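(* Let $\lambda$ and $\mu$ be partitions of $n$. Then $$\chi^\lambda_\mu=\sum_{\rho\subseteq\lambda}\frac{(-1)^{|\rho|}\,\pi_\mu(\rho)}{H_\rho\,H_{\lambda/\rho}}\qquad\text{and}\qquad K_{\lambda\mu}=\sum_{\rho\subseteq\lambda}\frac{(-1)^{|\lambda/\rho|}\,\varkappa_\mu(\rho)}{H_\rho\,H_{\lambda/\rho}},$$ where the sums are over partitions $\rho$ contained in $\lambda$.
   Context: $\chi^\lambda_\mu$ is the value of the irreducible character of the symmetric group $\mathfrak S_n$ indexed by $\lambda$ on permutations of cycle type $\mu$, and $K_{\lambda\mu}$ are the Kostka numbers. $|\theta|$ denotes the number of boxes of a (skew) diagram $\theta$. For any skew diagram $\theta$ let $\dim\theta$ be the number of standard $\theta$-tableaux (row and column strict) with entries in $\{1,2,\dots,|\theta|\}$, and set $H_\theta=|\theta|!/\dim\theta$ (so $H_\theta=1$ for the empty diagram). For partitions $\mu=(1^{m_1}2^{m_2}\dots r^{m_r})$ and $\rho=(\rho_1,\dots,\rho_l)$ (with $\rho_i=0$ for $i>l$) set $$\pi_\mu(\rho)=\prod_{k=1}^r\Big((1-\rho_1)^k+\dots+(l-\rho_l)^k-1^k-\dots-l^k\Big)^{m_k}$$ and $$\varkappa_\mu(\rho)=\prod_{k=1}^r\Big(\sum_{i_1\geqslant\dots\geqslant i_k\geqslant 1}\rho_{i_1}(\rho_{i_2}-1)\cdots(\rho_{i_k}-k+1)\Big)^{m_k}.$$ *)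

theory Defs
  imports
    Complex_Main
    "HOL-Library.FuncSet"
    "HOL-Library.Multiset"
    "HOL-Library.Function_Algebras"
    "HOL-Combinatorics.Combinatorics"
begin

section \<open>Partitions, diagrams and tableaux\<close>

text \<open>A partition is the weakly decreasing list of its (nonzero) parts. Parts and boxes are
  numbered from 1, so that box \<open>(i, j)\<close> lies in row \<open>i\<close> and column \<open>j\<close>.\<close>

definition partition_of :: "nat \<Rightarrow> nat list \<Rightarrow> bool" where
  "partition_of n lam \<longleftrightarrow> sorted_wrt (\<ge>) lam \<and> 0 \<notin> set lam \<and> sum_list lam = n"

definition is_partition :: "nat list \<Rightarrow> bool" where
  "is_partition lam \<longleftrightarrow> partition_of (sum_list lam) lam"

definition part :: "nat list \<Rightarrow> nat \<Rightarrow> nat" where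
  "part lam i = (if 1 \<le> i \<and> i \<le> length lam then lam ! (i - 1) else 0)"

definition diagram :: "nat list \<Rightarrow> (nat \<times> nat) set" where
  "diagram lam = {(i, j). 1 \<le> i \<and> 1 \<le> j \<and> j \<le> part lam i}"

definition standard_tableaux :: "(nat \<times> nat) set \<Rightarrow> (nat \<times> nat \<Rightarrow> nat) set" where
  "standard_tableaux \<theta> = {T \<in> \<theta> \<rightarrow>\<^sub>E {1..card \<theta>}. bij_betw T \<theta> {1..card \<theta>} \<and>
     (\<forall>i j j'. (i, j) \<in> \<theta> \<and> (i, j') \<in> \<theta> \<and> j < j' \<longrightarrow> T (i, j) < T (i, j')) \<and>
     (\<forall>i i' j. (i, j) \<in> \<theta> \<and> (i', j) \<in> \<theta> \<and> i < i' \<longrightarrow> T (i, j) < T (i', j))}"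

definition dim_diagram :: "(nat \<times> nat) set \<Rightarrow> nat" where
  "dim_diagram \<theta> = card (standard_tableaux \<theta>)"

definition H_diag :: "(nat \<times> nat) set \<Rightarrow> real" where
  "H_diag \<theta> = fact (card \<theta>) / real (dim_diagram \<theta>)"

definition semistandard_tableaux :: "nat list \<Rightarrow> nat list \<Rightarrow> (nat \<times> nat \<Rightarrow> nat) set" where
  "semistandard_tableaux lam mu = {T \<in> diagram lam \<rightarrow>\<^sub>E {1..length mu}.
     (\<forall>i j j'. (i, j) \<in> diagram lam \<and> (i, j') \<in> diagram lam \<and> j < j' \<longrightarrow> T (i, j) \<le> T (i, j')) \<and>
     (\<forall>i i' j. (i, j) \<in> diagram lam \<and> (i', j) \<in> diagram lam \<and> i < i' \<longrightarrow> T (i, j) < T (i', j)) \<and>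
     (\<forall>k\<in>{1..length mu}. card {c \<in> diagram lam. T c = k} = part mu k)}"

definition kostka :: "nat list \<Rightarrow> nat list \<Rightarrow> nat" where
  "kostka lam mu = card (semistandard_tableaux lam mu)"


section \<open>The functions \<open>\<pi>\<close> and \<open>\<kappa>\<close>\<close>

text \<open>In both products \<open>count_list mu k\<close> is the multiplicity \<open>m\<^sub>k\<close>; values \<open>k\<close> with
  \<open>m\<^sub>k = 0\<close> contribute a factor 1 and are left out.\<close>

definition pi_part :: "nat list \<Rightarrow> nat list \<Rightarrow> int" where
  "pi_part mu rho = (\<Prod>k\<in>set mu.
     ((\<Sum>i=1..length rho. (int i - int (part rho i)) ^ k) - (\<Sum>i=1..length rho. int i ^ k))
       ^ count_list mu k)"

text \<open>The inner sum runs over the index sequences \<open>i\<^sub>1 \<ge> \<dots> \<ge> i\<^sub>k \<ge> 1\<close>, as lists \<open>is\<close> with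
  0-based positions: \<open>i\<^sub>1 = is ! 0\<close>, and so on. The terms with \<open>i\<^sub>1 > length rho\<close> vanish, because
  their factor \<open>\<rho>\<close> at \<open>i\<^sub>1\<close> is 0; restricting to \<open>i\<^sub>1 \<le> length rho\<close> makes the sum finite.\<close>

definition kappa_part :: "nat list \<Rightarrow> nat list \<Rightarrow> int" where
  "kappa_part mu rho = (\<Prod>k\<in>set mu.
     (\<Sum>is\<in>{is. length is = k \<and> sorted_wrt (\<ge>) is \<and> set is \<subseteq> {1..length rho}}.
        \<Prod>j<k. int (part rho (is ! j)) - int j)
       ^ count_list mu k)"


section \<open>Traces on subspaces of function spaces\<close>

interpretation cfun: vector_space "\<lambda>(c::complex) (f::'a \<Rightarrow> complex) x. c * f x"
  by unfold_locales (auto simp: fun_eq_iff algebra_simps)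

text \<open>The trace of a linear operator \<open>T\<close> that maps the finite-dimensional subspace \<open>V\<close> to itself,
  computed in an arbitrarily chosen basis of \<open>V\<close>.\<close>

definition trace_on ::
  "('a \<Rightarrow> complex) set \<Rightarrow> (('a \<Rightarrow> complex) \<Rightarrow> ('a \<Rightarrow> complex)) \<Rightarrow> complex" where
  "trace_on V T =
     (let B = (SOME B. B \<subseteq> V \<and> cfun.independent B \<and> cfun.span B = V)
      in \<Sum>b\<in>B. cfun.representation B (T b) b)"


section \<open>Irreducible characters of the symmetric groups\<close>

text \<open>The symmetric group of degree \<open>n\<close> is \<open>{p. p permutes {1..n}}\<close>. An element of its complex
  group algebra is given by its coefficient function, which vanishes off the group.\<close>

definition group_alg :: "nat \<Rightarrow> ((nat \<Rightarrow> nat) \<Rightarrow> complex) set" where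
  "group_alg n = {f. \<forall>p. \<not> p permutes {1..n} \<longrightarrow> f p = 0}"

definition group_elem :: "(nat \<Rightarrow> nat) \<Rightarrow> (nat \<Rightarrow> nat) \<Rightarrow> complex" where
  "group_elem p = (\<lambda>q. if q = p then 1 else 0)"

definition conv ::
  "nat \<Rightarrow> ((nat \<Rightarrow> nat) \<Rightarrow> complex) \<Rightarrow> ((nat \<Rightarrow> nat) \<Rightarrow> complex) \<Rightarrow> (nat \<Rightarrow> nat) \<Rightarrow> complex" where
  "conv n f g = (\<lambda>p. \<Sum>q | q permutes {1..n}. f q * g (inv q \<circ> p))"

text \<open>The tableau of shape \<open>lam\<close> that contains \<open>1, 2, \<dots>\<close> in reading order, row by row.\<close>

definition canonical_tableau :: "nat list \<Rightarrow> nat \<times> nat \<Rightarrow> nat" where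
  "canonical_tableau lam = (\<lambda>(i, j). (\<Sum>k=1..<i. part lam k) + j)"

definition row_group :: "nat list \<Rightarrow> (nat \<Rightarrow> nat) set" where
  "row_group lam = {p. p permutes {1..sum_list lam} \<and>
     (\<forall>i j. (i, j) \<in> diagram lam \<longrightarrow> (\<exists>j'. (i, j') \<in> diagram lam \<and>
        p (canonical_tableau lam (i, j)) = canonical_tableau lam (i, j')))}"

definition column_group :: "nat list \<Rightarrow> (nat \<Rightarrow> nat) set" where
  "column_group lam = {p. p permutes {1..sum_list lam} \<and>
     (\<forall>i j. (i, j) \<in> diagram lam \<longrightarrow> (\<exists>i'. (i', j) \<in> diagram lam \<and>
        p (canonical_tableau lam (i, j)) = canonical_tableau lam (i', j)))}"

definition young_symmetrizer :: "nat list \<Rightarrow> (nat \<Rightarrow> nat) \<Rightarrow> complex" where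
  "young_symmetrizer lam = conv (sum_list lam)
     (\<Sum>p\<in>row_group lam. group_elem p)
     (\<Sum>q\<in>column_group lam. (\<lambda>x. of_int (sign q) * group_elem q x))"

text \<open>The irreducible module (Specht module) indexed by \<open>lam\<close>, realized as the left ideal of the
  group algebra generated by the Young symmetrizer. With this convention the partition \<open>(n)\<close>
  gives the trivial representation and \<open>(1\<^sup>n)\<close> the sign representation.\<close>

definition specht_module :: "nat list \<Rightarrow> ((nat \<Rightarrow> nat) \<Rightarrow> complex) set" where
  "specht_module lam =
     (\<lambda>x. conv (sum_list lam) x (young_symmetrizer lam)) ` group_alg (sum_list lam)"

text \<open>The value at \<open>p\<close> of the irreducible character indexed by \<open>lam\<close>.\<close>

definition irr_character :: "nat list \<Rightarrow> (nat \<Rightarrow> nat) \<Rightarrow> complex" where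
  "irr_character lam p = trace_on (specht_module lam) (conv (sum_list lam) (group_elem p))"

definition has_cycle_type :: "nat \<Rightarrow> (nat \<Rightarrow> nat) \<Rightarrow> nat list \<Rightarrow> bool" where
  "has_cycle_type n p mu \<longleftrightarrow>
     p permutes {1..n} \<and> image_mset card (mset_set (orbit p ` {1..n})) = mset mu"

end

theory Submission imports Defs begin

text \<open>
  Partitions with at most \<open>N\<close> rows index the alternants \<open>a\<close> with exponent \<open>\<lambda> + \<delta>\<close> in \<open>N\<close> variables.
  Multiplication by \<open>p\<^sub>1\<close> adds a box, so \<open>exp p\<^sub>1\<close> applied to the Vandermonde determinant has
  coefficients \<open>1 / H\<close>, and \<open>exp (- p\<^sub>1)\<close> produces the signs and the factors of the skew shapes.
  A shifted symmetric function acts as a diagonal operator \<open>G\<close>, and both sums in the statement are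
  coefficients of \<open>exp (- p\<^sub>1) G exp p\<^sub>1\<close> applied to the Vandermonde determinant. In degree \<open>n\<close> only the
  \<open>n\<close>-fold commutator of \<open>G\<close> with \<open>p\<^sub>1\<close> survives, which is multiplication by the leading term
  of \<open>G\<close>: up to sign the power sum \<open>p\<^sub>\<mu>\<close> for \<open>\<pi>\<close> and the complete symmetric function
  \<open>h\<^sub>\<mu>\<close> for \<open>\<kappa>\<close>. For \<open>h\<^sub>\<mu>\<close> the Pieri rule gives the Kostka number.

  For \<open>p\<^sub>\<mu>\<close> the coefficient is an alternating sum \<open>\<omega>\<close> of permutation characters. The character
  \<open>\<chi>\<close> of the left ideal of the Young symmetrizer \<open>c\<close> is an average of the coefficients of \<open>c\<close> over
  conjugates. The dominance order and von Neumann's lemma give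
  \<open>\<langle>\<chi>, \<chi>\<rangle> = \<langle>\<chi>, \<omega>\<rangle> = \<langle>\<omega>, \<omega>\<rangle> = 1\<close>, so that \<open>\<chi> - \<omega>\<close> has norm 0. No completeness of the
  irreducible characters is needed.
\<close>

section \<open>Difference operators and their symbols\<close>

text \<open>Polynomials are handled as coefficient functions on integer points: multiplication by a
  symmetric function is a sum of translations, the operator \<open>G\<close> is a pointwise product,
  and both kinds live in one algebra. Translations commute, and the commutator of a coordinate with
  \<open>p_1\<close> is a translation, so every commutator lowers the degree of a polynomial
  coefficient by one; the top term collects the factor \<open>n!\<close>. The obstacle is that
  adding boxes leads out of the set of partitions. Alternating functions vanish at the neighbouring
  points outside, and shifted symmetry of \<open>G\<close> is what keeps functions alternating. On
  the character side, \<open>\<chi>\<close> and \<open>\<omega>\<close> are both paired with the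
  permutation characters of words with content \<open>\<lambda> - id + w\<close>. For
  \<open>w \<noteq> id\<close> such a content is not dominated by \<open>\<lambda>\<close>, so only
  \<open>w = id\<close> survives. The scalar \<open>h\<close> in \<open>c c = h c\<close> cancels
  from all pairings once it is known to be nonzero, which follows from a positivity argument because
  \<open>c\<close> has real coefficients.\<close>

type_synonym point = "nat \<Rightarrow> int"
type_synonym operator = "(point \<Rightarrow> real) \<Rightarrow> point \<Rightarrow> real"

definition lower :: "nat \<Rightarrow> point \<Rightarrow> point" where
  "lower i x = x(i := x i - 1)"

text \<open>If \<open>F x\<close> is read as the coefficient of the monomial with exponent vector
  \<open>x + \<delta>\<close>, evaluation at \<open>lower i x\<close> is multiplication by the
  \<open>i\<close>-th variable; \<open>add_box N\<close> is then multiplication by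
  \<open>p_1\<close>.\<close>

definition shift_op :: "nat \<Rightarrow> operator" where
  "shift_op i F = (\<lambda>x. F (lower i x))"

definition mult_op :: "(point \<Rightarrow> real) \<Rightarrow> operator" where
  "mult_op G F = (\<lambda>x. G x * F x)"

definition add_box :: "nat \<Rightarrow> operator" where
  "add_box N F = (\<lambda>x. \<Sum>i=1..N. F (lower i x))"

definition lin_op :: "operator \<Rightarrow> bool" where
  "lin_op X \<longleftrightarrow> (\<forall>F G. X (\<lambda>x. F x + G x) = (\<lambda>x. X F x + X G x)) \<and>
     (\<forall>c F. X (\<lambda>x. c * F x) = (\<lambda>x. c * X F x))"

text \<open>The order of the two terms gives a coordinate function the commutator
  \<open>shift_op i\<close> without a sign.\<close>

definition ad_op :: "nat \<Rightarrow> operator \<Rightarrow> operator" where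
  "ad_op N X = (\<lambda>F x. X (add_box N F) x - add_box N (X F) x)"

text \<open>The operator \<open>X\<close> has order at most \<open>k\<close> with respect to commutators with \<open>add_box N\<close>,
  and its \<open>k\<close>-fold commutator is \<open>k!\<close> times \<open>Z\<close>.\<close>

fun has_symbol :: "nat \<Rightarrow> nat \<Rightarrow> operator \<Rightarrow> operator \<Rightarrow> bool" where
  "has_symbol N 0 X Z \<longleftrightarrow> X = Z \<and> ad_op N X = (\<lambda>F x. 0)"
| "has_symbol N (Suc k) X Z \<longleftrightarrow> has_symbol N k (ad_op N X) (\<lambda>F x. real (Suc k) * Z F x)"

section \<open>Linearity and the calculus of symbols\<close>

lemma lin_opI:
  assumes "\<And>F G x. X (\<lambda>x. F x + G x) x = X F x + X G x" "\<And>c F x. X (\<lambda>x. c * F x) x = c * X F x"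
  shows "lin_op X"
  using assms unfolding lin_op_def by blast

lemma lin_op_add: "lin_op X \<Longrightarrow> X (\<lambda>x. F x + G x) = (\<lambda>x. X F x + X G x)"
  and lin_op_scale: "lin_op X \<Longrightarrow> X (\<lambda>x. c * F x) = (\<lambda>x. c * X F x)"
  by (simp_all add: lin_op_def)

lemma lin_op_zero: "lin_op X \<Longrightarrow> X (\<lambda>x. 0) = (\<lambda>x. 0)"
  using lin_op_scale[of X 0 "\<lambda>x. 0"] by simp

lemma lin_op_diff: "lin_op X \<Longrightarrow> X (\<lambda>x. F x - G x) = (\<lambda>x. X F x - X G x)"
  using lin_op_add[of X F "\<lambda>x. (-1) * G x"] lin_op_scale[of X "-1" G] by (simp add: fun_eq_iff)

lemma lin_shift: "lin_op (shift_op i)"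
  by (rule lin_opI) (auto simp: shift_op_def)

lemma lin_mult: "lin_op (mult_op G)"
  by (rule lin_opI) (auto simp: mult_op_def algebra_simps)

lemma lin_add_box: "lin_op (add_box N)"
  by (rule lin_opI) (auto simp: add_box_def sum.distrib sum_distrib_left)

lemma lin_id: "lin_op (\<lambda>F. F)"
  by (rule lin_opI) auto

lemma lin_const_zero: "lin_op (\<lambda>F x. 0)"
  by (rule lin_opI) auto

lemma lin_comp: "lin_op X \<Longrightarrow> lin_op Y \<Longrightarrow> lin_op (\<lambda>F. X (Y F))"
  by (rule lin_opI) (auto simp: lin_op_add lin_op_scale)

lemma lin_plus: "lin_op X \<Longrightarrow> lin_op Y \<Longrightarrow> lin_op (\<lambda>F x. X F x + Y F x)"
  by (rule lin_opI) (auto simp: lin_op_add lin_op_scale algebra_simps)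

lemma lin_scale: "lin_op X \<Longrightarrow> lin_op (\<lambda>F x. c * X F x)"
  by (rule lin_opI) (auto simp: lin_op_add lin_op_scale algebra_simps)

lemma lin_pow: "lin_op X \<Longrightarrow> lin_op (X ^^ k)"
  by (induction k) (auto simp: lin_id id_def comp_def intro: lin_comp)

lemma lin_ad: "lin_op X \<Longrightarrow> lin_op (ad_op N X)"
  by (rule lin_opI) (auto simp: ad_op_def lin_op_add lin_op_scale lin_add_box algebra_simps)

lemma ad_plus: "ad_op N (\<lambda>F x. X F x + Y F x) = (\<lambda>F x. ad_op N X F x + ad_op N Y F x)"
  by (auto simp: ad_op_def fun_eq_iff lin_op_add[OF lin_add_box])

lemma ad_scale: "ad_op N (\<lambda>F x. c * X F x) = (\<lambda>F x. c * ad_op N X F x)"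
  by (auto simp: ad_op_def fun_eq_iff lin_op_scale[OF lin_add_box] algebra_simps)

lemma ad_zero: "ad_op N (\<lambda>F x. 0) = (\<lambda>F x. 0)"
  by (auto simp: ad_op_def fun_eq_iff lin_op_zero[OF lin_add_box])

lemma ad_comp:
  assumes "lin_op X"
  shows "ad_op N (\<lambda>F. X (Y F)) = (\<lambda>F x. ad_op N X (Y F) x + X (ad_op N Y F) x)"
  by (auto simp: ad_op_def fun_eq_iff lin_op_diff[OF assms])

lemma has_symbol_0D: "has_symbol N 0 X Z \<Longrightarrow> ad_op N X = (\<lambda>F x. 0)"
  unfolding has_symbol.simps by (rule conjunct2)

lemma has_symbol_zero: "has_symbol N k (\<lambda>F x. 0) (\<lambda>F x. 0)"
  by (induction k) (auto simp: ad_zero)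

lemma has_symbol_plus:
  "has_symbol N k X Z \<Longrightarrow> has_symbol N k Y W \<Longrightarrow>
   has_symbol N k (\<lambda>F x. X F x + Y F x) (\<lambda>F x. Z F x + W F x)"
proof (induction k arbitrary: X Y Z W)
  case (Suc k)
  from Suc.IH[of "ad_op N X" "\<lambda>F x. real (Suc k) * Z F x" "ad_op N Y" "\<lambda>F x. real (Suc k) * W F x"]
  show ?case using Suc.prems by (simp add: ad_plus distrib_left del: of_nat_Suc)
qed (auto simp: ad_plus)

lemma has_symbol_scale:
  "has_symbol N k X Z \<Longrightarrow> has_symbol N k (\<lambda>F x. c * X F x) (\<lambda>F x. c * Z F x)"
proof (induction k arbitrary: X Z)
  case (Suc k)
  from Suc.IH[of "ad_op N X" "\<lambda>F x. real (Suc k) * Z F x"] Suc.prems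
  show ?case by (simp add: ad_scale algebra_simps del: of_nat_Suc)
qed (auto simp: ad_scale)

lemma has_symbol_sum:
  assumes "\<And>a. a \<in> A \<Longrightarrow> has_symbol N k (X a) (Z a)"
  shows "has_symbol N k (\<lambda>F x. \<Sum>a\<in>A. X a F x) (\<lambda>F x. \<Sum>a\<in>A. Z a F x)"
  using assms
proof (induction A rule: infinite_finite_induct)
  case (insert a A)
  then show ?case by (auto intro: has_symbol_plus)
qed (auto simp: has_symbol_zero)

text \<open>An operator of order at most \<open>k\<close> is annihilated by \<open>k + 1\<close>
  commutators; this discards lower-order terms when operators of different orders are added.\<close>

lemma has_symbol_raise: "has_symbol N k X Z \<Longrightarrow> has_symbol N (Suc k) X (\<lambda>F x. 0)"
proof (induction k arbitrary: X Z)
  case (Suc k)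
  from Suc.IH[of "ad_op N X"] Suc.prems show ?case by (simp del: of_nat_Suc)
qed (auto simp: ad_zero)

lemma has_symbol_const:
  assumes "has_symbol N 0 X Z" "k > 0"
  shows "has_symbol N k X (\<lambda>F x. 0)"
proof -
  obtain j where "k = Suc j" using assms(2) by (cases k) auto
  moreover have "has_symbol N (Suc j) X (\<lambda>F x. 0)" for j
    by (induction j) (use assms(1) in \<open>blast intro: has_symbol_raise\<close>)+
  ultimately show ?thesis by blast
qed

text \<open>By the Leibniz rule the commutator of the product has two summands, with symbols
  \<open>k\<close> and \<open>m\<close> times the product of the symbols, and \<open>k + m\<close>
  is the factor that \<open>has_symbol\<close> demands in degree \<open>k + m\<close>. Either factor
  may be the one that is differentiated, hence the induction on the total degree.\<close>

lemma has_symbol_comp: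
  assumes "has_symbol N k X Z" "has_symbol N m Y W" "lin_op X" "lin_op Y" "lin_op Z"
  shows "has_symbol N (k + m) (\<lambda>F. X (Y F)) (\<lambda>F. Z (W F))"
  using assms
proof (induction "k + m" arbitrary: k m X Y Z W)
  case 0
  then show ?case by (auto simp: ad_comp lin_op_zero)
next
  case (Suc s)
  have L: "lin_op (ad_op N X)" "lin_op (ad_op N Y)" using Suc.prems lin_ad by auto
  \<comment> \<open>For \<open>k = 0\<close> the commutator vanishes together with the scalar
    \<open>real k\<close>, so the formula is uniform in \<open>k\<close>.\<close>
  have 1: "has_symbol N s (\<lambda>F. ad_op N X (Y F)) (\<lambda>F x. real k * Z (W F) x)"
  proof (cases k)
    case 0
    from Suc.prems(1)[unfolded 0] have "ad_op N X = (\<lambda>F x. 0)" by (rule has_symbol_0D)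
    then show ?thesis using 0 has_symbol_zero[of N s] by simp
  next
    case (Suc k')
    have "has_symbol N (k' + m) (\<lambda>F. ad_op N X (Y F)) (\<lambda>F. (\<lambda>F x. real (Suc k') * Z F x) (W F))"
      using Suc.prems L Suc \<open>Suc s = k + m\<close>
      by (intro Suc.hyps(1)) (auto intro: lin_scale simp del: of_nat_Suc)
    with Suc \<open>Suc s = k + m\<close> show ?thesis by (simp del: of_nat_Suc)
  qed
  have 2: "has_symbol N s (\<lambda>F. X (ad_op N Y F)) (\<lambda>F x. real m * Z (W F) x)"
  proof (cases m)
    case 0
    from Suc.prems(2)[unfolded 0] have "ad_op N Y = (\<lambda>F x. 0)" by (rule has_symbol_0D)
    then show ?thesis using 0 has_symbol_zero[of N s] by (simp add: lin_op_zero[OF Suc.prems(3)])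
  next
    case (Suc m')
    have "has_symbol N (k + m') (\<lambda>F. X (ad_op N Y F)) (\<lambda>F. Z ((\<lambda>F x. real (Suc m') * W F x) F))"
      using Suc.prems L Suc \<open>Suc s = k + m\<close>
      by (intro Suc.hyps(1)) (auto simp del: of_nat_Suc)
    with Suc \<open>Suc s = k + m\<close> Suc.prems show ?thesis by (simp add: lin_op_scale del: of_nat_Suc)
  qed
  have "has_symbol N s (ad_op N (\<lambda>F. X (Y F))) (\<lambda>F x. real (k + m) * Z (W F) x)"
    using has_symbol_plus[OF 1 2] unfolding ad_comp[OF Suc.prems(3), of N Y] by (simp add: algebra_simps)
  then show ?case by (simp only: Suc.hyps(2)[symmetric] has_symbol.simps)
qed

text \<open>Pascal's rule: the \<open>n\<close>-th difference of the first difference of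
  \<open>t\<close> is its difference of order \<open>n + 1\<close>.\<close>

lemma alternating_sum_Suc:
  fixes t :: "nat \<Rightarrow> real"
  shows "(\<Sum>j\<le>n. (-1) ^ (n - j) * real (n choose j) * (t (Suc j) - t j)) =
    (\<Sum>j\<le>Suc n. (-1) ^ (Suc n - j) * real (Suc n choose j) * t j)"
proof -
  have "(\<Sum>j\<le>Suc n. (-1) ^ (Suc n - j) * real (Suc n choose j) * t j) =
     (-1) ^ Suc n * t 0 + (\<Sum>j\<le>n. (-1) ^ (n - j) * real (Suc n choose Suc j) * t (Suc j))"
    by (subst sum.atMost_Suc_shift) simp
  also have "(\<Sum>j\<le>n. (-1) ^ (n - j) * real (Suc n choose Suc j) * t (Suc j)) =
     (\<Sum>j\<le>n. (-1) ^ (n - j) * real (n choose j) * t (Suc j)) +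
     (\<Sum>j\<le>n. (-1) ^ (n - j) * real (n choose Suc j) * t (Suc j))"
    by (simp add: algebra_simps sum.distrib)
  also have "(\<Sum>j\<le>n. (-1) ^ (n - j) * real (n choose Suc j) * t (Suc j)) =
      (\<Sum>j\<le>Suc n. (-1) ^ (Suc n - j) * real (n choose j) * t j) - (-1) ^ Suc n * t 0"
    by (subst sum.atMost_Suc_shift) simp
  also have "(\<Sum>j\<le>Suc n. (-1) ^ (Suc n - j) * real (n choose j) * t j) =
      - (\<Sum>j\<le>n. (-1) ^ (n - j) * real (n choose j) * t j)"
    by (simp add: Suc_diff_le sum_negf)
  finally show ?thesis
    by (simp add: algebra_simps sum_subtractf)
qed

text \<open>Composition with \<open>add_box N\<close> on the left commutes with composition on the
  right, so the \<open>n\<close>-fold commutator is a binomial sum; \<open>has_symbol\<close> says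
  that it is \<open>n!\<close> times the symbol.\<close>

lemma has_symbol_expand:
  assumes "has_symbol N n X Z" "lin_op X"
  shows "(\<Sum>j\<le>n. (-1) ^ (n - j) * real (n choose j) *
           (add_box N ^^ (n - j)) (X ((add_box N ^^ j) F)) x) = fact n * Z F x"
  using assms
proof (induction n arbitrary: X Z)
  case (Suc n)
  define t where "t j = (add_box N ^^ (Suc n - j)) (X ((add_box N ^^ j) F)) x" for j
  have ad_t: "(add_box N ^^ (n - j)) (ad_op N X ((add_box N ^^ j) F)) x = t (Suc j) - t j" if "j \<le> n" for j
    using that unfolding ad_op_def t_def
    by (simp add: lin_op_diff[OF lin_pow[OF lin_add_box]] Suc_diff_le funpow_swap1)
  have "(\<Sum>j\<le>Suc n. (-1) ^ (Suc n - j) * real (Suc n choose j) * t j) =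
      (\<Sum>j\<le>n. (-1) ^ (n - j) * real (n choose j) * (t (Suc j) - t j))"
    by (rule alternating_sum_Suc[symmetric])
  also have "\<dots> = (\<Sum>j\<le>n. (-1) ^ (n - j) * real (n choose j) *
           (add_box N ^^ (n - j)) (ad_op N X ((add_box N ^^ j) F)) x)"
    by (rule sum.cong[OF refl]) (simp only: ad_t atMost_iff)
  also have "\<dots> = fact n * (real (Suc n) * Z F x)"
    by (rule Suc.IH[of "ad_op N X" "\<lambda>F x. real (Suc n) * Z F x"])
      (use Suc.prems lin_ad in \<open>simp_all del: of_nat_Suc\<close>)
  also have "\<dots> = fact (Suc n) * Z F x" by simp
  finally show ?case unfolding t_def .
qed auto

section \<open>Symbols of multiplication operators\<close>

lemma mult_op_mult: "mult_op (\<lambda>x. G x * H x) = (\<lambda>F. mult_op G (mult_op H F))"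
  by (auto simp: mult_op_def fun_eq_iff)

lemma ad_mult_op:
  "ad_op N (mult_op G) = (\<lambda>F x. \<Sum>i=1..N. (G x - G (lower i x)) * F (lower i x))"
  by (auto simp: ad_op_def mult_op_def add_box_def fun_eq_iff sum_distrib_left sum_subtractf algebra_simps)

lemma lower_commute: "lower i (lower j x) = lower j (lower i x)"
  by (auto simp: lower_def fun_eq_iff)

lemma ad_shift_op: "ad_op N (shift_op i) = (\<lambda>F x. 0)"
  by (auto simp: ad_op_def shift_op_def add_box_def fun_eq_iff lower_commute)

lemma has_symbol_mult_const: "has_symbol N 0 (mult_op (\<lambda>x. c)) (\<lambda>F x. c * F x)"
  unfolding has_symbol.simps ad_mult_op by (auto simp: mult_op_def fun_eq_iff)

text \<open>Of the shifts in \<open>add_box N\<close> only the \<open>i\<close>-th changes the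
  coordinate \<open>x i\<close>, and it does so by 1; the additive constant cancels in the
  commutator.\<close>

lemma has_symbol_coord:
  assumes "i \<in> {1..N}"
  shows "has_symbol N 1 (mult_op (\<lambda>x. of_int (x i) + c)) (shift_op i)"
proof -
  have "ad_op N (mult_op (\<lambda>x. of_int (x i) + c)) = (\<lambda>F x. \<Sum>j=1..N. if j = i then F (lower j x) else 0)"
    unfolding ad_mult_op by (intro ext sum.cong) (auto simp: lower_def)
  also have "\<dots> = shift_op i"
    using assms by (auto simp: shift_op_def)
  finally show ?thesis by (simp add: ad_shift_op)
qed

lemma has_symbol_power:
  assumes "has_symbol N 1 (mult_op G) Z" "lin_op Z"
  shows "has_symbol N k (mult_op (\<lambda>x. G x ^ k)) (Z ^^ k)"
proof (induction k)
  case 0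
  have "Z ^^ 0 = (\<lambda>F x. 1 * F x)" by (auto simp: fun_eq_iff)
  with has_symbol_mult_const[of N 1] show ?case by (simp only: power_0)
next
  case (Suc k)
  from has_symbol_comp[OF assms(1) Suc lin_mult lin_mult assms(2)]
  show ?case by (simp add: mult_op_mult comp_def)
qed

lemma shift_op_pow: "(shift_op i ^^ k) F x = F (x(i := x i - int k))"
  by (induction k arbitrary: x) (auto simp: shift_op_def lower_def algebra_simps)

text \<open>Multiplication by the power sum \<open>p_k\<close>.\<close>

definition power_op :: "nat \<Rightarrow> nat \<Rightarrow> operator" where
  "power_op N k F = (\<lambda>x. \<Sum>i=1..N. F (x(i := x i - int k)))"

lemma lin_power_op: "lin_op (power_op N k)"
  by (rule lin_opI) (auto simp: power_op_def sum.distrib sum_distrib_left)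

text \<open>The factor of \<pi> that belongs to one part \<open>k\<close>. Subtracting
  \<open>real i ^ k\<close> row by row makes empty rows contribute 0, so trailing empty rows up to
  \<open>N\<close> do no harm.\<close>

definition pi_fun :: "nat \<Rightarrow> nat \<Rightarrow> point \<Rightarrow> real" where
  "pi_fun N k x = (\<Sum>i=1..N. (real i - of_int (x i)) ^ k - real i ^ k)"

text \<open>The sign comes from writing \<open>i - x i\<close> as the negative of a coordinate plus
  a constant. The subtracted powers of \<open>i\<close> have order 0 and drop out because
  \<open>k > 0\<close>.\<close>

lemma has_symbol_pi_fun:
  assumes "k > 0"
  shows "has_symbol N k (mult_op (pi_fun N k)) (\<lambda>F x. (-1) ^ k * power_op N k F x)"
proof -
  have 1: "has_symbol N k (mult_op (\<lambda>x. (real i - of_int (x i)) ^ k - real i ^ k))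
      (\<lambda>F x. (-1) ^ k * F (x(i := x i - int k)))" if "i \<in> {1..N}" for i
  proof -
    have "has_symbol N k (mult_op (\<lambda>x. (of_int (x i) + (- real i)) ^ k)) (shift_op i ^^ k)"
      by (intro has_symbol_power has_symbol_coord lin_shift that)
    then have a: "has_symbol N k (\<lambda>F x. (-1) ^ k * mult_op (\<lambda>x. (of_int (x i) + (- real i)) ^ k) F x)
       (\<lambda>F x. (-1) ^ k * (shift_op i ^^ k) F x)" by (rule has_symbol_scale)
    have b: "has_symbol N k (mult_op (\<lambda>x. - (real i ^ k))) (\<lambda>F x. 0)"
      using has_symbol_const[OF has_symbol_mult_const assms] .
    have c: "(-1) ^ k * (y + (- real i)) ^ k = (real i - y) ^ k" for y
      by (simp flip: power_mult_distrib)
    have "mult_op (\<lambda>x. (real i - of_int (x i)) ^ k - real i ^ k) = (\<lambda>F x. (-1) ^ k *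
        mult_op (\<lambda>x. (of_int (x i) + (- real i)) ^ k) F x + mult_op (\<lambda>x. - (real i ^ k)) F x)"
      unfolding c[symmetric] by (auto simp: mult_op_def algebra_simps fun_eq_iff)
    then show ?thesis
      using has_symbol_plus[OF a b] by (simp add: shift_op_pow)
  qed
  have "mult_op (pi_fun N k) =
      (\<lambda>F x. \<Sum>i=1..N. mult_op (\<lambda>x. (real i - of_int (x i)) ^ k - real i ^ k) F x)"
    by (simp add: pi_fun_def mult_op_def sum_distrib_right fun_eq_iff)
  then show ?thesis
    using has_symbol_sum[of "{1..N}" N k _ "\<lambda>i F x. (-1) ^ k * F (x(i := x i - int k))", OF 1]
    by (simp add: power_op_def sum_distrib_left)
qed

lemma has_symbol_prod:
  assumes "\<And>k. k \<in> set mu \<Longrightarrow> has_symbol N k (mult_op (g k)) (Z k)" "\<And>k. lin_op (Z k)"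
  shows "has_symbol N (sum_list mu) (mult_op (\<lambda>x. prod_list (map (\<lambda>k. g k x) mu))) (fold Z mu)"
  using assms(1)
\<comment> \<open>\<open>fold\<close> applies the operator of the last part outermost, so parts are
  removed at the end.\<close>
proof (induction mu rule: rev_induct)
  case Nil
  have "fold Z [] = (\<lambda>F x. 1 * F x)" by (auto simp: fun_eq_iff)
  with has_symbol_mult_const[of N 1] show ?case by (simp only: list.map prod_list.Nil sum_list.Nil)
next
  case (snoc k mu)
  have "has_symbol N (k + sum_list mu) (\<lambda>F. mult_op (g k) (mult_op (\<lambda>x. prod_list (map (\<lambda>k. g k x) mu)) F))
     (\<lambda>F. Z k (fold Z mu F))"
    using snoc by (intro has_symbol_comp) (auto simp: lin_mult assms(2))
  then show ?case
    by (simp add: mult_op_mult[symmetric] ac_simps comp_def)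
qed

section \<open>The complete shifted symmetric functions\<close>

text \<open>\<open>hop N k\<close> is the complete symmetric polynomial of degree \<open>k\<close> in the first \<open>N\<close> shift operators
  and \<open>kap N k 0\<close> its shifted analogue, the inner sum in \<open>\<kappa>\<close>. The parameter \<open>a\<close> counts the
  factors that have been split off.\<close>

fun hop :: "nat \<Rightarrow> nat \<Rightarrow> operator" where
  "hop N 0 = (\<lambda>F. F)"
| "hop 0 (Suc k) = (\<lambda>F x. 0)"
| "hop (Suc N) (Suc k) = (\<lambda>F x. shift_op (Suc N) (hop (Suc N) k F) x + hop N (Suc k) F x)"

fun kap :: "nat \<Rightarrow> nat \<Rightarrow> real \<Rightarrow> point \<Rightarrow> real" where
  "kap N 0 a x = 1"
| "kap 0 (Suc k) a x = 0"
| "kap (Suc N) (Suc k) a x = (of_int (x (Suc N)) - a) * kap (Suc N) k (a + 1) x + kap N (Suc k) a x"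

lemma lin_hop: "lin_op (hop N k)"
proof (induction N k rule: hop.induct)
  case (3 N k)
  then show ?case
    unfolding hop.simps by (intro lin_plus[OF lin_comp[OF lin_shift]])
qed (auto intro: lin_id lin_const_zero)

text \<open>\<open>kap\<close> and \<open>hop\<close> obey the same recursion. The parameter
  \<open>a\<close> enters each factor as an additive constant and leaves no trace in the symbol.
  \<open>N'\<close> stays fixed while the recursion lowers \<open>N\<close>.\<close>

lemma has_symbol_kap: "N \<le> N' \<Longrightarrow> has_symbol N' k (mult_op (kap N k a)) (hop N k)"
proof (induction N k arbitrary: a rule: hop.induct)
  case (1 N)
  have "kap N 0 a = (\<lambda>x. 1)" "hop N 0 = (\<lambda>F x. 1 * F x)" by (auto simp: fun_eq_iff)
  then show ?case using has_symbol_mult_const[of N' 1] by (simp only:)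
next
  case (2 k)
  have "mult_op (kap 0 (Suc k) a) = (\<lambda>F x. 0)" by (auto simp: mult_op_def fun_eq_iff)
  then show ?case using has_symbol_zero[of N' "Suc k"] by (simp only: hop.simps)
next
  case (3 N k)
  have 1: "has_symbol N' 1 (mult_op (\<lambda>x. of_int (x (Suc N)) + (- a))) (shift_op (Suc N))"
    by (rule has_symbol_coord) (use 3 in auto)
  have 2: "has_symbol N' (1 + k) (\<lambda>F. mult_op (\<lambda>x. of_int (x (Suc N)) + (- a)) (mult_op (kap (Suc N) k (a + 1)) F))
     (\<lambda>F. shift_op (Suc N) (hop (Suc N) k F))"
    by (intro has_symbol_comp 1 3 lin_mult lin_shift)
  have "mult_op (kap (Suc N) (Suc k) a) = (\<lambda>F x. mult_op (\<lambda>x. of_int (x (Suc N)) + (- a))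
      (mult_op (kap (Suc N) k (a + 1)) F) x + mult_op (kap N (Suc k) a) F x)"
    by (auto simp: mult_op_def fun_eq_iff algebra_simps)
  then show ?case
    using has_symbol_plus[OF 2[unfolded plus_1_eq_Suc] 3(2)[OF Suc_leD[OF 3(3)], of a]]
    by (simp only: hop.simps)
qed

lemma kap_cong: "(\<And>i. i \<in> {1..N} \<Longrightarrow> x i = y i) \<Longrightarrow> kap N k a x = kap N k a y"
  by (induction N k a x rule: kap.induct) auto

text \<open>With parameter 0, every term gained from a new index has that coordinate itself as its
  first factor, and this is 0.\<close>

lemma kap_extend:
  assumes "M \<le> N" "\<And>i. i \<in> {M<..N} \<Longrightarrow> x i = 0"
  shows "kap N k 0 x = kap M k 0 x"
  using assms
proof (induction N rule: dec_induct)
  case (step N)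
  then show ?case by (cases k) auto
qed auto

definition decreasing_lists :: "nat \<Rightarrow> nat \<Rightarrow> nat list set" where
  "decreasing_lists N k = {is. length is = k \<and> sorted_wrt (\<ge>) is \<and> set is \<subseteq> {1..N}}"

lemma finite_decreasing_lists: "finite (decreasing_lists N k)"
  by (rule finite_subset[OF _ finite_lists_length_eq[of "{1..N}" k]]) (auto simp: decreasing_lists_def)

lemma decreasing_lists_Suc:
  "decreasing_lists (Suc N) (Suc k) =
     (#) (Suc N) ` decreasing_lists (Suc N) k \<union> decreasing_lists N (Suc k)"
proof (intro set_eqI iffI)
  fix js assume js: "js \<in> decreasing_lists (Suc N) (Suc k)"
  then obtain i is' where e: "js = i # is'" by (auto simp: decreasing_lists_def length_Suc_conv)
  show "js \<in> (#) (Suc N) ` decreasing_lists (Suc N) k \<union> decreasing_lists N (Suc k)"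
  proof (cases "i = Suc N")
    case True
    then show ?thesis using js e by (auto simp: decreasing_lists_def)
  next
    case False
    then have "i \<le> N" using js e by (auto simp: decreasing_lists_def)
    then show ?thesis using js e by (fastforce simp: decreasing_lists_def)
  qed
qed (fastforce simp: decreasing_lists_def)+

lemma kap_eq_sum:
  "kap N k a x = (\<Sum>is\<in>decreasing_lists N k. \<Prod>j<k. of_int (x (is ! j)) - a - real j)"
proof (induction N k a x rule: kap.induct)
  case (1 N a x)
  have "decreasing_lists N 0 = {[]}" by (auto simp: decreasing_lists_def)
  then show ?case by simp
next
  case (2 k a x)
  have "decreasing_lists 0 (Suc k) = {}" by (auto simp: decreasing_lists_def)
  then show ?case by simp
next
  case (3 N k a x)
  have d: "(#) (Suc N) ` decreasing_lists (Suc N) k \<inter> decreasing_lists N (Suc k) = {}"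
    by (auto simp: decreasing_lists_def)
  \<comment> \<open>Behind the head \<open>Suc N\<close> all positions move by one, which accounts
    for \<open>a + 1\<close>.\<close>
  have p: "(\<Prod>j<Suc k. of_int (x ((Suc N # js) ! j)) - a - real j) =
      (of_int (x (Suc N)) - a) * (\<Prod>j<k. of_int (x (js ! j)) - (a + 1) - real j)" for js
    by (simp add: prod.lessThan_Suc_shift diff_diff_eq add.assoc del: prod.lessThan_Suc)
  have "(\<Sum>is\<in>decreasing_lists (Suc N) (Suc k). \<Prod>j<Suc k. of_int (x (is ! j)) - a - real j) =
      (\<Sum>is\<in>decreasing_lists (Suc N) k. \<Prod>j<Suc k. of_int (x ((Suc N # is) ! j)) - a - real j) +
      kap N (Suc k) a x"
    unfolding decreasing_lists_Suc
    by (subst sum.union_disjoint[OF _ _ d]) (simp_all add: finite_decreasing_lists sum.reindex 3)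
  also have "\<dots> = kap (Suc N) (Suc k) a x"
    by (simp add: p sum_distrib_left 3 del: prod.lessThan_Suc)
  finally show ?case ..
qed

text \<open>In the coordinates \<open>x j - j\<close> this exchanges the entries at \<open>i\<close>
  and \<open>Suc i\<close>; invariance under these swaps is shifted symmetry.\<close>

definition swap_rows :: "nat \<Rightarrow> point \<Rightarrow> point" where
  "swap_rows i x = x(i := x (Suc i) - 1, Suc i := x i + 1)"

text \<open>\<open>kap (Suc N)\<close> with its last variable, already reduced by \<open>a\<close>,
  replaced by a free real \<open>z\<close>. This allows values at two different entries to be
  compared in one identity.\<close>

fun kap_last :: "nat \<Rightarrow> point \<Rightarrow> real \<Rightarrow> nat \<Rightarrow> real \<Rightarrow> real" where
  "kap_last N x z 0 a = 1"
| "kap_last N x z (Suc k) a = z * kap_last N x (z - 1) k (a + 1) + kap N (Suc k) a x"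

lemma kap_Suc_eq: "kap (Suc N) k a x = kap_last N x (of_int (x (Suc N)) - a) k a"
  by (induction k arbitrary: a) (auto simp: algebra_simps)

text \<open>The shifted version of
  \<open>(y - u) * h_k(.., u, y) = y * h_k(.., y) - u * h_k(.., u)\<close>. Replacing
  \<open>(u, y)\<close> by \<open>(y - 1, u + 1)\<close> negates both the factor on the left and the
  right-hand side, so the symmetry hidden in the recursion becomes visible.\<close>

lemma kap_Suc_Suc:
  fixes a :: real and N :: nat and x :: point
  defines "u \<equiv> of_int (x (Suc N))" and "y \<equiv> of_int (x (Suc (Suc N)))"
  shows "(y - u - 1) * kap (Suc (Suc N)) k a x =
    (y - a) * kap_last N x (y - a - 1) k a - (u + 1 - a) * kap_last N x (u - a) k a"
proof (induction k arbitrary: a)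
  case (Suc k)
  have e: "u - (a + 1) = u - a - 1" "y - (a + 1) - 1 = y - a - 1 - 1" by simp_all
  have "(y - u - 1) * kap (Suc (Suc N)) (Suc k) a x =
     (y - a) * ((y - u - 1) * kap (Suc (Suc N)) k (a + 1) x) + (y - u - 1) * kap (Suc N) (Suc k) a x"
    by (simp add: y_def algebra_simps)
  also have "kap (Suc N) (Suc k) a x = kap_last N x (u - a) (Suc k) a"
    unfolding kap_Suc_eq u_def ..
  also have "(y - a) * ((y - u - 1) * kap (Suc (Suc N)) k (a + 1) x) +
      (y - u - 1) * kap_last N x (u - a) (Suc k) a = (y - a) * ((y - (a + 1)) * kap_last N x (y - (a + 1) - 1) k (a + 1) -
      (u + 1 - (a + 1)) * kap_last N x (u - (a + 1)) k (a + 1)) +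
      (y - u - 1) * kap_last N x (u - a) (Suc k) a"
    unfolding Suc ..
  finally show ?case unfolding e by (simp add: algebra_simps)
qed (simp add: algebra_simps)

lemma kap_last_cong: "(\<And>i. i \<in> {1..N} \<Longrightarrow> x i = y i) \<Longrightarrow> kap_last N x z k a = kap_last N y z k a"
proof (induction k arbitrary: z a)
  case (Suc k)
  then show ?case using kap_cong[of N x y "Suc k" a] by auto
qed auto

lemma kap_swap_last: "kap (Suc (Suc N)) k a (swap_rows (Suc N) x) = kap (Suc (Suc N)) k a x"
\<comment> \<open>If the factor \<open>y - u - 1\<close> vanishes it cannot be cancelled, but then
  the swap fixes the point.\<close>
proof (cases "x (Suc (Suc N)) = x (Suc N) + 1")
  case True
  then have "swap_rows (Suc N) x = x" by (auto simp: swap_rows_def fun_eq_iff)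
  then show ?thesis by simp
next
  case False
  let ?s = "swap_rows (Suc N) x"
  have c: "kap_last N ?s z k a = kap_last N x z k a" for z k a
    by (rule kap_last_cong) (auto simp: swap_rows_def)
  have "(of_int (x (Suc (Suc N))) - of_int (x (Suc N)) - 1) * kap (Suc (Suc N)) k a ?s =
     (of_int (x (Suc (Suc N))) - of_int (x (Suc N)) - 1) * kap (Suc (Suc N)) k a x"
    using kap_Suc_Suc[of ?s N k a] kap_Suc_Suc[of x N k a] unfolding c
    by (simp add: swap_rows_def algebra_simps)
  moreover have "real_of_int (x (Suc (Suc N))) - of_int (x (Suc N)) - 1 \<noteq> 0"
    using False by linarith
  ultimately show ?thesis by simp
qed

lemma kap_swap: "1 \<le> i \<Longrightarrow> i < N \<Longrightarrow> kap N k a (swap_rows i x) = kap N k a x"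
proof (induction N k a x rule: kap.induct)
  case (3 N k a x)
  show ?case
  proof (cases "i = N")
    case True
    then obtain M where "N = Suc M" using 3 by (cases N) auto
    show ?thesis unfolding True \<open>N = Suc M\<close> by (rule kap_swap_last)
  next
    case False
    then have "i < N" using 3 by auto
    then show ?thesis using 3 by (auto simp: swap_rows_def)
  qed
qed auto

lemma pi_fun_swap:
  assumes "1 \<le> i" "i < N"
  shows "pi_fun N k (swap_rows i x) = pi_fun N k x"
proof -
  let ?g = "\<lambda>x j. (real j - of_int (x j)) ^ k - real j ^ k"
  have s: "{1..N} = insert i (insert (Suc i) ({1..N} - {i, Suc i}))" using assms by auto
  have "(\<Sum>j\<in>{1..N} - {i, Suc i}. ?g (swap_rows i x) j) = (\<Sum>j\<in>{1..N} - {i, Suc i}. ?g x j)"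
    by (rule sum.cong) (auto simp: swap_rows_def)
  then show ?thesis
    unfolding pi_fun_def by (subst s, subst (2) s) (simp add: swap_rows_def algebra_simps)
qed

section \<open>Alternating functions and standard tableaux\<close>

text \<open>The coordinates are those of \<open>\<lambda>\<close>, not of \<open>\<lambda> + \<delta>\<close>; exchanging two consecutive entries of
  \<open>\<lambda> + \<delta>\<close> becomes \<open>swap_rows\<close>.\<close>

definition alternating :: "nat \<Rightarrow> (point \<Rightarrow> real) \<Rightarrow> bool" where
  "alternating N F \<longleftrightarrow> (\<forall>i x. 1 \<le> i \<and> i < N \<longrightarrow> F (swap_rows i x) = - F x) \<and>
     (\<forall>x. x N < 0 \<longrightarrow> F x = 0)"

definition partition_points :: "nat \<Rightarrow> point set" where
  "partition_points N = {x. (\<forall>i\<ge>1. x (Suc i) \<le> x i) \<and> (\<forall>i. 0 \<le> x i) \<and> (\<forall>i. i \<notin> {1..N} \<longrightarrow> x i = 0)}"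

definition cells :: "point \<Rightarrow> (nat \<times> nat) set" where
  "cells x = {(i, j). 1 \<le> i \<and> 1 \<le> j \<and> int j \<le> x i}"

definition weight :: "nat \<Rightarrow> point \<Rightarrow> int" where
  "weight N x = (\<Sum>i=1..N. x i)"

lemma partition_pointsD:
  assumes "x \<in> partition_points N"
  shows "i \<ge> 1 \<Longrightarrow> x (Suc i) \<le> x i" "0 \<le> x i" "i \<notin> {1..N} \<Longrightarrow> x i = 0"
  using assms by (auto simp: partition_points_def)

lemma partition_points_antimono:
  assumes "x \<in> partition_points N" "1 \<le> i" "i \<le> j"
  shows "x j \<le> x i"
  using assms(3)
proof (induction j rule: dec_induct)
  case (step j)
  then show ?case using partition_pointsD(1)[OF assms(1), of j] assms(2) by auto
qed auto

lemma cells_eq_Sigma: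
  assumes "x \<in> partition_points N"
  shows "cells x = (SIGMA i:{1..N}. {1..nat (x i)})"
proof -
  have "i \<in> {1..N}" if "1 \<le> j" "int j \<le> x i" for i j
    using partition_pointsD(3)[OF assms, of i] that by (cases "i \<in> {1..N}") auto
  then show ?thesis by (fastforce simp: cells_def)
qed

lemma finite_cells: "x \<in> partition_points N \<Longrightarrow> finite (cells x)"
  by (simp add: cells_eq_Sigma)

lemma card_cells: "x \<in> partition_points N \<Longrightarrow> int (card (cells x)) = weight N x"
  by (simp add: cells_eq_Sigma weight_def partition_pointsD)

lemma cells_subset_iff:
  assumes "x \<in> partition_points N" "y \<in> partition_points N"
  shows "cells y \<subseteq> cells x \<longleftrightarrow> (\<forall>i. y i \<le> x i)"
proof
  assume s: "cells y \<subseteq> cells x"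
  show "\<forall>i. y i \<le> x i"
  proof
    fix i
    show "y i \<le> x i"
    proof (cases "i \<in> {1..N} \<and> y i > 0")
      case True
      then have "(i, nat (y i)) \<in> cells y" by (auto simp: cells_def)
      then have "(i, nat (y i)) \<in> cells x" using s by blast
      then show ?thesis using True by (auto simp: cells_def)
    next
      case False
      then have "y i \<le> 0" using partition_pointsD(3)[OF assms(2), of i] by (cases "i \<in> {1..N}") auto
      then show ?thesis using partition_pointsD(2)[OF assms(1), of i] by linarith
    qed
  qed
qed (fastforce simp: cells_def intro: order_trans)

lemma cells_eq_iff:
  assumes "x \<in> partition_points N" "y \<in> partition_points N"
  shows "cells y = cells x \<longleftrightarrow> y = x"
  using cells_subset_iff[OF assms] cells_subset_iff[OF assms(2,1)]
  by (auto simp: fun_eq_iff intro: order.antisym)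

section \<open>Standard tableaux and removal of the largest entry\<close>

lemma finite_standard_tableaux: "finite \<theta> \<Longrightarrow> finite (standard_tableaux \<theta>)"
  by (rule finite_subset[OF _ finite_PiE[of \<theta> "\<lambda>_. {1..card \<theta>}"]]) (auto simp: standard_tableaux_def)

lemma dim_diagram_empty: "dim_diagram {} = 1"
proof -
  have "standard_tableaux {} = {\<lambda>_. undefined}"
    by (auto simp: standard_tableaux_def bij_betw_def)
  then show ?thesis by (simp add: dim_diagram_def)
qed

text \<open>The cells that can hold the largest entry of a standard tableau.\<close>

definition corners :: "(nat \<times> nat) set \<Rightarrow> (nat \<times> nat) set" where
  "corners \<theta> = {(i, j) \<in> \<theta>. (\<forall>j'. (i, j') \<in> \<theta> \<longrightarrow> j' \<le> j) \<and> (\<forall>i'. (i', j) \<in> \<theta> \<longrightarrow> i' \<le> i)}"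

text \<open>Forgetting the largest entry and putting it back are inverse maps; that \<open>c\<close>
  ends its row and its column makes the restored filling standard.\<close>

lemma standard_tableaux_remove:
  assumes "finite \<theta>" "c \<in> corners \<theta>"
  shows "card {T \<in> standard_tableaux \<theta>. T c = card \<theta>} = dim_diagram (\<theta> - {c})"
proof -
  obtain i j where c: "c = (i, j)" by (cases c)
  have c\<theta>: "c \<in> \<theta>" and row: "\<And>j'. (i, j') \<in> \<theta> \<Longrightarrow> j' \<le> j" and col: "\<And>i'. (i', j) \<in> \<theta> \<Longrightarrow> i' \<le> i"
    using assms(2) c by (auto simp: corners_def)
  define m where "m = card (\<theta> - {c})"
  have m: "card \<theta> = Suc m" using assms(1) c\<theta> by (metis m_def card_Suc_Diff1)
  have I: "{1..Suc m} = insert (Suc m) {1..m}" by auto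
  have "bij_betw (\<lambda>T. restrict T (\<theta> - {c})) {T \<in> standard_tableaux \<theta>. T c = card \<theta>} (standard_tableaux (\<theta> - {c}))"
  proof (rule bij_betwI[where g = "\<lambda>T. T(c := Suc m)"])
    show "(\<lambda>T. restrict T (\<theta> - {c})) \<in> {T \<in> standard_tableaux \<theta>. T c = card \<theta>} \<rightarrow> standard_tableaux (\<theta> - {c})"
    proof
      fix T assume T: "T \<in> {T \<in> standard_tableaux \<theta>. T c = card \<theta>}"
      then have b: "bij_betw T \<theta> {1..Suc m}" and Tc: "T c = Suc m" by (auto simp: standard_tableaux_def m)
      have "T ` (\<theta> - {c}) = {1..Suc m} - {Suc m}"
        using b Tc c\<theta> by (subst inj_on_image_set_diff[of T \<theta>]) (auto simp: bij_betw_def)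
      then have im: "T ` (\<theta> - {c}) = {1..m}" by auto
      then have "bij_betw T (\<theta> - {c}) {1..m}"
        using b by (auto simp: bij_betw_def inj_on_def)
      moreover have "restrict T (\<theta> - {c}) \<in> (\<theta> - {c}) \<rightarrow>\<^sub>E {1..m}"
        using im by (intro restrict_PiE_iff[THEN iffD2]) auto
      moreover have "bij_betw (restrict T (\<theta> - {c})) (\<theta> - {c}) {1..m} = bij_betw T (\<theta> - {c}) {1..m}"
        by (rule bij_betw_cong) auto
      ultimately show "restrict T (\<theta> - {c}) \<in> standard_tableaux (\<theta> - {c})"
        using T unfolding standard_tableaux_def m_def[symmetric] by simp
    qed
  next
    show "(\<lambda>T. T(c := Suc m)) \<in> standard_tableaux (\<theta> - {c}) \<rightarrow> {T \<in> standard_tableaux \<theta>. T c = card \<theta>}"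
    proof
      fix T assume T: "T \<in> standard_tableaux (\<theta> - {c})"
      then have b: "bij_betw T (\<theta> - {c}) {1..m}" and P: "T \<in> (\<theta> - {c}) \<rightarrow>\<^sub>E {1..m}"
        and r: "\<And>i j j'. (i, j) \<in> \<theta> - {c} \<Longrightarrow> (i, j') \<in> \<theta> - {c} \<Longrightarrow> j < j' \<Longrightarrow> T (i, j) < T (i, j')"
        and cl: "\<And>i i' j. (i, j) \<in> \<theta> - {c} \<Longrightarrow> (i', j) \<in> \<theta> - {c} \<Longrightarrow> i < i' \<Longrightarrow> T (i, j) < T (i', j)"
        by (auto simp: standard_tableaux_def m_def)
      let ?T = "T(c := Suc m)"
      have le: "T d \<le> m" if "d \<in> \<theta>" "d \<noteq> c" for d
        using P that by (auto simp: PiE_iff)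
      have "bij_betw ?T (\<theta> - {c}) {1..m}" using b by (rule bij_betw_cong[THEN iffD1, rotated]) auto
      then have "bij_betw ?T ({c} \<union> (\<theta> - {c})) ({Suc m} \<union> {1..m})"
        by (intro bij_betw_combine) (auto simp: bij_betw_def)
      then have b': "bij_betw ?T \<theta> {1..Suc m}" using c\<theta> I by (simp add: insert_absorb)
      moreover have "?T \<in> \<theta> \<rightarrow>\<^sub>E {1..Suc m}"
        using b' P c\<theta> by (auto simp: PiE_iff extensional_def bij_betw_def)
      moreover have "?T (k, l) < ?T (k, l')" if "(k, l) \<in> \<theta>" "(k, l') \<in> \<theta>" "l < l'" for k l l'
        using that r[of k l l'] le[of "(k, l)"] row[of l'] by (auto simp: c less_Suc_eq_le)
      moreover have "?T (k, l) < ?T (k', l)" if "(k, l) \<in> \<theta>" "(k', l) \<in> \<theta>" "k < k'" for k k' l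
        using that cl[of k l k'] le[of "(k, l)"] col[of k'] by (auto simp: c less_Suc_eq_le)
      ultimately show "?T \<in> {T \<in> standard_tableaux \<theta>. T c = card \<theta>}"
        by (simp add: standard_tableaux_def m)
    qed
  next
    fix T assume T: "T \<in> {T \<in> standard_tableaux \<theta>. T c = card \<theta>}"
    then have "T \<in> extensional \<theta>" by (auto simp: standard_tableaux_def PiE_iff)
    then show "(restrict T (\<theta> - {c}))(c := Suc m) = T"
      using T by (auto simp: fun_eq_iff m extensional_def restrict_def)
  next
    fix T assume T: "T \<in> standard_tableaux (\<theta> - {c})"
    then have "T \<in> extensional (\<theta> - {c})" by (auto simp: standard_tableaux_def PiE_iff)
    then show "restrict (T(c := Suc m)) (\<theta> - {c}) = T"
      by (auto simp: fun_eq_iff extensional_def restrict_def)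
  qed
  then show ?thesis by (simp add: bij_betw_same_card dim_diagram_def)
qed

lemma dim_diagram_rec:
  assumes "finite \<theta>" "\<theta> \<noteq> {}"
  shows "dim_diagram \<theta> = (\<Sum>c\<in>corners \<theta>. dim_diagram (\<theta> - {c}))"
proof -
  have fc: "finite (corners \<theta>)" by (rule finite_subset[OF _ assms(1)]) (auto simp: corners_def)
  have pos: "card \<theta> \<in> {1..card \<theta>}" using assms by (simp add: Suc_leI card_gt_0_iff)
  have max: "\<exists>c\<in>corners \<theta>. T c = card \<theta>" if T: "T \<in> standard_tableaux \<theta>" for T
  proof -
    have b: "bij_betw T \<theta> {1..card \<theta>}" using T by (auto simp: standard_tableaux_def)
    then obtain c where c: "c \<in> \<theta>" "T c = card \<theta>" using pos unfolding bij_betw_def by (metis imageE)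
    have le: "T d \<le> card \<theta>" if "d \<in> \<theta>" for d using b that by (auto simp: bij_betw_def)
    obtain i j where ij: "c = (i, j)" by (cases c)
    have "c \<in> corners \<theta>"
    proof -
      have "j' \<le> j" if "(i, j') \<in> \<theta>" for j'
      proof (rule ccontr)
        assume "\<not> j' \<le> j"
        then have "j < j'" by simp
        then have "T (i, j) < T (i, j')" using T c(1) that ij unfolding standard_tableaux_def by blast
        then show False using le[OF that] c ij by simp
      qed
      moreover have "i' \<le> i" if "(i', j) \<in> \<theta>" for i'
      proof (rule ccontr)
        assume "\<not> i' \<le> i"
        then have "i < i'" by simp
        then have "T (i, j) < T (i', j)" using T c(1) that ij unfolding standard_tableaux_def by blast
        then show False using le[OF that] c ij by simp
      qed
      ultimately show ?thesis using c ij by (auto simp: corners_def)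
    qed
    then show ?thesis using c by blast
  qed
  have "standard_tableaux \<theta> = (\<Union>c\<in>corners \<theta>. {T \<in> standard_tableaux \<theta>. T c = card \<theta>})"
    using max by auto
  then have "dim_diagram \<theta> = card (\<Union>c\<in>corners \<theta>. {T \<in> standard_tableaux \<theta>. T c = card \<theta>})"
    by (simp add: dim_diagram_def)
  also have "\<dots> = (\<Sum>c\<in>corners \<theta>. card {T \<in> standard_tableaux \<theta>. T c = card \<theta>})"
  proof (rule card_UN_disjoint[OF fc])
    show "\<forall>c\<in>corners \<theta>. \<forall>d\<in>corners \<theta>. c \<noteq> d \<longrightarrow>
        {T \<in> standard_tableaux \<theta>. T c = card \<theta>} \<inter> {T \<in> standard_tableaux \<theta>. T d = card \<theta>} = {}"
    proof (intro ballI impI equals0I)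
      fix c d T assume cd: "c \<in> corners \<theta>" "d \<in> corners \<theta>" "c \<noteq> d"
        and T: "T \<in> {T \<in> standard_tableaux \<theta>. T c = card \<theta>} \<inter> {T \<in> standard_tableaux \<theta>. T d = card \<theta>}"
      have "inj_on T \<theta>" using T by (auto simp: standard_tableaux_def bij_betw_def)
      moreover have "c \<in> \<theta>" "d \<in> \<theta>" using cd by (auto simp: corners_def)
      ultimately show False using T cd(3) inj_onD[of T \<theta> c d] by auto
    qed
  qed (use finite_standard_tableaux[OF assms(1)] in auto)
  also have "\<dots> = (\<Sum>c\<in>corners \<theta>. dim_diagram (\<theta> - {c}))"
    by (intro sum.cong standard_tableaux_remove assms) auto
  finally show ?thesis .
qed

section \<open>Adding boxes to alternating functions\<close>

lemma swap_lower:
  "lower (transpose i (Suc i) j) (swap_rows i x) = swap_rows i (lower j x)"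
  by (cases "j = i"; cases "j = Suc i") (auto simp: lower_def swap_rows_def fun_eq_iff transpose_def)

text \<open>A swap of rows merely permutes the shifts, because \<open>p_1\<close> is
  symmetric.\<close>

lemma alternating_add_box:
  assumes "alternating N F"
  shows "alternating N (add_box N F)"
  unfolding alternating_def
proof (intro conjI allI impI)
  fix i x assume i: "1 \<le> i \<and> i < N"
  have "transpose i (Suc i) permutes {1..N}" using i by (intro permutes_swap_id) auto
  then have "add_box N F (swap_rows i x) = (\<Sum>j=1..N. F (lower (transpose i (Suc i) j) (swap_rows i x)))"
    unfolding add_box_def by (rule sum.permute[of _ _ "\<lambda>j. F (lower j (swap_rows i x))", unfolded comp_def])
  also have "\<dots> = - add_box N F x"
    using assms i by (simp add: swap_lower add_box_def sum_negf alternating_def)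
  finally show "add_box N F (swap_rows i x) = - add_box N F x" .
next
  fix x :: point assume "x N < 0"
  then have "lower j x N < 0" for j by (auto simp: lower_def)
  then have "F (lower j x) = 0" for j using assms unfolding alternating_def by blast
  then show "add_box N F x = 0" by (simp add: add_box_def)
qed

lemma alternating_funpow: "alternating N F \<Longrightarrow> alternating N ((add_box N ^^ m) F)"
  by (induction m) (auto intro: alternating_add_box)

lemma partition_points_lower:
  assumes "x \<in> partition_points N" "i \<in> {1..N}" "x (Suc i) < x i"
  shows "lower i x \<in> partition_points N"
  unfolding partition_points_def
proof (intro CollectI conjI allI impI)
  fix j :: nat assume "1 \<le> j"
  then show "lower i x (Suc j) \<le> lower i x j"
    using partition_pointsD(1)[OF assms(1), of j] assms(3) by (auto simp: lower_def)
next
  fix j show "0 \<le> lower i x j"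
    using partition_pointsD(2)[OF assms(1), of j] partition_pointsD(2)[OF assms(1), of "Suc i"] assms(3)
    by (auto simp: lower_def)
next
  fix j assume "j \<notin> {1..N}"
  then show "lower i x j = 0" using partition_pointsD(3)[OF assms(1), of j] assms(2) by (auto simp: lower_def)
qed

text \<open>Either rows \<open>i\<close> and \<open>Suc i\<close> of \<open>x\<close> are equally
  long, and then \<open>swap_rows i\<close> fixes the lowered point, where \<open>F\<close> equals
  its own negative; or \<open>i = N\<close> and the last entry becomes negative.\<close>

lemma alternating_lower_eq_0:
  assumes "alternating N F" "x \<in> partition_points N" "i \<in> {1..N}" "lower i x \<notin> partition_points N"
  shows "F (lower i x) = 0"
proof -
  have "\<not> x (Suc i) < x i" using assms partition_points_lower by blast
  then have *: "x (Suc i) = x i" using partition_pointsD(1)[OF assms(2), of i] assms(3) by auto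
  show ?thesis
  proof (cases "i < N \<and> x (Suc i) = x i")
    case True
    then have "swap_rows i (lower i x) = lower i x"
      by (auto simp: swap_rows_def lower_def fun_eq_iff)
    then have "F (lower i x) = - F (lower i x)"
      using assms(1,3) True unfolding alternating_def by (metis atLeastAtMost_iff)
    then show ?thesis by simp
  next
    case False
    then have "i = N" using * assms(3) by auto
    then have "x N = 0" using * partition_pointsD(3)[OF assms(2), of "Suc i"] by auto
    then have "lower i x N < 0" using \<open>i = N\<close> by (simp add: lower_def)
    then show ?thesis using assms(1) by (auto simp: alternating_def)
  qed
qed

definition subpartitions :: "nat \<Rightarrow> point \<Rightarrow> point set" where
  "subpartitions N x = {y \<in> partition_points N. \<forall>i. y i \<le> x i}"

lemma finite_subpartitions: "finite (subpartitions N x)"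
proof (rule finite_subset)
  show "subpartitions N x \<subseteq>
     {y. \<forall>i. (i \<in> {1..N} \<longrightarrow> y i \<in> {0..Max (x ` {1..N})}) \<and> (i \<notin> {1..N} \<longrightarrow> y i = 0)}"
  proof (intro subsetI CollectI allI conjI impI)
    fix y i assume y: "y \<in> subpartitions N x"
    then have p: "y \<in> partition_points N" "y i \<le> x i" by (auto simp: subpartitions_def)
    show "y i = 0" if "i \<notin> {1..N}" using partition_pointsD(3)[OF p(1) that] .
    have "x i \<le> Max (x ` {1..N})" if "i \<in> {1..N}" using that by (intro Max_ge) auto
    then show "y i \<in> {0..Max (x ` {1..N})}" if "i \<in> {1..N}"
      using that p(2) partition_pointsD(2)[OF p(1), of i] unfolding atLeastAtMost_iff by (meson order_trans)
  qed
  show "finite {y. \<forall>i. (i \<in> {1..N} \<longrightarrow> y i \<in> {0..Max (x ` {1..N})}) \<and> (i \<notin> {1..N} \<longrightarrow> y i = (0::int))}"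
    by (rule finite_set_of_finite_funs) auto
qed

lemma subpartitions_weight_eq:
  assumes "y \<in> subpartitions N x" "x \<in> partition_points N" "weight N y = weight N x"
  shows "y = x"
proof -
  have y: "y \<in> partition_points N" using assms(1) by (simp add: subpartitions_def)
  have "cells y \<subseteq> cells x" using assms(1,2) y cells_subset_iff by (auto simp: subpartitions_def)
  moreover have "card (cells y) = card (cells x)"
    using card_cells[OF y] card_cells[OF assms(2)] assms(3) by simp
  ultimately have "cells y = cells x" using finite_cells[OF assms(2)] card_subset_eq by blast
  then show ?thesis using cells_eq_iff[OF assms(2) y] by simp
qed

lemma weight_lower: "i \<in> {1..N} \<Longrightarrow> weight N (lower i x) = weight N x - 1"
  by (simp add: weight_def lower_def sum.remove[of _ i] if_distrib sum.If_cases)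

text \<open>A corner of \<open>x / y\<close> is the last box of a row of \<open>x\<close> that is
  longer than the next row of \<open>x\<close> and than the same row of \<open>y\<close>.\<close>

lemma corners_skew:
  assumes "x \<in> partition_points N" "y \<in> subpartitions N x"
  shows "bij_betw (\<lambda>i. (i, nat (x i))) {i \<in> {1..N}. y \<in> subpartitions N (lower i x) \<and> lower i x \<in> partition_points N}
     (corners (cells x - cells y))"
proof -
  let ?\<theta> = "cells x - cells y"
  have y: "y \<in> partition_points N" using assms(2) by (simp add: subpartitions_def)
  have "(i, nat (x i)) \<in> corners ?\<theta>"
    if i: "i \<in> {1..N}" "y \<in> subpartitions N (lower i x)" "lower i x \<in> partition_points N" for i
  proof -
    have 1: "x i > 0" "x (Suc i) < x i"
      using partition_pointsD(2)[OF i(3), of i] partition_pointsD(1)[OF i(3), of i] i(1) by (auto simp: lower_def)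
    have "y i \<le> lower i x i" using i(2) by (simp add: subpartitions_def)
    then have 2: "y i < x i" by (simp add: lower_def)
    have "k \<le> i" if "x i \<le> x k" for k
      using partition_points_antimono[OF assms(1), of "Suc i" k] 1 that by (cases "k \<le> i") auto
    then show ?thesis using 1 2 i(1) by (auto simp: corners_def cells_def)
  qed
  moreover have "c \<in> (\<lambda>i. (i, nat (x i))) ` {i \<in> {1..N}. y \<in> subpartitions N (lower i x) \<and> lower i x \<in> partition_points N}"
    if c: "c \<in> corners ?\<theta>" for c
  proof -
    obtain i j where ij: "c = (i, j)" by (cases c)
    have i: "1 \<le> i" "1 \<le> j" "int j \<le> x i" "y i < int j" using c ij by (auto simp: corners_def cells_def)
    have iN: "i \<in> {1..N}" using partition_pointsD(3)[OF assms(1), of i] i by (cases "i \<in> {1..N}") auto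
    have "(i, nat (x i)) \<in> ?\<theta>" using i by (auto simp: cells_def)
    then have "nat (x i) \<le> j" using c ij by (auto simp: corners_def)
    then have j: "j = nat (x i)" using i by auto
    \<comment> \<open>If rows \<open>i\<close> and \<open>Suc i\<close> of \<open>x\<close> were
      equally long, the cell below \<open>(i, j)\<close> would lie in the skew shape, since row
      \<open>Suc i\<close> of \<open>y\<close> is no longer than row \<open>i\<close>, which ends
      before \<open>j\<close>.\<close>
    have "(Suc i, j) \<notin> ?\<theta>" using c ij by (auto simp: corners_def)
    then have "x (Suc i) < x i"
      using i partition_pointsD(1)[OF y, of i] j by (auto simp: cells_def)
    then have "lower i x \<in> partition_points N" by (rule partition_points_lower[OF assms(1) iN])
    moreover have "y \<in> subpartitions N (lower i x)"
      using assms(2) i j by (auto simp: subpartitions_def lower_def)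
    ultimately show ?thesis using iN ij j by auto
  qed
  ultimately show ?thesis by (auto simp: bij_betw_def inj_on_def)
qed

lemma cells_lower:
  assumes "x \<in> partition_points N" "lower i x \<in> partition_points N" "i \<in> {1..N}"
  shows "cells (lower i x) = cells x - {(i, nat (x i))}"
  using partition_pointsD(2)[OF assms(2), of i] assms(3)
  by (auto simp: cells_def lower_def split: if_splits)

text \<open>Iterating \<open>add_box\<close> on an alternating function adds boxes one by one: the terms that leave
  the set of partitions vanish.\<close>

lemma add_box_funpow:
  assumes "alternating N F" "x \<in> partition_points N"
  shows "(add_box N ^^ m) F x =
    (\<Sum>y | y \<in> subpartitions N x \<and> weight N y + int m = weight N x. real (dim_diagram (cells x - cells y)) * F y)"
  using assms(2)
proof (induction m arbitrary: x)
  case 0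
  have "{y. y \<in> subpartitions N x \<and> weight N y + int 0 = weight N x} = {x}"
    using 0 subpartitions_weight_eq by (auto simp: subpartitions_def)
  then show ?case by (simp add: dim_diagram_empty)
next
  case (Suc m)
  let ?Y = "{y. y \<in> subpartitions N x \<and> weight N y + int (Suc m) = weight N x}"
  let ?P = "\<lambda>i. lower i x \<in> partition_points N"
  let ?d = "\<lambda>i y. real (dim_diagram (cells (lower i x) - cells y))"
  have fY: "finite ?Y" by (rule finite_subset[OF _ finite_subpartitions[of N x]]) auto
  have "(add_box N ^^ Suc m) F x = (\<Sum>i=1..N. (add_box N ^^ m) F (lower i x))"
    by (simp add: add_box_def)
  also have "\<dots> = (\<Sum>i=1..N. if ?P i then (add_box N ^^ m) F (lower i x) else 0)"
  proof (rule sum.cong[OF refl])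
    fix i assume "i \<in> {1..N}"
    then have "(add_box N ^^ m) F (lower i x) = 0" if "\<not> ?P i"
      using alternating_lower_eq_0[OF alternating_funpow[OF assms(1)] Suc.prems] that by blast
    then show "(add_box N ^^ m) F (lower i x) = (if ?P i then (add_box N ^^ m) F (lower i x) else 0)"
      by (cases "?P i") (simp_all only: if_True if_False simp_thms)
  qed
  also have "\<dots> = (\<Sum>i=1..N. \<Sum>y\<in>?Y. if y \<in> subpartitions N (lower i x) \<and> ?P i then ?d i y * F y else 0)"
  proof (rule sum.cong[OF refl])
    fix i assume i: "i \<in> {1..N}"
    have "{y. y \<in> subpartitions N (lower i x) \<and> weight N y + int m = weight N (lower i x)} =
        {y \<in> ?Y. y \<in> subpartitions N (lower i x)}"
    proof -
      have "y \<in> subpartitions N x" if "y \<in> subpartitions N (lower i x)" for y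
      proof -
        have "lower i x k \<le> x k" for k by (simp add: lower_def)
        then show ?thesis using that unfolding subpartitions_def by (blast intro: order_trans)
      qed
      then show ?thesis unfolding weight_lower[OF i] by auto
    qed
    then show "(if ?P i then (add_box N ^^ m) F (lower i x) else 0) =
        (\<Sum>y\<in>?Y. if y \<in> subpartitions N (lower i x) \<and> ?P i then ?d i y * F y else 0)"
      using Suc.IH[of "lower i x"] fY by (auto simp: sum.If_cases Int_def)
  qed
  also have "\<dots> = (\<Sum>y\<in>?Y. \<Sum>i=1..N. if y \<in> subpartitions N (lower i x) \<and> ?P i then ?d i y * F y else 0)"
    by (rule sum.swap)
  also have "\<dots> = (\<Sum>y\<in>?Y. real (dim_diagram (cells x - cells y)) * F y)"
  proof (rule sum.cong[OF refl])
    fix y assume y: "y \<in> ?Y"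
    let ?I = "{i \<in> {1..N}. y \<in> subpartitions N (lower i x) \<and> ?P i}"
    \<comment> \<open>The recursion for \<open>dim_diagram\<close> applies to nonempty shapes;
      \<open>y\<close> differs from \<open>x\<close> because the weights differ by
      \<open>Suc m\<close>.\<close>
    have "cells x - cells y \<noteq> {}"
    proof
      assume "cells x - cells y = {}"
      then have "cells x \<subseteq> cells y" by blast
      then have "x = y" using y Suc.prems cells_subset_iff[of y N x]
        by (auto simp: subpartitions_def fun_eq_iff intro: order.antisym)
      then show False using y by simp
    qed
    then have "dim_diagram (cells x - cells y) = (\<Sum>c\<in>corners (cells x - cells y). dim_diagram (cells x - cells y - {c}))"
      using finite_cells[OF Suc.prems] by (intro dim_diagram_rec) auto
    also have "\<dots> = (\<Sum>i\<in>?I. dim_diagram (cells x - cells y - {(i, nat (x i))}))"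
      by (rule sum.reindex_bij_betw[OF corners_skew, symmetric]) (use y Suc.prems in auto)
    also have "\<dots> = (\<Sum>i\<in>?I. dim_diagram (cells (lower i x) - cells y))"
    proof (rule sum.cong[OF refl])
      fix i assume "i \<in> ?I"
      then have "cells x - cells y - {(i, nat (x i))} = cells (lower i x) - cells y"
        using cells_lower[OF Suc.prems, of i] by auto
      then show "dim_diagram (cells x - cells y - {(i, nat (x i))}) = dim_diagram (cells (lower i x) - cells y)"
        by simp
    qed
    finally show "(\<Sum>i=1..N. if y \<in> subpartitions N (lower i x) \<and> ?P i then ?d i y * F y else 0) =
        real (dim_diagram (cells x - cells y)) * F y"
      by (simp add: sum.If_cases Int_def sum_distrib_right conj_commute conj_left_commute)
  qed
  finally show ?case .
qed

section \<open>The Pieri rule and Kostka numbers\<close>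

text \<open>The coefficients of the Vandermonde determinant, with \<open>x\<close> standing for the exponent
  vector \<open>x + \<delta>\<close>.\<close>

definition alternant :: "nat \<Rightarrow> point \<Rightarrow> real" where
  "alternant N x = (\<Sum>w | w permutes {1..N}. of_int (sign w) * (if x = (\<lambda>i. int i - int (w i)) then 1 else 0))"

lemma alternating_alternant: "alternating N (alternant N)"
  unfolding alternating_def
proof (intro conjI allI impI)
  fix i x assume i: "1 \<le> i \<and> i < N"
  let ?t = "transpose i (Suc i)"
  let ?e = "\<lambda>x w. of_int (sign w) * (if x = (\<lambda>i. int i - int (w i)) then 1 else 0 :: real)"
  have t: "?t permutes {1..N}" using i by (intro permutes_swap_id) auto
  have "alternant N (swap_rows i x) = (\<Sum>w | w permutes {1..N}. ?e (swap_rows i x) (w \<circ> ?t))"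
    unfolding alternant_def
    by (rule sum.reindex_bij_witness[where i = "\<lambda>w. w \<circ> ?t" and j = "\<lambda>w. w \<circ> ?t"])
      (use t in \<open>auto simp: permutes_compose comp_assoc simp del: One_nat_def\<close>)
  also have "?e (swap_rows i x) (w \<circ> ?t) = - ?e x w" if "w permutes {1..N}" for w
  proof -
    have "(swap_rows i x = (\<lambda>j. int j - int ((w \<circ> ?t) j))) \<longleftrightarrow> x = (\<lambda>j. int j - int (w j))" (is "?l \<longleftrightarrow> ?r")
    proof
      assume l: ?l
      show ?r
      proof
        fix j
        show "x j = int j - int (w j)"
          using fun_cong[OF l, of i] fun_cong[OF l, of "Suc i"] fun_cong[OF l, of j]
          by (cases "j = i"; cases "j = Suc i") (auto simp: swap_rows_def transpose_def)
      qed
    qed (auto simp: swap_rows_def fun_eq_iff transpose_def)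
    moreover have "sign (w \<circ> ?t) = - sign w"
      using that t permutes_imp_permutation[of "{1..N}"] by (simp add: sign_compose sign_swap_id)
    ultimately show ?thesis by simp
  qed
  then have "(\<Sum>w | w permutes {1..N}. ?e (swap_rows i x) (w \<circ> ?t)) = (\<Sum>w | w permutes {1..N}. - ?e x w)"
    by (intro sum.cong) auto
  also have "\<dots> = - alternant N x" by (simp add: alternant_def sum_negf)
  finally show "alternant N (swap_rows i x) = - alternant N x" .
next
  fix x :: point assume x: "x N < 0"
  have "x \<noteq> (\<lambda>i. int i - int (w i))" if "w permutes {1..N}" for w
  proof
    assume "x = (\<lambda>i. int i - int (w i))"
    then have "int N < int (w N)" using x by simp
    moreover have "w N \<le> N"
      using permutes_in_image[OF that, of N] permutes_not_in[OF that, of N] by (cases "N \<in> {1..N}") auto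
    ultimately show False by simp
  qed
  then show "alternant N x = 0" by (simp add: alternant_def)
qed

text \<open>A contributing \<open>w\<close> satisfies \<open>x i = i - w i\<close>, which is
  nonnegative for a partition; a permutation with \<open>w i \<le> i\<close> throughout is the
  identity.\<close>

lemma alternant_partition:
  assumes "x \<in> partition_points N"
  shows "alternant N x = (if x = (\<lambda>i. 0) then 1 else 0)"
proof -
  have "(x = (\<lambda>i. int i - int (w i))) \<longleftrightarrow> w = id \<and> x = (\<lambda>i. 0)" if w: "w permutes {1..N}" for w
  proof
    assume x: "x = (\<lambda>i. int i - int (w i))"
    have "w i \<le> i" for i using partition_pointsD(2)[OF assms, of i] x by simp
    then have "w = id" using w by (intro permutes_natset_le) auto
    then show "w = id \<and> x = (\<lambda>i. 0)" using x by auto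
  qed auto
  then have "alternant N x = (\<Sum>w | w permutes {1..N}. if w = id then (if x = (\<lambda>i. 0) then 1 else 0) else 0)"
    unfolding alternant_def by (intro sum.cong) auto
  also have "\<dots> = (if x = (\<lambda>i. 0) then 1 else 0)"
    by (subst sum.delta) (auto simp: finite_permutations permutes_id)
  finally show ?thesis .
qed

text \<open>The differences \<open>x - y\<close> are the exponent vectors of the monomials of
  \<open>h_k\<close>; the points \<open>y\<close> need not be partitions.\<close>

definition lower_set :: "nat \<Rightarrow> nat \<Rightarrow> point \<Rightarrow> point set" where
  "lower_set N k x = {y. (\<forall>i\<in>{1..N}. y i \<le> x i) \<and> (\<forall>i. i \<notin> {1..N} \<longrightarrow> y i = x i) \<and>
     weight N x - weight N y = int k}"

lemma weight_mono_eq: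
  assumes "\<forall>i\<in>{1..N}. y i \<le> x i" "weight N x = weight N y" "i \<in> {1..N}"
  shows "y i = x i"
proof (rule ccontr)
  assume "y i \<noteq> x i"
  then have "weight N y < weight N x"
    unfolding weight_def using assms by (intro sum_strict_mono_ex1) (auto simp: order_less_le)
  then show False using assms(2) by simp
qed

lemma lower_set_0: "lower_set N 0 x = {x}"
proof -
  have "y = x" if "y \<in> lower_set N 0 x" for y
  proof
    fix i show "y i = x i"
      using that weight_mono_eq[of N y x i] by (cases "i \<in> {1..N}") (auto simp: lower_set_def)
  qed
  then show ?thesis by (auto simp: lower_set_def)
qed

text \<open>The recursion of \<open>hop\<close> for sets: the last coordinate is either lowered at
  least once or kept.\<close>

lemma lower_set_Suc:
  "lower_set (Suc N) (Suc k) x = lower_set (Suc N) k (lower (Suc N) x) \<union> lower_set N (Suc k) x"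
proof -
  have w: "weight (Suc N) y = y (Suc N) + weight N y" for y :: point by (simp add: weight_def)
  have l: "weight N (lower (Suc N) x) = weight N x"
    unfolding weight_def lower_def by (intro sum.cong) auto
  have I: "{1..Suc N} = insert (Suc N) {1..N}" by auto
  show ?thesis
  proof (intro set_eqI iffI)
    fix y assume y: "y \<in> lower_set (Suc N) (Suc k) x"
    show "y \<in> lower_set (Suc N) k (lower (Suc N) x) \<union> lower_set N (Suc k) x"
    proof (cases "y (Suc N) = x (Suc N)")
      case True
      have "y i = x i" if "i \<notin> {1..N}" for i
        using y that True unfolding lower_set_def I by (cases "i = Suc N") auto
      then have "y \<in> lower_set N (Suc k) x" using y True unfolding lower_set_def w I by auto
      then show ?thesis ..
    next
      case False
      then have "y \<in> lower_set (Suc N) k (lower (Suc N) x)"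
        using y unfolding lower_set_def w l I by (auto simp: lower_def)
      then show ?thesis ..
    qed
  next
    fix y assume y: "y \<in> lower_set (Suc N) k (lower (Suc N) x) \<union> lower_set N (Suc k) x"
    then show "y \<in> lower_set (Suc N) (Suc k) x"
    proof
      assume "y \<in> lower_set (Suc N) k (lower (Suc N) x)"
      then show ?thesis unfolding lower_set_def w l I by (auto simp: lower_def) 
    next
      assume "y \<in> lower_set N (Suc k) x"
      then show ?thesis unfolding lower_set_def w I by auto
    qed
  qed
qed

lemma lower_set_Suc_disjoint: "lower_set (Suc N) k (lower (Suc N) x) \<inter> lower_set N (Suc k) x = {}"
proof (rule equals0I)
  fix y assume "y \<in> lower_set (Suc N) k (lower (Suc N) x) \<inter> lower_set N (Suc k) x"
  moreover have "Suc N \<in> {1..Suc N}" "Suc N \<notin> {1..N}" by auto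
  ultimately have "y (Suc N) \<le> lower (Suc N) x (Suc N)" "y (Suc N) = x (Suc N)"
    unfolding lower_set_def by blast+
  then show False by (simp add: lower_def)
qed

lemma lower_set_zero_Suc: "lower_set 0 (Suc k) x = {}"
  by (auto simp: lower_set_def weight_def)

lemma finite_lower_set: "finite (lower_set N k x)"
  by (induction N k arbitrary: x rule: hop.induct) (auto simp: lower_set_0 lower_set_Suc lower_set_zero_Suc)

lemma hop_eq_sum: "hop N k F x = (\<Sum>y\<in>lower_set N k x. F y)"
  by (induction N k arbitrary: x rule: hop.induct)
    (auto simp: lower_set_0 lower_set_Suc lower_set_zero_Suc sum.union_disjoint finite_lower_set
      lower_set_Suc_disjoint shift_op_def)

lemma swap_rows_swap_rows: "swap_rows i (swap_rows i x) = x"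
  by (auto simp: swap_rows_def fun_eq_iff)

lemma sum_two_rows:
  assumes "1 \<le> i" "i < N"
  shows "(\<Sum>j=1..N. f j) = f i + f (Suc i) + (\<Sum>j\<in>{1..N} - {i, Suc i}. f j :: int)"
proof -
  have s: "{1..N} = insert i (insert (Suc i) ({1..N} - {i, Suc i}))" using assms by auto
  show ?thesis by (subst s) (simp add: algebra_simps)
qed

lemma weight_swap_rows: "1 \<le> i \<Longrightarrow> i < N \<Longrightarrow> weight N (swap_rows i x) = weight N x"
proof -
  assume i: "1 \<le> i" "i < N"
  have "(\<Sum>j\<in>{1..N} - {i, Suc i}. swap_rows i x j) = (\<Sum>j\<in>{1..N} - {i, Suc i}. x j)"
    by (rule sum.cong) (auto simp: swap_rows_def)
  then show ?thesis
    unfolding weight_def sum_two_rows[OF i] by (simp add: swap_rows_def)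
qed

lemma swap_rows_lower_set:
  assumes "1 \<le> i" "i < N" "y \<in> lower_set N k x"
  shows "swap_rows i y \<in> lower_set N k (swap_rows i x)"
  unfolding lower_set_def mem_Collect_eq weight_swap_rows[OF assms(1,2)]
proof (intro conjI allI ballI impI)
  fix j assume "j \<in> {1..N}"
  moreover have "y i \<le> x i" "y (Suc i) \<le> x (Suc i)" using assms by (auto simp: lower_set_def)
  ultimately show "swap_rows i y j \<le> swap_rows i x j"
    using assms(3) by (auto simp: lower_set_def swap_rows_def)
qed (use assms in \<open>auto simp: lower_set_def swap_rows_def\<close>)

lemma alternating_hop:
  assumes "alternating N F"
  shows "alternating N (hop N k F)"
  unfolding alternating_def
proof (intro conjI allI impI)
  fix i x assume i: "1 \<le> i \<and> i < N"
  have "hop N k F (swap_rows i x) = (\<Sum>y\<in>lower_set N k x. F (swap_rows i y))"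
    unfolding hop_eq_sum
    by (rule sum.reindex_bij_witness[where i = "swap_rows i" and j = "swap_rows i"])
      (use i swap_rows_lower_set[of i N _ k x] swap_rows_lower_set[of i N _ k "swap_rows i x"]
        in \<open>auto simp: swap_rows_swap_rows\<close>)
  also have "\<dots> = - hop N k F x"
    using assms i by (simp add: hop_eq_sum alternating_def sum_negf)
  finally show "hop N k F (swap_rows i x) = - hop N k F x" .
next
  fix x :: point assume x: "x N < 0"
  have "y N < 0" if "y \<in> lower_set N k x" for y
    using that x unfolding lower_set_def by (cases "N \<in> {1..N}") force+
  then show "hop N k F x = 0" using assms by (simp add: hop_eq_sum alternating_def)
qed

text \<open>The interlacing inequalities express that \<open>x / y\<close> is a horizontal
  strip.\<close>

definition strips :: "nat \<Rightarrow> nat \<Rightarrow> point \<Rightarrow> point set" where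
  "strips N k x = {y \<in> subpartitions N x. (\<forall>i\<ge>1. x (Suc i) \<le> y i) \<and> weight N x - weight N y = int k}"

text \<open>Terms whose first violation of the strip condition is in row \<open>i\<close> cancel in pairs under
  \<open>swap_rows i\<close>.\<close>

lemma pieri:
  assumes "alternating N F" "x \<in> partition_points N"
  shows "hop N k F x = (\<Sum>y\<in>strips N k x. F y)"
proof -
  let ?Y = "lower_set N k x"
  let ?G = "\<lambda>m. {y \<in> ?Y. \<forall>j\<in>{1..<m}. x (Suc j) \<le> y j}"
  have step: "sum F (?G m) = sum F (?G (Suc m))" if m: "1 \<le> m" "m < N" for m
  proof -
    \<comment> \<open>The points whose first violation of interlacing occurs at row
      \<open>m\<close>.\<close>
    let ?B = "{y \<in> ?G m. y m < x (Suc m)}"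
    \<comment> \<open>The swap puts \<open>y (Suc m) - 1 < x (Suc m)\<close> into row
      \<open>m\<close>, again a violation, and \<open>y m + 1 \<le> x (Suc m)\<close> into row
      \<open>Suc m\<close>; the rows before \<open>m\<close> are untouched.\<close>
    have mem: "swap_rows m y \<in> ?B" if y: "y \<in> ?B" for y
    proof -
      have "y m < x (Suc m)" "x (Suc m) \<le> x m"
        using y partition_pointsD(1)[OF assms(2), of m] m by auto
      moreover have "y (Suc m) \<le> x (Suc m)" using y m by (auto simp: lower_set_def)
      ultimately have "y (Suc m) - 1 \<le> x m" "y (Suc m) - 1 < x (Suc m)" by linarith+
      then show ?thesis
        using y m weight_swap_rows[of m N y, symmetric] by (auto simp: lower_set_def swap_rows_def)
    qed
    have "sum F ?B = (\<Sum>y\<in>?B. F (swap_rows m y))"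
      by (rule sum.reindex_bij_witness[where i = "swap_rows m" and j = "swap_rows m"])
        (use mem in \<open>auto simp: swap_rows_swap_rows\<close>)
    also have "\<dots> = - sum F ?B"
      using assms(1) m by (simp add: alternating_def sum_negf)
    finally have B: "sum F ?B = 0" by simp
    have "{1..<Suc m} = insert m {1..<m}" using m by auto
    then have U: "?G m = ?G (Suc m) \<union> ?B" by auto
    have D: "?G (Suc m) \<inter> ?B = {}" using m by force
    have "sum F (?G (Suc m) \<union> ?B) = sum F (?G (Suc m)) + sum F ?B"
      by (rule sum.union_disjoint[OF _ _ D]) (auto simp: finite_lower_set)
    then show ?thesis by (subst U) (simp only: B add_0_right)
  qed
  have "sum F (?G 1) = sum F (?G (Suc m))" if "m < N" for m
    using that by (induction m) (use step in auto)
  then have *: "sum F ?Y = sum F (?G N)" by (cases N) auto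
  \<comment> \<open>The swaps treat the rows below \<open>N\<close>. The last condition is
    \<open>0 \<le> y N\<close>, and points violating it are killed by the second clause of
    \<open>alternating\<close>.\<close>
  have "sum F (strips N k x) = sum F (?G N)"
  proof (rule sum.mono_neutral_left)
    show "finite (?G N)" by (simp add: finite_lower_set)
    show "strips N k x \<subseteq> ?G N"
    proof
      fix y assume "y \<in> strips N k x"
      moreover from this have "y i = 0" if "i \<notin> {1..N}" for i
        using that partition_pointsD(3)[of y N i] by (auto simp: strips_def subpartitions_def)
      ultimately show "y \<in> ?G N"
        using partition_pointsD(3)[OF assms(2)]
        by (auto simp: strips_def subpartitions_def lower_set_def)
    qed
    show "\<forall>y\<in>?G N - strips N k x. F y = 0"
    proof
      fix y assume y: "y \<in> ?G N - strips N k x"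
      show "F y = 0"
      proof (cases "y N < 0")
        case True
        then show ?thesis using assms(1) by (auto simp: alternating_def)
      next
        case False
        have le: "y i \<le> x i" for i using y by (cases "i \<in> {1..N}") (auto simp: lower_set_def)
        have out: "y i = 0" if "i \<notin> {1..N}" for i
          using y that partition_pointsD(3)[OF assms(2) that] by (auto simp: lower_set_def)
        have ge: "x (Suc i) \<le> y i" if "i \<ge> 1" for i
        proof (cases "i < N")
          case True
          then show ?thesis using y that by auto
        next
          case F: False
          then have "x (Suc i) = 0" using partition_pointsD(3)[OF assms(2), of "Suc i"] by auto
          moreover have "0 \<le> y i" using F False out[of i] by (cases "i = N") auto
          ultimately show ?thesis by simp
        qed
        have "0 \<le> y i" for i
          using ge[of i] partition_pointsD(2)[OF assms(2), of "Suc i"] out[of i] by (cases "i \<ge> 1") auto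
        moreover have "y (Suc i) \<le> y i" if "i \<ge> 1" for i
          using le[of "Suc i"] ge[OF that] by linarith
        ultimately have "y \<in> strips N k x"
          using le ge out y by (auto simp: strips_def subpartitions_def partition_points_def lower_set_def)
        then show ?thesis using y by simp
      qed
    qed
  qed
  then show ?thesis using * by (simp add: hop_eq_sum)
qed

lemma alternating_fold_hop: "alternating N F \<Longrightarrow> alternating N (fold (hop N) mu F)"
  by (induction mu arbitrary: F) (auto intro: alternating_hop)

text \<open>\<open>semistandard_tableaux\<close> for a shape given as a point. The content
  \<open>mu\<close> may be unordered and contain zeros, as happens for the contents
  \<open>twist x w\<close> below.\<close>

definition ss_tableaux :: "point \<Rightarrow> nat list \<Rightarrow> (nat \<times> nat \<Rightarrow> nat) set" where
  "ss_tableaux x mu = {T \<in> cells x \<rightarrow>\<^sub>E {1..length mu}.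
     (\<forall>i j j'. (i, j) \<in> cells x \<and> (i, j') \<in> cells x \<and> j < j' \<longrightarrow> T (i, j) \<le> T (i, j')) \<and>
     (\<forall>i i' j. (i, j) \<in> cells x \<and> (i', j) \<in> cells x \<and> i < i' \<longrightarrow> T (i, j) < T (i', j)) \<and>
     (\<forall>k\<in>{1..length mu}. card {c \<in> cells x. T c = k} = part mu k)}"

lemma finite_ss_tableaux: "x \<in> partition_points N \<Longrightarrow> finite (ss_tableaux x mu)"
  by (rule finite_subset[OF _ finite_PiE[of "cells x" "\<lambda>_. {1..length mu}"]])
    (auto simp: ss_tableaux_def finite_cells)

lemma initial_segment:
  assumes "finite J" "0 \<notin> J" "\<And>j j'. j \<in> J \<Longrightarrow> 1 \<le> j' \<Longrightarrow> j' \<le> j \<Longrightarrow> j' \<in> J"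
  shows "J = {1..card J}"
proof (cases "J = {}")
  case False
  have "J = {1..Max J}"
  proof
    show "J \<subseteq> {1..Max J}"
    proof
      fix j assume "j \<in> J"
      then show "j \<in> {1..Max J}" using assms(1,2) by (cases j) auto
    qed
    show "{1..Max J} \<subseteq> J" using assms(1,3) Max_in[OF assms(1) False] by auto
  qed
  then have "card J = Max J" by (metis card_atLeastAtMost diff_Suc_1)
  with \<open>J = {1..Max J}\<close> show ?thesis by simp
qed auto

lemma cells_row_closed: "(i, j) \<in> cells x \<Longrightarrow> 1 \<le> j' \<Longrightarrow> j' \<le> j \<Longrightarrow> (i, j') \<in> cells x"
  by (auto simp: cells_def)

lemma cells_col_closed:
  assumes "x \<in> partition_points N" "(i, j) \<in> cells x" "1 \<le> i'" "i' \<le> i"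
  shows "(i', j) \<in> cells x"
  using partition_points_antimono[OF assms(1,3,4)] assms(2,3) by (auto simp: cells_def)

lemma strips_partition: "y \<in> strips N k x \<Longrightarrow> y \<in> partition_points N"
  by (simp add: strips_def subpartitions_def)

lemma strips_cells: "y \<in> strips N k x \<Longrightarrow> cells y \<subseteq> cells x"
  by (fastforce simp: strips_def subpartitions_def cells_def intro: order_trans)

text \<open>The boxes with the largest letter form a horizontal strip, since a box with another box
  below it holds a smaller letter.\<close>

lemma ss_tableaux_shape:
  assumes "x \<in> partition_points N" "T \<in> ss_tableaux x (mu @ [k])"
  shows "\<exists>y\<in>strips N k x. {c \<in> cells x. T c \<le> length mu} = cells y"
proof -
  let ?m = "length mu"
  have row: "T (i, j) \<le> T (i, j')" if "(i, j) \<in> cells x" "(i, j') \<in> cells x" "j < j'" for i j j'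
    using assms(2) that unfolding ss_tableaux_def by blast
  have col: "T (i, j) < T (i', j)" if "(i, j) \<in> cells x" "(i', j) \<in> cells x" "i < i'" for i i' j
    using assms(2) that unfolding ss_tableaux_def by blast
  have rng: "T c \<in> {1..Suc ?m}" if "c \<in> cells x" for c
    using assms(2) that by (auto simp: ss_tableaux_def)
  have last: "card {c \<in> cells x. T c = Suc ?m} = k"
    using assms(2) by (auto simp: ss_tableaux_def part_def)
  define J where "J i = {j. (i, j) \<in> cells x \<and> T (i, j) \<le> ?m}" for i
  define y where "y i = int (card (J i))" for i
  have fJ: "finite (J i)" for i
    by (rule finite_subset[of _ "snd ` cells x"]) (force simp: J_def, simp add: finite_cells[OF assms(1)])
  have J: "J i = {1..card (J i)}" for i
  proof (rule initial_segment[OF fJ])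
    show "0 \<notin> J i" by (auto simp: J_def cells_def)
    fix j j' assume j: "j \<in> J i" "1 \<le> j'" "j' \<le> j"
    then have "(i, j') \<in> cells x" using cells_row_closed by (auto simp: J_def)
    moreover have "T (i, j') \<le> T (i, j)" using row[of i j' j] j calculation by (cases "j' = j") (auto simp: J_def)
    ultimately show "j' \<in> J i" using j by (auto simp: J_def)
  qed
  have cy: "cells y = {c \<in> cells x. T c \<le> ?m}"
  proof (intro set_eqI iffI; clarify)
    fix i j assume "(i, j) \<in> cells y"
    then have "j \<in> {1..card (J i)}" by (auto simp: cells_def y_def)
    then have "j \<in> J i" using J by blast
    then show "(i, j) \<in> cells x \<and> T (i, j) \<le> ?m" by (auto simp: J_def)
  next
    fix i j assume a: "(i, j) \<in> cells x" "T (i, j) \<le> ?m"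
    then have "j \<in> J i" by (auto simp: J_def)
    then have "j \<in> {1..card (J i)}" using J by blast
    then show "(i, j) \<in> cells y" using a by (auto simp: cells_def y_def)
  qed
  have le: "y i \<le> x i" for i
  proof -
    have "J i \<subseteq> {1..nat (x i)}" by (auto simp: J_def cells_def)
    then have "card (J i) \<le> nat (x i)" using card_mono[of "{1..nat (x i)}" "J i"] by simp
    then show ?thesis using partition_pointsD(2)[OF assms(1), of i] by (simp add: y_def)
  qed
  \<comment> \<open>A box in row \<open>Suc i\<close> holds at most \<open>Suc ?m\<close>, so by
    column strictness the box above it holds at most \<open>?m\<close>.\<close>
  have ge: "x (Suc i) \<le> y i" if "i \<ge> 1" for i
  proof -
    have "{1..nat (x (Suc i))} \<subseteq> J i"
    proof
      fix j assume j: "j \<in> {1..nat (x (Suc i))}"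
      then have a: "(Suc i, j) \<in> cells x" by (auto simp: cells_def)
      then have b: "(i, j) \<in> cells x" using cells_col_closed[OF assms(1)] that by auto
      show "j \<in> J i" using col[OF b a] rng[OF a] b by (auto simp: J_def)
    qed
    from card_mono[OF fJ this] have "nat (x (Suc i)) \<le> card (J i)" by simp
    then show ?thesis by (simp add: y_def)
  qed
  have y: "y \<in> partition_points N"
    unfolding partition_points_def
  proof (intro CollectI conjI allI impI)
    fix i :: nat assume "1 \<le> i"
    then show "y (Suc i) \<le> y i" using le[of "Suc i"] ge[of i] by linarith
  next
    fix i assume "i \<notin> {1..N}"
    then show "y i = 0" using le[of i] partition_pointsD(3)[OF assms(1), of i] by (simp add: y_def)
  qed (simp add: y_def)
  have "cells x = cells y \<union> {c \<in> cells x. T c = Suc ?m}"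
    using rng unfolding cy by force
  moreover have "cells y \<inter> {c \<in> cells x. T c = Suc ?m} = {}" unfolding cy by auto
  ultimately have "card (cells x) = card (cells y) + k"
    using card_Un_disjoint[of "cells y" "{c \<in> cells x. T c = Suc ?m}"] last finite_cells[OF y]
      finite_cells[OF assms(1)] by auto
  then have "weight N x - weight N y = int k"
    using card_cells[OF y] card_cells[OF assms(1)] by linarith
  then have "y \<in> strips N k x" using y le ge by (auto simp: strips_def subpartitions_def)
  then show ?thesis using cy by blast
qed

text \<open>The inverse of the restriction fills the strip with the new largest letter.\<close>

lemma ss_tableaux_restrict:
  assumes x: "x \<in> partition_points N" and y: "y \<in> strips N k x"
  shows "card {T \<in> ss_tableaux x (mu @ [k]). {c \<in> cells x. T c \<le> length mu} = cells y} = card (ss_tableaux y mu)"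
proof -
  let ?m = "length mu"
  let ?A = "{T \<in> ss_tableaux x (mu @ [k]). {c \<in> cells x. T c \<le> ?m} = cells y}"
  have sub: "cells y \<subseteq> cells x" by (rule strips_cells[OF y])
  have yp: "y \<in> partition_points N" by (rule strips_partition[OF y])
  have "card (cells x - cells y) = card (cells x) - card (cells y)"
    by (rule card_Diff_subset[OF finite_cells[OF yp] sub])
  moreover have "weight N x - weight N y = int k" using y by (simp add: strips_def)
  ultimately have cd: "card (cells x - cells y) = k"
    using card_cells[OF x] card_cells[OF yp] by simp
  let ?g = "\<lambda>T c. if c \<in> cells y then T c else if c \<in> cells x then Suc ?m else undefined"
  have "bij_betw (\<lambda>T. restrict T (cells y)) ?A (ss_tableaux y mu)"
  proof (rule bij_betwI[where g = ?g])
    show "(\<lambda>T. restrict T (cells y)) \<in> ?A \<rightarrow> ss_tableaux y mu"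
    proof
      fix T assume T: "T \<in> ?A"
      then have s: "c \<in> cells y \<longleftrightarrow> c \<in> cells x \<and> T c \<le> ?m" for c by blast
      have rng: "T c \<in> {1..?m}" if "c \<in> cells y" for c
        using T that s[of c] by (auto simp: ss_tableaux_def PiE_iff)
      have "card {c \<in> cells y. T c = l} = part mu l" if "l \<in> {1..?m}" for l
      proof -
        have "{c \<in> cells y. T c = l} = {c \<in> cells x. T c = l}" using that s by auto
        moreover have "card {c \<in> cells x. T c = l} = part (mu @ [k]) l"
          using T that by (auto simp: ss_tableaux_def)
        moreover have "part (mu @ [k]) l = part mu l" using that by (auto simp: part_def nth_append)
        ultimately show ?thesis by simp
      qed
      moreover have "{c \<in> cells y. restrict T (cells y) c = l} = {c \<in> cells y. T c = l}" for l by auto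
      ultimately show "restrict T (cells y) \<in> ss_tableaux y mu"
        using T rng sub unfolding ss_tableaux_def by (auto simp: subset_iff)
    qed
  next
    show "?g \<in> ss_tableaux y mu \<rightarrow> ?A"
    proof
      fix T assume T: "T \<in> ss_tableaux y mu"
      have row: "T (i, j) \<le> T (i, j')" if "(i, j) \<in> cells y" "(i, j') \<in> cells y" "j < j'" for i j j'
        using T that unfolding ss_tableaux_def by blast
      have col: "T (i, j) < T (i', j)" if "(i, j) \<in> cells y" "(i', j) \<in> cells y" "i < i'" for i i' j
        using T that unfolding ss_tableaux_def by blast
      have rng: "T c \<in> {1..?m}" if "c \<in> cells y" for c
        using T that by (auto simp: ss_tableaux_def)
      have "?g T \<in> cells x \<rightarrow>\<^sub>E {1..Suc ?m}"
        using rng sub by (force simp: PiE_iff extensional_def)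
      moreover have "?g T (i, j) \<le> ?g T (i, j')" if "(i, j) \<in> cells x" "(i, j') \<in> cells x" "j < j'" for i j j'
        using that row[of i j j'] rng[of "(i, j)"] by (auto simp: cells_def)
      \<comment> \<open>By interlacing, a box with another box below it already lies in
        \<open>cells y\<close>, so the new letter is never on top of another entry.\<close>
      moreover have "?g T (i, j) < ?g T (i', j)" if c: "(i, j) \<in> cells x" "(i', j) \<in> cells x" "i < i'" for i i' j
      proof -
        have "int j \<le> x i'" "1 \<le> i" "1 \<le> j" using c by (auto simp: cells_def)
        moreover have "x i' \<le> x (Suc i)" using partition_points_antimono[OF x, of "Suc i" i'] c by auto
        moreover have "x (Suc i) \<le> y i" using y \<open>1 \<le> i\<close> by (auto simp: strips_def)
        ultimately have "(i, j) \<in> cells y" by (auto simp: cells_def)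
        then show ?thesis using c col[of i j i'] rng[of "(i, j)"] by auto
      qed
      moreover have "card {c \<in> cells x. ?g T c = l} = part (mu @ [k]) l" if l: "l \<in> {1..Suc ?m}" for l
      proof (cases "l = Suc ?m")
        case True
        have "{c \<in> cells x. ?g T c = l} = cells x - cells y" using True rng sub by force
        then show ?thesis using cd True by (simp add: part_def)
      next
        case False
        then have "{c \<in> cells x. ?g T c = l} = {c \<in> cells y. T c = l}" using l sub by auto
        moreover have "card {c \<in> cells y. T c = l} = part mu l" using T l False by (auto simp: ss_tableaux_def)
        ultimately show ?thesis using l False by (auto simp: part_def nth_append)
      qed
      ultimately have "?g T \<in> ss_tableaux x (mu @ [k])" unfolding ss_tableaux_def by simp
      moreover have "{c \<in> cells x. ?g T c \<le> ?m} = cells y" using rng sub by force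
      ultimately show "?g T \<in> ?A" by blast
    qed
  next
    fix T assume T: "T \<in> ?A"
    then have s: "c \<in> cells y \<longleftrightarrow> c \<in> cells x \<and> T c \<le> ?m" for c by blast
    have P: "T \<in> cells x \<rightarrow>\<^sub>E {1..Suc ?m}" using T by (auto simp: ss_tableaux_def)
    have "T c = Suc ?m" if "c \<in> cells x" "c \<notin> cells y" for c
      using P that s[of c] by (auto simp: PiE_iff le_Suc_eq)
    then show "?g (restrict T (cells y)) = T"
      using P by (auto simp: fun_eq_iff PiE_iff extensional_def)
  next
    fix T assume "T \<in> ss_tableaux y mu"
    then have "T \<in> extensional (cells y)" by (auto simp: ss_tableaux_def PiE_iff)
    then show "restrict (?g T) (cells y) = T" by (auto simp: fun_eq_iff extensional_def)
  qed
  then show ?thesis by (rule bij_betw_same_card)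
qed

lemma card_ss_tableaux_snoc:
  assumes "x \<in> partition_points N"
  shows "card (ss_tableaux x (mu @ [k])) = (\<Sum>y\<in>strips N k x. card (ss_tableaux y mu))"
proof -
  let ?A = "\<lambda>y. {T \<in> ss_tableaux x (mu @ [k]). {c \<in> cells x. T c \<le> length mu} = cells y}"
  have "ss_tableaux x (mu @ [k]) = (\<Union>y\<in>strips N k x. ?A y)"
    using ss_tableaux_shape[OF assms, of _ mu k] by blast
  then have "card (ss_tableaux x (mu @ [k])) = card (\<Union>y\<in>strips N k x. ?A y)" by simp
  also have "\<dots> = (\<Sum>y\<in>strips N k x. card (?A y))"
  proof (rule card_UN_disjoint)
    show "finite (strips N k x)"
      by (rule finite_subset[OF _ finite_subpartitions[of N x]]) (auto simp: strips_def)
    show "\<forall>y\<in>strips N k x. finite (?A y)" using finite_ss_tableaux[OF assms] by simp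
    show "\<forall>y\<in>strips N k x. \<forall>z\<in>strips N k x. y \<noteq> z \<longrightarrow> ?A y \<inter> ?A z = {}"
      using cells_eq_iff strips_partition by blast
  qed
  also have "\<dots> = (\<Sum>y\<in>strips N k x. card (ss_tableaux y mu))"
    using ss_tableaux_restrict[OF assms] by simp
  finally show ?thesis .
qed

text \<open>Each use of the Pieri rule strips off the largest letter. For the empty content the
  Vandermonde coefficient is 1 at the empty shape and 0 at the other partitions, which counts the
  empty tableau.\<close>

lemma fold_hop_alternant:
  "x \<in> partition_points N \<Longrightarrow> fold (hop N) mu (alternant N) x = real (card (ss_tableaux x mu))"
proof (induction mu arbitrary: x rule: rev_induct)
  case Nil
  show ?case
  proof (cases "x = (\<lambda>i. 0)")
    case True
    then have "cells x = {}" by (auto simp: cells_def)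
    then have "ss_tableaux x [] = {\<lambda>_. undefined}" by (auto simp: ss_tableaux_def)
    then show ?thesis using Nil True by (simp add: alternant_partition)
  next
    case False
    have z: "(\<lambda>i. 0) \<in> partition_points N" "cells (\<lambda>i. 0) = {}"
      by (auto simp: partition_points_def cells_def)
    then have "cells x \<noteq> {}" using False cells_eq_iff[OF z(1) Nil] by auto
    then have "ss_tableaux x [] = {}" by (auto simp: ss_tableaux_def PiE_iff)
    then show ?thesis using Nil False by (simp add: alternant_partition)
  qed
next
  case (snoc k mu)
  have "fold (hop N) (mu @ [k]) (alternant N) x = (\<Sum>y\<in>strips N k x. fold (hop N) mu (alternant N) y)"
    using pieri[OF alternating_fold_hop[OF alternating_alternant] snoc.prems] by simp
  also have "\<dots> = (\<Sum>y\<in>strips N k x. real (card (ss_tableaux y mu)))"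
    using snoc.IH strips_partition by (intro sum.cong) auto
  finally show ?case by (simp add: card_ss_tableaux_snoc[OF snoc.prems])
qed

section \<open>Dominance and the extremal Kostka numbers\<close>

lemma sum_part_card:
  assumes "x \<in> partition_points N" "T \<in> ss_tableaux x mu" "m \<le> length mu"
  shows "card {c \<in> cells x. T c \<le> m} = (\<Sum>i=1..m. part mu i)"
  using assms(3)
proof (induction m)
  case 0
  have "{c \<in> cells x. T c \<le> 0} = {}" using assms(2) by (force simp: ss_tableaux_def PiE_iff)
  then show ?case by (simp only: card.empty) simp
next
  case (Suc m)
  have "{c \<in> cells x. T c \<le> Suc m} = {c \<in> cells x. T c \<le> m} \<union> {c \<in> cells x. T c = Suc m}" by auto
  moreover have "card \<dots> = card {c \<in> cells x. T c \<le> m} + card {c \<in> cells x. T c = Suc m}"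
    using finite_cells[OF assms(1)] by (intro card_Un_disjoint) auto
  moreover have "card {c \<in> cells x. T c = Suc m} = part mu (Suc m)"
    using assms(2) Suc.prems by (auto simp: ss_tableaux_def)
  ultimately show ?case using Suc by simp
qed

lemma ss_tableau_row_le:
  assumes x: "x \<in> partition_points N" and T: "T \<in> ss_tableaux x mu" and c: "(i, j) \<in> cells x"
  shows "i \<le> T (i, j)"
  using c
proof (induction i)
  case (Suc i)
  show ?case
  proof (cases "i = 0")
    case True
    then show ?thesis using Suc.prems T by (force simp: ss_tableaux_def PiE_iff)
  next
    case False
    then have "(i, j) \<in> cells x" using cells_col_closed[OF x Suc.prems, of i] by auto
    moreover from this have "T (i, j) < T (Suc i, j)" using T Suc.prems unfolding ss_tableaux_def by blast
    ultimately show ?thesis using Suc.IH by simp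
  qed
qed simp

lemma card_rows:
  assumes "x \<in> partition_points N"
  shows "int (card {(i, j) \<in> cells x. i \<le> m}) = (\<Sum>i=1..m. x i)"
proof -
  have "{(i, j) \<in> cells x. i \<le> m} = (SIGMA i:{1..m}. {1..nat (x i)})" by (fastforce simp: cells_def)
  then show ?thesis by (simp add: partition_pointsD[OF assms])
qed

text \<open>Entries at most \<open>m\<close> stand in the first \<open>m\<close> rows, which offer
  too few boxes.\<close>

lemma ss_tableaux_dominance:
  assumes "x \<in> partition_points N" "m \<le> length mu" "(\<Sum>i=1..m. x i) < int (\<Sum>i=1..m. part mu i)"
  shows "ss_tableaux x mu = {}"
proof (rule equals0I)
  fix T assume T: "T \<in> ss_tableaux x mu"
  have "{c \<in> cells x. T c \<le> m} \<subseteq> {(i, j) \<in> cells x. i \<le> m}"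
    using ss_tableau_row_le[OF assms(1) T] by (auto intro: order_trans)
  then have "card {c \<in> cells x. T c \<le> m} \<le> card {(i, j) \<in> cells x. i \<le> m}"
    by (intro card_mono) (auto intro: finite_subset[OF _ finite_cells[OF assms(1)]])
  then show False
    using sum_part_card[OF assms(1) T assms(2)] card_rows[OF assms(1), of m] assms(3)
    by (simp del: of_nat_sum)
qed

text \<open>When these counts are equalities, the entries at most \<open>i\<close> fill exactly the
  first \<open>i\<close> rows, so every row is constant.\<close>

lemma ss_tableaux_superstandard:
  assumes x: "x \<in> partition_points N" and mu: "length mu = N" "\<And>i. i \<in> {1..N} \<Longrightarrow> int (part mu i) = x i"
  shows "card (ss_tableaux x mu) = 1"
proof -
  let ?T = "\<lambda>c. if c \<in> cells x then fst c else undefined"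
  have row: "i \<in> {1..N}" if "(i, j) \<in> cells x" for i j
    using that unfolding cells_eq_Sigma[OF x] by auto
  have "T = ?T" if T: "T \<in> ss_tableaux x mu" for T
  proof
    fix c
    show "T c = ?T c"
    proof (cases "c \<in> cells x")
      case True
      obtain i j where c: "c = (i, j)" by (cases c)
      have i: "i \<in> {1..N}" using row True c by simp
      have s: "{c \<in> cells x. T c \<le> i} \<subseteq> {(k, j) \<in> cells x. k \<le> i}"
        using ss_tableau_row_le[OF x T] by (auto intro: order_trans)
      have f: "finite {(k, j) \<in> cells x. k \<le> i}" by (auto intro: finite_subset[OF _ finite_cells[OF x]])
      have "int (card {c \<in> cells x. T c \<le> i}) = (\<Sum>k=1..i. int (part mu k))"
        using sum_part_card[OF x T, of i] i mu(1) by simp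
      also have "\<dots> = (\<Sum>k=1..i. x k)" using i by (intro sum.cong) (auto simp: mu(2))
      also have "\<dots> = int (card {(k, j) \<in> cells x. k \<le> i})" by (rule card_rows[OF x, symmetric])
      finally have "{c \<in> cells x. T c \<le> i} = {(k, j) \<in> cells x. k \<le> i}"
        using card_subset_eq[OF f s] by simp
      then have "T (i, j) \<le> i" using True c by blast
      then show ?thesis using ss_tableau_row_le[OF x T, of i j] True c by auto
    next
      case False
      then show ?thesis using T by (cases c) (auto simp: ss_tableaux_def PiE_iff extensional_def)
    qed
  qed
  moreover have "?T \<in> ss_tableaux x mu"
  proof -
    have "card {c \<in> cells x. ?T c = k} = part mu k" if k: "k \<in> {1..N}" for k
    proof -
      have "{c \<in> cells x. ?T c = k} = {k} \<times> {1..nat (x k)}" using k by (force simp: cells_def)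
      then have "card {c \<in> cells x. ?T c = k} = nat (x k)" by (simp add: card_cartesian_product)
      then show ?thesis using mu(2)[OF k] by simp
    qed
    then show ?thesis using row mu(1) unfolding ss_tableaux_def by (auto simp: PiE_iff extensional_def)
  qed
  ultimately have "ss_tableaux x mu = {?T}" by blast
  then show ?thesis by simp
qed

section \<open>The two expansions\<close>

text \<open>Here shifted symmetry enters: the diagonal operator keeps functions alternating, so
  boxes can be added both before and after it.\<close>

lemma alternating_mult:
  assumes "alternating N F" "\<And>i x. 1 \<le> i \<Longrightarrow> i < N \<Longrightarrow> G (swap_rows i x) = G x"
  shows "alternating N (mult_op G F)"
  using assms by (auto simp: alternating_def mult_op_def)

lemma add_box_funpow_alternant:
  assumes "y \<in> partition_points N" "weight N y = int j"
  shows "(add_box N ^^ j) (alternant N) y = real (dim_diagram (cells y))"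
proof -
  have z: "(\<lambda>i. 0) \<in> partition_points N" by (auto simp: partition_points_def)
  have "{z. z \<in> subpartitions N y \<and> weight N z + int j = weight N y} = {\<lambda>i. 0}"
  proof (intro set_eqI iffI; clarify)
    fix u assume u: "u \<in> subpartitions N y" "weight N u + int j = weight N y"
    then have "weight N u = weight N (\<lambda>i. 0)" using assms(2) by (simp add: weight_def)
    moreover have "(\<lambda>i. 0) \<in> subpartitions N u" using u z partition_pointsD(2) by (auto simp: subpartitions_def)
    ultimately show "u = (\<lambda>i. 0)" using u(1) subpartitions_weight_eq[of "\<lambda>i. 0" N u] by (auto simp: subpartitions_def)
  next
    show "(\<lambda>i. 0) \<in> subpartitions N y \<and> weight N (\<lambda>i. 0) + int j = weight N y"
      using z assms partition_pointsD(2)[OF assms(1)] by (auto simp: subpartitions_def weight_def)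
  qed
  moreover have "cells (\<lambda>i. 0) = {}" by (auto simp: cells_def)
  ultimately show ?thesis
    using add_box_funpow[OF alternating_alternant assms(1), of j] alternant_partition[OF z] by simp
qed

text \<open>The binomial sum for the \<open>n\<close>-fold commutator at the Vandermonde
  coefficients: boxes lead from the empty shape to \<open>y\<close>, the value is multiplied by
  \<open>G y\<close>, and boxes lead on from \<open>y\<close> to \<open>x\<close>. A shape of weight
  \<open>j\<close> occurs in the \<open>j\<close>-th term only.\<close>

lemma symbol_expansion:
  assumes x: "x \<in> partition_points N" "weight N x = int n"
    and G: "has_symbol N n (mult_op G) Z" "\<And>i x. 1 \<le> i \<Longrightarrow> i < N \<Longrightarrow> G (swap_rows i x) = G x"
  shows "(\<Sum>y\<in>subpartitions N x. (-1) ^ card (cells x - cells y) * G y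
      / (H_diag (cells y) * H_diag (cells x - cells y))) = Z (alternant N) x"
proof -
  let ?A = "alternant N"
  let ?Y = "\<lambda>j. {y \<in> subpartitions N x. nat (weight N y) = j}"
  have sub: "y \<in> partition_points N \<and> cells y \<subseteq> cells x \<and> int (card (cells y)) = weight N y \<and>
      card (cells y) \<le> n \<and> card (cells x - cells y) = n - card (cells y)" if "y \<in> subpartitions N x" for y
  proof -
    have y: "y \<in> partition_points N" "cells y \<subseteq> cells x"
      using that cells_subset_iff[OF x(1)] by (auto simp: subpartitions_def)
    have n: "card (cells x) = n" using card_cells[OF x(1)] x(2) by simp
    show ?thesis
      using y n card_cells[OF y(1)] card_mono[OF finite_cells[OF x(1)] y(2)]
        card_Diff_subset[OF finite_cells[OF y(1)] y(2)] by simp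
  qed
  have le_n: "nat (weight N y) \<le> n" if "y \<in> subpartitions N x" for y
    using sub[OF that] by linarith
  have inner: "(add_box N ^^ (n - j)) (mult_op G ((add_box N ^^ j) ?A)) x =
      (\<Sum>y\<in>?Y j. real (dim_diagram (cells x - cells y)) * (G y * real (dim_diagram (cells y))))"
    if j: "j \<le> n" for j
  proof -
    have "{y. y \<in> subpartitions N x \<and> weight N y + int (n - j) = weight N x} = ?Y j"
      using j x(2) sub by force
    then have "(add_box N ^^ (n - j)) (mult_op G ((add_box N ^^ j) ?A)) x =
      (\<Sum>y\<in>?Y j. real (dim_diagram (cells x - cells y)) * mult_op G ((add_box N ^^ j) ?A) y)"
      using add_box_funpow[OF alternating_mult[OF alternating_funpow[OF alternating_alternant] G(2)] x(1)] by simp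
    also have "\<dots> = (\<Sum>y\<in>?Y j. real (dim_diagram (cells x - cells y)) * (G y * real (dim_diagram (cells y))))"
    proof (rule sum.cong[OF refl])
      fix y assume y: "y \<in> ?Y j"
      then have "(add_box N ^^ j) ?A y = real (dim_diagram (cells y))"
        using sub[of y] by (intro add_box_funpow_alternant) auto
      then show "real (dim_diagram (cells x - cells y)) * mult_op G ((add_box N ^^ j) ?A) y =
         real (dim_diagram (cells x - cells y)) * (G y * real (dim_diagram (cells y)))"
        by (simp add: mult_op_def)
    qed
    finally show ?thesis .
  qed
  have "fact n * Z ?A x = (\<Sum>j\<le>n. (-1) ^ (n - j) * real (n choose j) *
           (add_box N ^^ (n - j)) (mult_op G ((add_box N ^^ j) ?A)) x)"
    by (rule has_symbol_expand[OF G(1) lin_mult, symmetric])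
  also have "\<dots> = (\<Sum>j\<le>n. \<Sum>y\<in>?Y j. (-1) ^ (n - j) * real (n choose j) *
       (real (dim_diagram (cells x - cells y)) * (G y * real (dim_diagram (cells y)))))"
    by (intro sum.cong refl) (simp add: inner sum_distrib_left)
  also have "\<dots> = (\<Sum>j\<le>n. \<Sum>y\<in>?Y j. fact n * ((-1) ^ card (cells x - cells y) * G y
      / (H_diag (cells y) * H_diag (cells x - cells y))))"
  proof (intro sum.cong refl)
    fix j y assume j: "j \<in> {..n}" and y: "y \<in> ?Y j"
    have c: "card (cells y) = j" "card (cells x - cells y) = n - j" using y sub[of y] by auto
    \<comment> \<open>The two factorials in the denominator are those in the factors
      \<open>H_diag\<close>; \<open>fact n\<close> is cancelled at the end.\<close>
    have "real (n choose j) = fact n / (fact j * fact (n - j))" using j by (intro binomial_fact) auto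
    then show "(-1) ^ (n - j) * real (n choose j) *
       (real (dim_diagram (cells x - cells y)) * (G y * real (dim_diagram (cells y)))) =
      fact n * ((-1) ^ card (cells x - cells y) * G y / (H_diag (cells y) * H_diag (cells x - cells y)))"
      unfolding H_diag_def c by simp
  qed
  also have "\<dots> = (\<Sum>y\<in>subpartitions N x. fact n * ((-1) ^ card (cells x - cells y) * G y
      / (H_diag (cells y) * H_diag (cells x - cells y))))"
    by (rule sum.group) (auto simp: finite_subpartitions le_n)
  finally have "fact n * Z ?A x = fact n * (\<Sum>y\<in>subpartitions N x. (-1) ^ card (cells x - cells y) * G y
      / (H_diag (cells y) * H_diag (cells x - cells y)))"
    by (simp only: sum_distrib_left)
  then show ?thesis by simp
qed

section \<open>Partitions as lists and as points\<close>

definition point_of :: "nat list \<Rightarrow> point" where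
  "point_of rho = (\<lambda>i. int (part rho i))"

lemma diagram_eq_cells: "diagram rho = cells (point_of rho)"
  by (auto simp: diagram_def cells_def point_of_def)

lemma is_partition_iff: "is_partition rho \<longleftrightarrow> sorted_wrt (\<ge>) rho \<and> 0 \<notin> set rho"
  by (simp add: is_partition_def partition_of_def)

lemma point_of_partition:
  assumes "is_partition rho" "length rho \<le> N"
  shows "point_of rho \<in> partition_points N"
  unfolding partition_points_def
proof (intro CollectI conjI allI impI)
  fix i :: nat assume "1 \<le> i"
  then show "point_of rho (Suc i) \<le> point_of rho i"
    using assms(1) sorted_wrt_nth_less[of "(\<ge>)" rho "i - 1" i]
    by (auto simp: is_partition_iff point_of_def part_def)
qed (use assms in \<open>auto simp: point_of_def part_def\<close>)

lemma weight_point_of: "length rho \<le> N \<Longrightarrow> weight N (point_of rho) = int (sum_list rho)"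
proof -
  assume N: "length rho \<le> N"
  have "weight N (point_of rho) = (\<Sum>i=1..length rho. point_of rho i)"
    unfolding weight_def using N by (intro sum.mono_neutral_right) (auto simp: point_of_def part_def)
  also have "\<dots> = (\<Sum>i<length rho. int (rho ! i))"
    by (rule sum.reindex_bij_witness[where i = Suc and j = "\<lambda>i. i - 1"]) (auto simp: point_of_def part_def)
  also have "\<dots> = int (sum_list rho)" by (simp add: sum_list_sum_nth atLeast0LessThan)
  finally show ?thesis .
qed

lemma part_pos_iff: "is_partition rho \<Longrightarrow> part rho i > 0 \<longleftrightarrow> i \<in> {1..length rho}"
  by (auto simp: is_partition_iff part_def intro!: Nat.gr0I dest: nth_mem[of _ rho])
    (metis Suc_le_lessD Suc_pred nth_mem)

lemma length_le_of_subset: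
  assumes "is_partition rho" "diagram rho \<subseteq> diagram lam"
  shows "length rho \<le> length lam"
proof (cases "length rho = 0")
  case False
  then have l: "1 \<le> length rho" by linarith
  then have "part rho (length rho) > 0" using part_pos_iff[OF assms(1), of "length rho"] by simp
  with l have "(length rho, 1) \<in> diagram rho" by (simp add: diagram_def Suc_le_eq)
  then have "(length rho, 1) \<in> diagram lam" using assms(2) by blast
  then show ?thesis by (auto simp: diagram_def part_def split: if_splits)
qed simp

lemma bij_betw_point_of:
  assumes lam: "is_partition lam"
  shows "bij_betw point_of {rho. is_partition rho \<and> diagram rho \<subseteq> diagram lam}
     (subpartitions (length lam) (point_of lam))"
proof -
  let ?N = "length lam"
  have lp: "point_of lam \<in> partition_points ?N" by (rule point_of_partition[OF lam]) simp
  show ?thesis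
    unfolding bij_betw_def
  proof (intro conjI inj_onI set_eqI iffI)
    fix r s assume rs: "r \<in> {rho. is_partition rho \<and> diagram rho \<subseteq> diagram lam}"
      "s \<in> {rho. is_partition rho \<and> diagram rho \<subseteq> diagram lam}" and e: "point_of r = point_of s"
    have p: "part r i = part s i" for i using fun_cong[OF e, of i] by (simp add: point_of_def)
    have "i \<in> {1..length r} \<longleftrightarrow> i \<in> {1..length s}" for i
      using part_pos_iff[of r i] part_pos_iff[of s i] rs p[of i] by simp
    then have "{1..length r} = {1..length s}" by blast
    then have l: "length r = length s" by (metis card_atLeastAtMost diff_Suc_1)
    show "r = s"
    proof (rule nth_equalityI[OF l])
      fix i assume "i < length r"
      then show "r ! i = s ! i" using p[of "Suc i"] l by (simp add: part_def)
    qed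
  next
    fix y assume "y \<in> point_of ` {rho. is_partition rho \<and> diagram rho \<subseteq> diagram lam}"
    then obtain r where r: "is_partition r" "diagram r \<subseteq> diagram lam" "y = point_of r" by auto
    then have "y \<in> partition_points ?N" using point_of_partition length_le_of_subset by blast
    then show "y \<in> subpartitions ?N (point_of lam)"
      using r(2,3) cells_subset_iff[OF lp] by (auto simp: subpartitions_def diagram_eq_cells)
  next
    fix y assume y: "y \<in> subpartitions ?N (point_of lam)"
    then have yp: "y \<in> partition_points ?N" by (simp add: subpartitions_def)
    \<comment> \<open>The positive entries of \<open>y\<close> form an initial segment of the rows,
      so listing them gives a partition without zero parts.\<close>
    let ?J = "{i \<in> {1..?N}. y i > 0}"
    define M where "M = card ?J"
    have J: "?J = {1..M}"
      unfolding M_def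
    proof (rule initial_segment)
      fix j j' assume "j \<in> ?J" "1 \<le> j'" "j' \<le> j"
      then show "j' \<in> ?J" using partition_points_antimono[OF yp, of j' j] by auto
    qed auto
    define r where "r = map (\<lambda>i. nat (y i)) [1..<Suc M]"
    have pr: "point_of r = y"
    proof
      fix i
      show "point_of r i = y i"
      proof (cases "i \<in> {1..M}")
        case True
        then have "y i > 0" using J by blast
        moreover obtain k where "i = Suc k" using True by (cases i) auto
        moreover have "k < M" using True \<open>i = Suc k\<close> by simp
        ultimately show ?thesis by (simp add: r_def point_of_def part_def del: upt_Suc)
      next
        case False
        then have "i \<notin> {1..?N} \<or> y i \<le> 0" using J by auto
        then have "y i = 0" using partition_pointsD(2,3)[OF yp, of i] by auto
        then show ?thesis using False by (auto simp: r_def point_of_def part_def simp del: upt_Suc)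
      qed
    qed
    have "sorted_wrt (\<ge>) r"
      unfolding sorted_wrt_iff_nth_less r_def using partition_points_antimono[OF yp]
      by (auto simp del: upt_Suc intro!: nat_mono)
    moreover have "y i > 0" if "i \<in> {1..M}" for i using J that by blast
    then have "0 \<notin> set r" by (fastforce simp: r_def simp del: upt_Suc)
    ultimately have "is_partition r" by (simp add: is_partition_iff)
    moreover have "diagram r \<subseteq> diagram lam"
      using y cells_subset_iff[OF lp yp] by (simp add: diagram_eq_cells pr subpartitions_def)
    ultimately show "y \<in> point_of ` {rho. is_partition rho \<and> diagram rho \<subseteq> diagram lam}" using pr by blast
  qed
qed

text \<open>Passes from powers by multiplicity to one factor for each part, the form in which
  operators are composed along \<open>mu\<close>.\<close>

lemma prod_count_list: "(\<Prod>k\<in>set mu. f k ^ count_list mu k) = prod_list (map f mu)"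
proof (induction mu)
  case (Cons a mu)
  have "(\<Prod>k\<in>set (a # mu). f k ^ count_list (a # mu) k) =
      (\<Prod>k\<in>set (a # mu). (if k = a then f a else 1) * f k ^ count_list mu k)"
    by (rule prod.cong) auto
  also have "\<dots> = f a * (\<Prod>k\<in>set (a # mu). f k ^ count_list mu k)"
    by (simp add: prod.distrib prod.delta del: prod.insert)
  also have "(\<Prod>k\<in>set (a # mu). f k ^ count_list mu k) = (\<Prod>k\<in>set mu. f k ^ count_list mu k)"
    by (rule prod.mono_neutral_right) auto
  finally show ?case by (simp add: Cons)
qed simp

lemma pi_part_eq:
  assumes "length rho \<le> N"
  shows "of_int (pi_part mu rho) = prod_list (map (\<lambda>k. pi_fun N k (point_of rho)) mu)"
proof -
  have "pi_fun N k (point_of rho) =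
     (\<Sum>i=1..length rho. (real i - real (part rho i)) ^ k - real i ^ k)" for k
    unfolding pi_fun_def using assms
    by (intro sum.mono_neutral_cong_right) (auto simp: point_of_def part_def)
  then show ?thesis
    by (simp add: pi_part_def prod_count_list[symmetric] sum_subtractf)
qed

lemma kappa_part_eq:
  assumes "length rho \<le> N"
  shows "of_int (kappa_part mu rho) = prod_list (map (\<lambda>k. kap N k 0 (point_of rho)) mu)"
proof -
  have "kap N k 0 (point_of rho) = kap (length rho) k 0 (point_of rho)" for k
    using assms by (intro kap_extend) (auto simp: point_of_def part_def)
  then show ?thesis
    by (simp add: kappa_part_def prod_count_list[symmetric] kap_eq_sum decreasing_lists_def point_of_def)
qed

text \<open>The common core of both formulas: \<open>g k\<close> is the shifted symmetric factor for
  a part \<open>k\<close>, and \<open>Z k\<close> is its leading term.\<close>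

lemma partition_sum_expansion:
  fixes P :: "nat list \<Rightarrow> int"
  assumes lam: "partition_of n lam" and n: "sum_list mu = n"
    and P: "\<And>rho. length rho \<le> length lam \<Longrightarrow>
        of_int (P rho) = prod_list (map (\<lambda>k. g k (point_of rho)) mu)"
    and g: "\<And>k. k \<in> set mu \<Longrightarrow> has_symbol (length lam) k (mult_op (g k)) (Z k)" "\<And>k. lin_op (Z k)"
    and sw: "\<And>k i x. 1 \<le> i \<Longrightarrow> i < length lam \<Longrightarrow> g k (swap_rows i x) = g k x"
  shows "(\<Sum>rho | is_partition rho \<and> diagram rho \<subseteq> diagram lam.
           (-1) ^ card (diagram lam - diagram rho) * of_int (P rho)
             / (H_diag (diagram rho) * H_diag (diagram lam - diagram rho))) =
         fold Z mu (alternant (length lam)) (point_of lam)"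
proof -
  let ?N = "length lam"
  let ?G = "\<lambda>x. prod_list (map (\<lambda>k. g k x) mu)"
  have L: "is_partition lam" using lam by (auto simp: partition_of_def is_partition_def)
  have "(\<Sum>rho | is_partition rho \<and> diagram rho \<subseteq> diagram lam.
           (-1) ^ card (diagram lam - diagram rho) * of_int (P rho)
             / (H_diag (diagram rho) * H_diag (diagram lam - diagram rho))) =
     (\<Sum>rho | is_partition rho \<and> diagram rho \<subseteq> diagram lam.
           (-1) ^ card (cells (point_of lam) - cells (point_of rho)) * ?G (point_of rho)
             / (H_diag (cells (point_of rho)) * H_diag (cells (point_of lam) - cells (point_of rho))))"
    by (intro sum.cong refl) (simp add: diagram_eq_cells[symmetric] P length_le_of_subset)
  also have "\<dots> = (\<Sum>y\<in>subpartitions ?N (point_of lam).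
           (-1) ^ card (cells (point_of lam) - cells y) * ?G y
             / (H_diag (cells y) * H_diag (cells (point_of lam) - cells y)))"
    by (rule sum.reindex_bij_betw[OF bij_betw_point_of[OF L]])
  also have "\<dots> = fold Z mu (alternant ?N) (point_of lam)"
  proof (rule symbol_expansion)
    show "point_of lam \<in> partition_points ?N" by (rule point_of_partition[OF L]) simp
    show "weight ?N (point_of lam) = int (sum_list mu)"
      using lam n by (simp add: weight_point_of partition_of_def)
    show "has_symbol ?N (sum_list mu) (mult_op ?G) (fold Z mu)"
      by (rule has_symbol_prod[OF g])
    show "?G (swap_rows i x) = ?G x" if "1 \<le> i" "i < ?N" for i x
      using sw[OF that] by simp
  qed
  finally show ?thesis .
qed

lemma kostka_expansion:
  assumes "partition_of n lam" "partition_of n mu"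
  shows "real (kostka lam mu) =
     (\<Sum>rho | is_partition rho \<and> diagram rho \<subseteq> diagram lam.
        (-1) ^ card (diagram lam - diagram rho) * real_of_int (kappa_part mu rho)
          / (H_diag (diagram rho) * H_diag (diagram lam - diagram rho)))"
proof -
  have "point_of lam \<in> partition_points (length lam)"
    using assms(1) by (intro point_of_partition) (auto simp: partition_of_def is_partition_def)
  then have "fold (hop (length lam)) mu (alternant (length lam)) (point_of lam) =
      real (card (ss_tableaux (point_of lam) mu))"
    by (rule fold_hop_alternant)
  moreover have "ss_tableaux (point_of lam) mu = semistandard_tableaux lam mu"
    by (simp add: ss_tableaux_def semistandard_tableaux_def diagram_eq_cells)
  ultimately show ?thesis
    using partition_sum_expansion[OF assms(1), of mu "kappa_part mu" "\<lambda>k. kap (length lam) k 0" "hop (length lam)"]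
      assms(2) kappa_part_eq has_symbol_kap[of "length lam" "length lam"] lin_hop kap_swap
    by (simp add: kostka_def partition_of_def)
qed

lemma fold_signed_power_op:
  "fold (\<lambda>k F x. (-1) ^ k * power_op N k F x) mu F = (\<lambda>x. (-1) ^ sum_list mu * fold (power_op N) mu F x)"
proof (induction mu rule: rev_induct)
  case (snoc k mu)
  then show ?case by (simp add: lin_op_scale[OF lin_power_op] power_add algebra_simps)
qed auto

text \<open>The symbols of the factors contribute \<open>(-1) ^ n\<close> in total. The sign
  attached to \<open>rho\<close> differs from that attached to the skew shape by the same
  \<open>(-1) ^ n\<close>, so the signs cancel.\<close>

lemma pi_expansion:
  assumes "partition_of n lam" "sum_list mu = n" "0 \<notin> set mu"
  shows "(\<Sum>rho | is_partition rho \<and> diagram rho \<subseteq> diagram lam.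
        (-1) ^ card (diagram rho) * real_of_int (pi_part mu rho)
          / (H_diag (diagram rho) * H_diag (diagram lam - diagram rho))) =
      fold (power_op (length lam)) mu (alternant (length lam)) (point_of lam)"
proof -
  let ?S = "{rho. is_partition rho \<and> diagram rho \<subseteq> diagram lam}"
  let ?N = "length lam"
  let ?r = "fold (power_op ?N) mu (alternant ?N) (point_of lam)"
  have L: "is_partition lam" using assms(1) by (auto simp: partition_of_def is_partition_def)
  have "(\<Sum>rho\<in>?S. (-1) ^ card (diagram lam - diagram rho) * real_of_int (pi_part mu rho)
          / (H_diag (diagram rho) * H_diag (diagram lam - diagram rho))) =
     fold (\<lambda>k F x. (-1) ^ k * power_op ?N k F x) mu (alternant ?N) (point_of lam)"
    using assms(3) by (intro partition_sum_expansion[OF assms(1,2), where g = "pi_fun ?N"])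
      (auto intro!: pi_part_eq has_symbol_pi_fun pi_fun_swap lin_scale lin_power_op Nat.gr0I)
  then have 1: "(\<Sum>rho\<in>?S. (-1) ^ card (diagram lam - diagram rho) * real_of_int (pi_part mu rho)
          / (H_diag (diagram rho) * H_diag (diagram lam - diagram rho))) = (-1) ^ n * ?r"
    by (simp add: fold_signed_power_op assms(2))
  have "(\<Sum>rho\<in>?S. (-1) ^ card (diagram rho) * real_of_int (pi_part mu rho)
          / (H_diag (diagram rho) * H_diag (diagram lam - diagram rho))) =
      (\<Sum>rho\<in>?S. (-1) ^ n * ((-1) ^ card (diagram lam - diagram rho) * real_of_int (pi_part mu rho)
          / (H_diag (diagram rho) * H_diag (diagram lam - diagram rho))))"
  proof (rule sum.cong[OF refl])
    fix rho assume rho: "rho \<in> ?S"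
    have lp: "point_of lam \<in> partition_points ?N" by (rule point_of_partition[OF L]) simp
    have f: "finite (diagram lam)" unfolding diagram_eq_cells by (rule finite_cells[OF lp])
    have "int (card (diagram lam)) = int n"
      using card_cells[OF lp] assms(1) by (simp add: diagram_eq_cells weight_point_of partition_of_def)
    then have "n = card (diagram rho) + card (diagram lam - diagram rho)"
      using rho f card_Diff_subset[of "diagram rho" "diagram lam"] card_mono[of "diagram lam" "diagram rho"]
      by (auto dest: finite_subset)
    then have "(-1) ^ card (diagram rho) = (-1 :: real) ^ n * (-1) ^ card (diagram lam - diagram rho)"
      by (simp add: power_add mult.assoc flip: power_mult_distrib)
    then show "(-1) ^ card (diagram rho) * real_of_int (pi_part mu rho)
          / (H_diag (diagram rho) * H_diag (diagram lam - diagram rho)) =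
       (-1) ^ n * ((-1) ^ card (diagram lam - diagram rho) * real_of_int (pi_part mu rho)
          / (H_diag (diagram rho) * H_diag (diagram lam - diagram rho)))" by simp
  qed
  also have "\<dots> = (-1) ^ n * ((-1) ^ n * ?r)" by (simp only: sum_distrib_left[symmetric] 1)
  also have "\<dots> = ?r" by (simp add: mult.assoc[symmetric] flip: power_mult_distrib)
  finally show ?thesis .
qed

section \<open>The Frobenius character formula as a class function\<close>

definition content :: "nat \<Rightarrow> (nat \<Rightarrow> 'a) \<Rightarrow> 'a \<Rightarrow> nat" where
  "content n f v = card {y \<in> {1..n}. f y = v}"

definition words :: "nat \<Rightarrow> nat \<Rightarrow> (nat \<Rightarrow> nat) set" where
  "words n N = {1..n} \<rightarrow>\<^sub>E {1..N}"

definition subtract :: "point \<Rightarrow> (nat \<Rightarrow> nat) \<Rightarrow> point" where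
  "subtract x m = (\<lambda>i. x i - int (m i))"

text \<open>With \<open>mu\<close> the cycle type of \<open>\<sigma>\<close>, this is the
  coefficient at \<open>x\<close> of \<open>p_mu\<close> times the Vandermonde determinant: choosing
  a variable in each factor of \<open>p_mu\<close> means choosing a word that is constant on cycles,
  and its content is the exponent vector. Summing over words fixed by \<open>\<sigma>\<close> gives
  access to permutation characters.\<close>

definition frobenius_character :: "nat \<Rightarrow> nat \<Rightarrow> point \<Rightarrow> (nat \<Rightarrow> nat) \<Rightarrow> real" where
  "frobenius_character n N x \<sigma> =
     (\<Sum>f | f \<in> words n N \<and> f \<circ> \<sigma> = f. alternant N (subtract x (content n f)))"

lemma finite_words: "finite (words n N)"
  by (simp add: words_def finite_PiE)

text \<open>Multiplying out a product of power sums: \<open>\<phi>\<close> selects a variable for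
  each set in \<open>os\<close>, whose cardinality is the degree of the factor.\<close>

lemma fold_power_op:
  assumes "distinct os"
  shows "fold (power_op N) (map card os) F x =
    (\<Sum>\<phi>\<in>set os \<rightarrow>\<^sub>E {1..N}. F (subtract x (\<lambda>i. \<Sum>o'\<in>{o' \<in> set os. \<phi> o' = i}. card o')))"
  using assms
proof (induction os arbitrary: F x)
  case Nil
  then show ?case by (simp add: subtract_def)
next
  case (Cons a os)
  let ?c = "\<lambda>S \<phi> i. \<Sum>o'\<in>{o' \<in> S. \<phi> o' = i}. card o'"
  have a: "a \<notin> set os" using Cons.prems by simp
  have c: "?c (insert a (set os)) (g(a := v)) = (?c (set os) g)(v := ?c (set os) g v + card a)" for g v
  proof
    fix i
    have "{o' \<in> insert a (set os). (g(a := v)) o' = i} =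
       (if v = i then insert a {o' \<in> set os. g o' = i} else {o' \<in> set os. g o' = i})"
      using a by auto
    then show "?c (insert a (set os)) (g(a := v)) i = ((?c (set os) g)(v := ?c (set os) g v + card a)) i"
      using a by auto
  qed
  have "(\<Sum>\<phi>\<in>set (a # os) \<rightarrow>\<^sub>E {1..N}. F (subtract x (?c (set (a # os)) \<phi>))) =
     (\<Sum>(v, g)\<in>{1..N} \<times> (set os \<rightarrow>\<^sub>E {1..N}). F (subtract x (?c (insert a (set os)) (g(a := v)))))"
    unfolding list.set PiE_insert_eq
    by (subst sum.reindex[OF inj_combinator[OF a]]) (simp add: case_prod_beta comp_def)
  also have "\<dots> = (\<Sum>v=1..N. \<Sum>g\<in>set os \<rightarrow>\<^sub>E {1..N}. F (subtract x (?c (insert a (set os)) (g(a := v)))))"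
    by (rule sum.cartesian_product[symmetric])
  also have "\<dots> = (\<Sum>g\<in>set os \<rightarrow>\<^sub>E {1..N}. \<Sum>v=1..N. F (subtract x (?c (insert a (set os)) (g(a := v)))))"
    by (rule sum.swap)
  also have "\<dots> = (\<Sum>g\<in>set os \<rightarrow>\<^sub>E {1..N}. power_op N (card a) F (subtract x (?c (set os) g)))"
  proof (intro sum.cong refl)
    fix g
    have "subtract x (?c (insert a (set os)) (g(a := v))) =
       (subtract x (?c (set os) g))(v := subtract x (?c (set os) g) v - int (card a))" for v
      unfolding c by (auto simp: subtract_def)
    then show "(\<Sum>v=1..N. F (subtract x (?c (insert a (set os)) (g(a := v))))) =
        power_op N (card a) F (subtract x (?c (set os) g))"
      unfolding power_op_def by simp
  qed
  also have "\<dots> = fold (power_op N) (map card os) (power_op N (card a) F) x"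
    using Cons by simp
  finally show ?case by simp
qed

lemma power_op_commute: "power_op N k \<circ> power_op N l = power_op N l \<circ> power_op N k"
proof (intro ext)
  fix F and x :: point
  have u: "(x(i := x i - int k))(j := (x(i := x i - int k)) j - int l) =
     (x(j := x j - int l))(i := (x(j := x j - int l)) i - int k)" for i j
    by (auto simp: fun_eq_iff)
  show "(power_op N k \<circ> power_op N l) F x = (power_op N l \<circ> power_op N k) F x"
    unfolding comp_def power_op_def u by (rule sum.swap)
qed

section \<open>Orbits and invariant words\<close>

lemma orbit_eq_of_mem:
  assumes "permutation \<sigma>" "z \<in> orbit \<sigma> y"
  shows "orbit \<sigma> z = orbit \<sigma> y"
  using orbit_cyclic_eq3[OF cyclic_on_orbit'[OF assms(1)] assms(2)] .

lemma fixed_on_orbit: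
  assumes "f \<circ> \<sigma> = f" "z \<in> orbit \<sigma> y"
  shows "f z = f y"
  using assms(2) by induction (use fun_cong[OF assms(1)] in auto)

text \<open>A word fixed by \<open>\<sigma>\<close> is a function on orbits, read off at a chosen
  element of each orbit; a letter occurs as often as the total size of the orbits that carry
  it.\<close>

lemma orbit_functions:
  fixes \<sigma> :: "nat \<Rightarrow> nat"
  assumes \<sigma>: "\<sigma> permutes {1..n}"
  defines "O' \<equiv> orbit \<sigma> ` {1..n}"
  shows "(\<Sum>\<phi>\<in>O' \<rightarrow>\<^sub>E {1..N}. F (\<lambda>i. \<Sum>o'\<in>{o' \<in> O'. \<phi> o' = i}. card o')) =
    (\<Sum>f | f \<in> words n N \<and> f \<circ> \<sigma> = f. F (content n f))"
proof -
  have perm: "permutation \<sigma>" using \<sigma> permutes_imp_permutation by blast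
  have self: "y \<in> orbit \<sigma> y" for y by (rule permutation_self_in_orbit[OF perm])
  have sub: "orbit \<sigma> y \<subseteq> {1..n}" if "y \<in> {1..n}" for y using permutes_orbit_subset[OF \<sigma> that] .
  have step: "orbit \<sigma> (\<sigma> y) = orbit \<sigma> y" for y by (rule permutation_orbit_step[OF perm])
  have some: "(SOME y. y \<in> o') \<in> o'" "orbit \<sigma> (SOME y. y \<in> o') = o'" if orb: "o' \<in> O'" for o'
  proof -
    obtain y where y: "o' = orbit \<sigma> y" using orb unfolding O'_def by blast
    show s: "(SOME y. y \<in> o') \<in> o'" unfolding y by (rule someI[of _ y]) (rule self)
    show "orbit \<sigma> (SOME y. y \<in> o') = o'" using orbit_eq_of_mem[OF perm] s y by blast
  qed
  have some_mem: "(SOME y. y \<in> o') \<in> {1..n}" if orb: "o' \<in> O'" for o'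
    using some(1)[OF orb] orb sub unfolding O'_def by blast
  let ?f = "\<lambda>\<phi> :: nat set \<Rightarrow> nat. \<lambda>y\<in>{1..n}. \<phi> (orbit \<sigma> y)"
  let ?g = "\<lambda>f :: nat \<Rightarrow> nat. \<lambda>o'\<in>O'. f (SOME y. y \<in> o')"
  show ?thesis
  proof (rule sum.reindex_bij_witness[where i = ?g and j = ?f])
    fix \<phi> assume \<phi>: "\<phi> \<in> O' \<rightarrow>\<^sub>E {1..N}"
    have O: "orbit \<sigma> y \<in> O' \<longleftrightarrow> y \<in> {1..n}" for y
      using sub self by (fastforce simp: O'_def)
    show "?f \<phi> \<in> {f. f \<in> words n N \<and> f \<circ> \<sigma> = f}"
      using \<phi> O permutes_in_image[OF \<sigma>] by (auto simp: words_def PiE_iff fun_eq_iff step)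
    show "?g (?f \<phi>) = \<phi>"
    proof
      fix o' show "?g (?f \<phi>) o' = \<phi> o'"
      proof (cases "o' \<in> O'")
        case True
        from some_mem[OF True] show ?thesis using True some(2)[OF True] by simp
      next
        case False
        then show ?thesis using \<phi> by (auto simp: PiE_iff extensional_def)
      qed
    qed
    have "content n (?f \<phi>) i = (\<Sum>o'\<in>{o' \<in> O'. \<phi> o' = i}. card o')" for i
    proof -
      have "{y \<in> {1..n}. ?f \<phi> y = i} = (\<Union>o'\<in>{o' \<in> O'. \<phi> o' = i}. o')"
      proof (intro set_eqI iffI)
        fix y assume "y \<in> {y \<in> {1..n}. ?f \<phi> y = i}"
        then have "orbit \<sigma> y \<in> {o' \<in> O'. \<phi> o' = i}" using O by auto
        then show "y \<in> (\<Union>o'\<in>{o' \<in> O'. \<phi> o' = i}. o')" using self by blast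
      next
        fix y assume "y \<in> (\<Union>o'\<in>{o' \<in> O'. \<phi> o' = i}. o')"
        then obtain z where z: "z \<in> {1..n}" "y \<in> orbit \<sigma> z" "\<phi> (orbit \<sigma> z) = i" by (auto simp: O'_def)
        then have "y \<in> {1..n}" using sub by blast
        moreover have "orbit \<sigma> y = orbit \<sigma> z" using orbit_eq_of_mem[OF perm z(2)] .
        ultimately show "y \<in> {y \<in> {1..n}. ?f \<phi> y = i}" using z by simp
      qed
      moreover have "card (\<Union>o'\<in>{o' \<in> O'. \<phi> o' = i}. o') = (\<Sum>o'\<in>{o' \<in> O'. \<phi> o' = i}. card o')"
      proof (rule card_UN_disjoint)
        show "finite {o' \<in> O'. \<phi> o' = i}" by (simp add: O'_def)
        show "\<forall>o'\<in>{o' \<in> O'. \<phi> o' = i}. finite o'"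
          by (auto simp: O'_def finite_orbit[OF self])
        show "\<forall>o'\<in>{o' \<in> O'. \<phi> o' = i}. \<forall>o''\<in>{o' \<in> O'. \<phi> o' = i}. o' \<noteq> o'' \<longrightarrow> o' \<inter> o'' = {}"
          using orbit_eq_of_mem[OF perm] unfolding O'_def by blast
      qed
      ultimately show ?thesis by (simp add: content_def)
    qed
    then show "F (content n (?f \<phi>)) = F (\<lambda>i. \<Sum>o'\<in>{o' \<in> O'. \<phi> o' = i}. card o')"
      by (metis (no_types, lifting) ext)
  next
    fix f assume "f \<in> {f. f \<in> words n N \<and> f \<circ> \<sigma> = f}"
    then have f: "f \<in> words n N" "f \<circ> \<sigma> = f" by auto
    from some_mem show "?g f \<in> O' \<rightarrow>\<^sub>E {1..N}" using f(1) by (auto simp: words_def PiE_iff)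
    show "?f (?g f) = f"
    proof
      fix y show "?f (?g f) y = f y"
      proof (cases "y \<in> {1..n}")
        case True
        then have O: "orbit \<sigma> y \<in> O'" by (simp add: O'_def)
        have "f (SOME z. z \<in> orbit \<sigma> y) = f y" using fixed_on_orbit[OF f(2)] some(1)[OF O] by blast
        then show ?thesis using True O by simp
      next
        case False
        then show ?thesis using f(1) by (auto simp: words_def PiE_iff extensional_def)
      qed
    qed
  qed
qed

text \<open>The cycle type fixes the cycle lengths as a multiset only; the operators
  \<open>power_op\<close> commute, so their order is immaterial.\<close>

lemma fold_power_op_cycle_type:
  assumes "has_cycle_type n \<sigma> mu"
  shows "fold (power_op N) mu (alternant N) x = frobenius_character n N x \<sigma>"
proof -
  let ?O = "orbit \<sigma> ` {1..n}"
  have \<sigma>: "\<sigma> permutes {1..n}" and mu: "mset mu = image_mset card (mset_set ?O)"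
    using assms by (auto simp: has_cycle_type_def)
  obtain os where os: "set os = ?O" "distinct os" using finite_distinct_list[of ?O] by auto
  have "mset (map card os) = mset mu" using mu os mset_set_set[OF os(2)] by simp
  then have "fold (power_op N) mu = fold (power_op N) (map card os)"
    using power_op_commute by (intro fold_multiset_equiv) auto
  then show ?thesis
    unfolding frobenius_character_def
    using fold_power_op[OF os(2), of N "alternant N" x]
      orbit_functions[OF \<sigma>, where N = N and F = "\<lambda>m. alternant N (subtract x m)"] os(1) by simp
qed

section \<open>Counting words by content\<close>

lemma content_permute:
  assumes "\<tau> permutes {1..n}"
  shows "content n (f \<circ> \<tau>) = content n f"
proof
  fix v
  have "bij_betw \<tau> {y \<in> {1..n}. (f \<circ> \<tau>) y = v} {y \<in> {1..n}. f y = v}"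
    using permutes_inj_on[OF assms] permutes_in_image[OF assms] permutes_surj[OF assms]
    by (auto simp: bij_betw_def image_iff) (metis surjD atLeastAtMost_iff One_nat_def)
  then show "content n (f \<circ> \<tau>) v = content n f v" by (simp add: content_def bij_betw_same_card)
qed

lemma extensional_permute:
  assumes "\<tau> permutes {1..n}" "f \<in> extensional {1..n}"
  shows "f \<circ> \<tau> \<in> extensional {1..n}"
  using assms by (auto simp: extensional_def permutes_not_in)

lemma same_content_permute:
  fixes f g :: "nat \<Rightarrow> 'a"
  assumes "f \<in> extensional {1..n}" "g \<in> extensional {1..n}" "content n f = content n g"
  obtains \<tau> where "\<tau> permutes {1..n}" "f \<circ> \<tau> = g"
proof -
  have "\<exists>h. bij_betw h {y \<in> {1..n}. g y = v} {y \<in> {1..n}. f y = v}" for v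
    using fun_cong[OF assms(3), of v] by (intro finite_same_card_bij) (auto simp: content_def)
  then obtain h where h: "\<And>v. bij_betw (h v) {y \<in> {1..n}. g y = v} {y \<in> {1..n}. f y = v}" by metis
  define \<tau> where "\<tau> y = (if y \<in> {1..n} then h (g y) y else y)" for y
  have \<tau>: "\<tau> y \<in> {1..n} \<and> f (\<tau> y) = g y" if "y \<in> {1..n}" for y
    using bij_betwE[OF h[of "g y"]] that by (auto simp: \<tau>_def)
  have "inj_on \<tau> {1..n}"
  proof (rule inj_onI)
    fix y z assume yz: "y \<in> {1..n}" "z \<in> {1..n}" "\<tau> y = \<tau> z"
    then have "g y = g z" using \<tau>[of y] \<tau>[of z] by simp
    then show "y = z" using yz bij_betw_imp_inj_on[OF h[of "g y"]] by (auto simp: \<tau>_def dest: inj_onD)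
  qed
  moreover from this have "\<tau> ` {1..n} = {1..n}" using \<tau> by (intro endo_inj_surj) auto
  ultimately have "bij_betw \<tau> {1..n} {1..n}" by (simp add: bij_betw_def)
  then have "\<tau> permutes {1..n}" by (rule bij_imp_permutes) (auto simp: \<tau>_def)
  moreover have "f \<circ> \<tau> = g"
  proof
    fix y show "(f \<circ> \<tau>) y = g y"
      using \<tau>[of y] assms(1,2) by (cases "y \<in> {1..n}") (auto simp: \<tau>_def extensional_def)
  qed
  ultimately show thesis by (rule that)
qed

text \<open>The words with the content of \<open>f0\<close> form one orbit of the symmetric group,
  and orbit size times stabilizer size is \<open>n!\<close>.\<close>

lemma sum_card_stabilizers:
  fixes f0 :: "nat \<Rightarrow> 'a"
  assumes "f0 \<in> extensional {1..n}"
  shows "(\<Sum>f | f \<in> extensional {1..n} \<and> content n f = content n f0.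
     card {\<sigma>. \<sigma> permutes {1..n} \<and> f \<circ> \<sigma> = f}) = fact n"
proof -
  let ?G = "{\<tau>. \<tau> permutes {1..n}}"
  have fG: "finite ?G" by (rule finite_permutations) simp
  have orb: "{f. f \<in> extensional {1..n} \<and> content n f = content n f0} = (\<lambda>\<tau>. f0 \<circ> \<tau>) ` ?G"
  proof (intro set_eqI iffI)
    fix f assume "f \<in> {f. f \<in> extensional {1..n} \<and> content n f = content n f0}"
    then obtain \<tau> where "\<tau> permutes {1..n}" "f0 \<circ> \<tau> = f"
      using same_content_permute[OF assms, of f] by auto
    then show "f \<in> (\<lambda>\<tau>. f0 \<circ> \<tau>) ` ?G" by blast
  next
    fix f assume "f \<in> (\<lambda>\<tau>. f0 \<circ> \<tau>) ` ?G"
    then show "f \<in> {f. f \<in> extensional {1..n} \<and> content n f = content n f0}"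
      using content_permute extensional_permute assms by fastforce
  qed
  have "card {\<sigma>. \<sigma> permutes {1..n} \<and> f \<circ> \<sigma> = f} = card {\<tau> \<in> ?G. f0 \<circ> \<tau> = f}"
    if f: "f \<in> (\<lambda>\<tau>. f0 \<circ> \<tau>) ` ?G" for f
  proof -
    obtain \<tau> where \<tau>: "\<tau> permutes {1..n}" "f = f0 \<circ> \<tau>" using f by auto
    \<comment> \<open>The permutations that carry \<open>f0\<close> to \<open>f\<close> form the
      coset of the stabilizer of \<open>f\<close> through \<open>\<tau>\<close>.\<close>
    have "bij_betw (\<lambda>\<sigma>. \<tau> \<circ> \<sigma>) {\<sigma>. \<sigma> permutes {1..n} \<and> f \<circ> \<sigma> = f} {\<tau> \<in> ?G. f0 \<circ> \<tau> = f}"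
      by (rule bij_betwI[where g = "\<lambda>\<rho>. inv \<tau> \<circ> \<rho>"])
        (auto simp: \<tau> permutes_compose permutes_inv comp_assoc[symmetric] permutes_inv_o[OF \<tau>(1)] simp del: One_nat_def,
          auto simp: \<tau> comp_assoc permutes_inv_o[OF \<tau>(1)] permutes_compose permutes_inv simp del: One_nat_def)
    then show ?thesis by (rule bij_betw_same_card)
  qed
  then have "(\<Sum>f\<in>(\<lambda>\<tau>. f0 \<circ> \<tau>) ` ?G. card {\<sigma>. \<sigma> permutes {1..n} \<and> f \<circ> \<sigma> = f}) =
     (\<Sum>f\<in>(\<lambda>\<tau>. f0 \<circ> \<tau>) ` ?G. \<Sum>\<tau> | \<tau> \<in> ?G \<and> f0 \<circ> \<tau> = f. 1)" by simp
  also have "\<dots> = (\<Sum>\<tau>\<in>?G. 1)" by (rule sum.group) (use fG in auto)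
  also have "\<dots> = fact n" using card_permutations[of "{1..n}" n] by simp
  finally show ?thesis by (simp only: orb)
qed

lemma exists_word_with_content:
  assumes "finite V" "\<And>v. v \<notin> V \<Longrightarrow> m v = 0" "(\<Sum>v\<in>V. m v) = n"
  obtains f where "f \<in> {1..n} \<rightarrow>\<^sub>E V" "content n f = m"
proof -
  obtain xs where xs: "mset xs = (\<Sum>v\<in>V. replicate_mset (m v) v)" using ex_mset by blast
  have "count (\<Sum>v\<in>V. replicate_mset (m v) v) u = (\<Sum>v\<in>V. if v = u then m v else 0)" for u
    unfolding count_sum by (rule sum.cong) auto
  then have cnt: "count (mset xs) u = m u" for u
    using assms(1,2) by (cases "u \<in> V") (auto simp: xs)
  have "length xs = size (mset xs)" by simp
  also have "\<dots> = (\<Sum>v\<in>V. m v)" unfolding xs using assms(1) by induction auto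
  also note assms(3)
  finally have len: "length xs = n" .
  define f where "f = (\<lambda>y\<in>{1..n}. xs ! (y - 1))"
  have "content n f v = m v" for v
  proof -
    have "bij_betw Suc {i. i < n \<and> v = xs ! i} {y \<in> {1..n}. f y = v}"
      by (rule bij_betwI[where g = "\<lambda>y. y - 1"]) (auto simp: f_def)
    from bij_betw_same_card[OF this] have "content n f v = card {i. i < length xs \<and> v = xs ! i}"
      by (simp add: content_def len)
    also have "\<dots> = count (mset xs) v"
      by (simp add: count_mset count_list_eq_length_filter length_filter_conv_card)
    finally show ?thesis by (simp add: cnt)
  qed
  then have c: "content n f = m" ..
  have "f y \<in> V" if "y \<in> {1..n}" for y
  proof (rule ccontr)
    assume "f y \<notin> V"
    then have "content n f (f y) = 0" using c assms(2) by simp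
    then show False using that by (auto simp: content_def)
  qed
  then have "f \<in> {1..n} \<rightarrow>\<^sub>E V" by (auto simp: f_def)
  then show thesis using c by (rule that)
qed

lemma sum_content:
  assumes "finite V" "f \<in> {1..n} \<rightarrow> V"
  shows "(\<Sum>v\<in>V. content n f v) = n"
proof -
  have "(\<Sum>v\<in>V. content n f v) = (\<Sum>v\<in>V. \<Sum>y\<in>{y \<in> {1..n}. f y = v}. 1)"
    by (simp add: content_def)
  also have "\<dots> = (\<Sum>y\<in>{1..n}. 1)" by (rule sum.group) (use assms in auto)
  finally show ?thesis by simp
qed

text \<open>A weighted Burnside count: after exchanging the sums, the words of each content
  contribute \<open>n!\<close> times the weight.\<close>

lemma sum_fixed_words:
  fixes W :: "('a \<Rightarrow> nat) \<Rightarrow> real"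
  assumes V: "finite V"
  shows "(\<Sum>\<sigma> | \<sigma> permutes {1..n}. \<Sum>f | f \<in> {1..n} \<rightarrow>\<^sub>E V \<and> f \<circ> \<sigma> = f. W (content n f)) =
    fact n * (\<Sum>m | (\<forall>v. v \<notin> V \<longrightarrow> m v = 0) \<and> (\<Sum>v\<in>V. m v) = n. W m)"
proof -
  let ?G = "{\<tau>. \<tau> permutes {1..n}}"
  let ?A = "{1..n} \<rightarrow>\<^sub>E V"
  let ?M = "{m. (\<forall>v. v \<notin> V \<longrightarrow> m v = 0) \<and> (\<Sum>v\<in>V. m v) = n}"
  have fG: "finite ?G" by (rule finite_permutations) simp
  have fA: "finite ?A" using V by (simp add: finite_PiE)
  have im: "content n f \<in> ?M" if "f \<in> ?A" for f
    using that sum_content[OF V, of f n] by (auto simp: content_def PiE_iff) 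
  have "?M \<subseteq> content n ` ?A"
  proof
    fix m assume "m \<in> ?M"
    then obtain f where "f \<in> ?A" "content n f = m" using exists_word_with_content[OF V, of m n] by auto
    then show "m \<in> content n ` ?A" by blast
  qed
  then have fM: "finite ?M" using fA finite_surj by blast
  have fib: "{f \<in> ?A. content n f = m} = {f. f \<in> extensional {1..n} \<and> content n f = m}" if m: "m \<in> ?M" for m
  proof -
    have "f y \<in> V" if "content n f = m" "y \<in> {1..n}" for f y
    proof (rule ccontr)
      assume "f y \<notin> V"
      then have "content n f (f y) = 0" using m that by simp
      then show False using that by (auto simp: content_def)
    qed
    then show ?thesis by (auto simp: PiE_iff)
  qed
  have "(\<Sum>\<sigma>\<in>?G. \<Sum>f | f \<in> ?A \<and> f \<circ> \<sigma> = f. W (content n f)) =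
     (\<Sum>\<sigma>\<in>?G. \<Sum>f\<in>?A. if f \<circ> \<sigma> = f then W (content n f) else 0)"
    using fA by (simp add: sum.If_cases Int_def)
  also have "\<dots> = (\<Sum>f\<in>?A. \<Sum>\<sigma>\<in>?G. if f \<circ> \<sigma> = f then W (content n f) else 0)" by (rule sum.swap)
  also have "\<dots> = (\<Sum>f\<in>?A. W (content n f) * real (card {\<sigma>. \<sigma> permutes {1..n} \<and> f \<circ> \<sigma> = f}))"
    using fG by (simp add: sum.If_cases Int_def mult.commute)
  also have "\<dots> = (\<Sum>m\<in>?M. \<Sum>f\<in>{f \<in> ?A. content n f = m}.
      W (content n f) * real (card {\<sigma>. \<sigma> permutes {1..n} \<and> f \<circ> \<sigma> = f}))"
    by (rule sum.group[symmetric]) (use fA fM im in auto)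
  also have "\<dots> = (\<Sum>m\<in>?M. W m * fact n)"
  proof (rule sum.cong[OF refl])
    fix m assume m: "m \<in> ?M"
    obtain f0 where f0: "f0 \<in> ?A" "content n f0 = m"
      using exists_word_with_content[OF V, of m n] m by auto
    have "(\<Sum>f\<in>{f \<in> ?A. content n f = m}. real (card {\<sigma>. \<sigma> permutes {1..n} \<and> f \<circ> \<sigma> = f})) = fact n"
      unfolding fib[OF m] using sum_card_stabilizers[of f0 n] f0
      by (simp add: PiE_iff flip: of_nat_sum)
    then show "(\<Sum>f\<in>{f \<in> ?A. content n f = m}.
      W (content n f) * real (card {\<sigma>. \<sigma> permutes {1..n} \<and> f \<circ> \<sigma> = f})) = W m * fact n"
      by (simp add: sum_distrib_left[symmetric])
  qed
  finally show ?thesis by (simp add: sum_distrib_left mult.commute)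
qed

text \<open>The choices of one monomial from each factor of \<open>h_mu\<close>: column
  \<open>j\<close> is the exponent vector taken from the \<open>j\<close>-th factor, and the row
  sums are the exponents of the product.\<close>

definition margin_matrices :: "nat \<Rightarrow> nat list \<Rightarrow> (nat \<times> nat \<Rightarrow> nat) set" where
  "margin_matrices N mu = {m. (\<forall>v. v \<notin> {1..N} \<times> {1..length mu} \<longrightarrow> m v = 0) \<and>
     (\<forall>j\<in>{1..length mu}. (\<Sum>i=1..N. m (i, j)) = part mu j)}"

lemma fold_hop_matrices:
  "fold (hop N) mu F x =
    (\<Sum>m\<in>margin_matrices N mu. F (subtract x (\<lambda>i. \<Sum>j=1..length mu. m (i, j))))"
proof (induction mu arbitrary: x rule: rev_induct)
  case Nil
  have "margin_matrices N [] = {\<lambda>_. 0}" by (auto simp: margin_matrices_def)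
  then show ?case by (simp add: subtract_def)
next
  case (snoc k mu)
  let ?L = "length mu"
  let ?row = "\<lambda>L m i. \<Sum>j=1..L. m (i, j) :: nat"
  have "fold (hop N) (mu @ [k]) F x = (\<Sum>y\<in>lower_set N k x. \<Sum>m\<in>margin_matrices N mu. F (subtract y (?row ?L m)))"
    by (simp add: hop_eq_sum snoc)
  also have "\<dots> = (\<Sum>(y, m)\<in>lower_set N k x \<times> margin_matrices N mu. F (subtract y (?row ?L m)))"
    by (rule sum.cartesian_product)
  also have "\<dots> = (\<Sum>m\<in>margin_matrices N (mu @ [k]). F (subtract x (?row (length (mu @ [k])) m)))"
  proof (rule sum.reindex_bij_witness[where
      i = "\<lambda>m. (\<lambda>i. x i - int (m (i, Suc ?L)), \<lambda>v. if snd v = Suc ?L then 0 else m v)" and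
      j = "\<lambda>p v. if snd v = Suc ?L then nat (x (fst v) - fst p (fst v)) else snd p v"])
    fix p assume p: "p \<in> lower_set N k x \<times> margin_matrices N mu"
    define y m where "y = fst p" and "m = snd p"
    then have y: "y \<in> lower_set N k x" and m: "m \<in> margin_matrices N mu" and p_eq: "p = (y, m)"
      using p by auto
    let ?m = "\<lambda>v. if snd v = Suc ?L then nat (x (fst v) - y (fst v)) else m v"
    have le: "y i \<le> x i" for i using y by (cases "i \<in> {1..N}") (auto simp: lower_set_def)
    show "(\<lambda>i. x i - int ((\<lambda>v. if snd v = Suc ?L then nat (x (fst v) - fst p (fst v)) else snd p v) (i, Suc ?L)),
        \<lambda>v. if snd v = Suc ?L then 0 else (\<lambda>v. if snd v = Suc ?L then nat (x (fst v) - fst p (fst v)) else snd p v) v) = p"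
      using le m by (auto simp: p_eq fun_eq_iff margin_matrices_def)
    have "(\<Sum>i=1..N. ?m (i, Suc ?L)) = k"
    proof -
      have "int (\<Sum>i=1..N. nat (x i - y i)) = weight N x - weight N y"
        using le by (simp add: weight_def sum_subtractf)
      also have "\<dots> = int k" using y by (simp add: lower_set_def)
      finally show ?thesis unfolding of_nat_eq_iff by simp
    qed
    then have last: "(\<Sum>i=1..N. ?m (i, Suc ?L)) = part (mu @ [k]) (Suc ?L)" by (simp add: part_def)
    have init: "(\<Sum>i=1..N. ?m (i, j)) = part (mu @ [k]) j" if "j \<in> {1..?L}" for j
      using that m by (auto simp: margin_matrices_def part_def nth_append)
    have "(\<Sum>i=1..N. ?m (i, j)) = part (mu @ [k]) j" if "j \<in> {1..Suc ?L}" for j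
    proof (cases "j = Suc ?L")
      case True
      then show ?thesis using last by simp
    next
      case False
      then show ?thesis using that by (intro init) auto
    qed
    moreover have "?m v = 0" if "v \<notin> {1..N} \<times> {1..Suc ?L}" for v
      using that m y by (cases v) (auto simp: margin_matrices_def lower_set_def)
    ultimately have "?m \<in> margin_matrices N (mu @ [k])"
      unfolding margin_matrices_def length_append_singleton by blast
    then show "(\<lambda>v. if snd v = Suc ?L then nat (x (fst v) - fst p (fst v)) else snd p v)
        \<in> margin_matrices N (mu @ [k])"
      by (simp only: p_eq fst_conv snd_conv)
    have "?row (length (mu @ [k])) ?m i = ?row ?L m i + nat (x i - y i)" for i by simp
    then have "subtract x (?row (length (mu @ [k])) ?m) = subtract y (?row ?L m)"
      using le by (simp add: subtract_def fun_eq_iff)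
    then show "F (subtract x (?row (length (mu @ [k]))
        (\<lambda>v. if snd v = Suc ?L then nat (x (fst v) - fst p (fst v)) else snd p v))) =
        (case p of (y, m) \<Rightarrow> F (subtract y (?row ?L m)))"
      unfolding p_eq fst_conv snd_conv prod.case by (rule arg_cong)
  next
    fix m assume m: "m \<in> margin_matrices N (mu @ [k])"
    let ?y = "\<lambda>i. x i - int (m (i, Suc ?L))"
    let ?m = "\<lambda>v. if snd v = Suc ?L then 0 else m v"
    show "(\<lambda>v. if snd v = Suc ?L then nat (x (fst v) - fst (?y, ?m) (fst v)) else snd (?y, ?m) v) = m"
      by (auto simp: fun_eq_iff)
    have z: "m v = 0" if "v \<notin> {1..N} \<times> {1..Suc ?L}" for v using m that unfolding margin_matrices_def length_append_singleton by blast
    have s: "(\<Sum>i=1..N. m (i, j)) = part (mu @ [k]) j" if "j \<in> {1..Suc ?L}" for j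
      using m that unfolding margin_matrices_def length_append_singleton by blast
    have "weight N x - weight N ?y = int (\<Sum>i=1..N. m (i, Suc ?L))"
      by (simp add: weight_def sum_subtractf)
    also have "\<dots> = int k" using s[of "Suc ?L"] by (simp add: part_def)
    finally have "?y \<in> lower_set N k x" using z by (simp add: lower_set_def)
    moreover have "?m \<in> margin_matrices N mu"
      unfolding margin_matrices_def
    proof (intro CollectI conjI allI ballI impI)
      fix v assume "v \<notin> {1..N} \<times> {1..?L}"
      then show "?m v = 0" using z[of v] by (cases v) (auto simp: le_Suc_eq)
    next
      fix j assume "j \<in> {1..?L}"
      then show "(\<Sum>i=1..N. ?m (i, j)) = part mu j" using s[of j] by (auto simp: part_def nth_append)
    qed
    ultimately show "(?y, ?m) \<in> lower_set N k x \<times> margin_matrices N mu" by blast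
  qed
  finally show ?case .
qed

text \<open>The character of the permutation representation on the words with content
  \<open>m\<close>.\<close>

definition word_character :: "nat \<Rightarrow> nat \<Rightarrow> (nat \<Rightarrow> nat) \<Rightarrow> (nat \<Rightarrow> nat) \<Rightarrow> real" where
  "word_character n N m \<sigma> = real (card {f. f \<in> words n N \<and> f \<circ> \<sigma> = f \<and> (\<forall>i\<in>{1..N}. content n f i = m i)})"

lemma word_content_0: "f \<in> words n N \<Longrightarrow> i \<notin> {1..N} \<Longrightarrow> content n f i = 0"
  by (force simp: words_def content_def PiE_iff)

lemma content_pair:
  fixes N :: nat
  assumes "h \<in> {1..n} \<rightarrow>\<^sub>E {1..N} \<times> {1..N}"
  shows "content n (\<lambda>y\<in>{1..n}. fst (h y)) i = (\<Sum>j=1..N. content n h (i, j))"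
    and "content n (\<lambda>y\<in>{1..n}. snd (h y)) i = (\<Sum>j=1..N. content n h (j, i))"
proof -
  have h: "snd (h y) \<in> {1..N} \<and> fst (h y) \<in> {1..N}" if "y \<in> {1..n}" for y
    using PiE_mem[OF assms that] by auto
  have "content n (\<lambda>y\<in>{1..n}. fst (h y)) i = (\<Sum>y\<in>{y \<in> {1..n}. fst (h y) = i}. 1)"
    by (auto simp: content_def intro: arg_cong[where f = card])
  also have "\<dots> = (\<Sum>j=1..N. \<Sum>y\<in>{y \<in> {y \<in> {1..n}. fst (h y) = i}. snd (h y) = j}. 1)"
    by (rule sum.group[where g = "\<lambda>y. snd (h y)", symmetric]) (simp, simp, use h in blast)
  also have "\<dots> = (\<Sum>j=1..N. content n h (i, j))"
    by (auto simp: content_def prod_eq_iff intro!: sum.cong arg_cong[where f = card])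
  finally show "content n (\<lambda>y\<in>{1..n}. fst (h y)) i = (\<Sum>j=1..N. content n h (i, j))" .
  have "content n (\<lambda>y\<in>{1..n}. snd (h y)) i = (\<Sum>y\<in>{y \<in> {1..n}. snd (h y) = i}. 1)"
    by (auto simp: content_def intro: arg_cong[where f = card])
  also have "\<dots> = (\<Sum>j=1..N. \<Sum>y\<in>{y \<in> {y \<in> {1..n}. snd (h y) = i}. fst (h y) = j}. 1)"
    by (rule sum.group[where g = "\<lambda>y. fst (h y)", symmetric]) (simp, simp, use h in blast)
  also have "\<dots> = (\<Sum>j=1..N. content n h (j, i))"
    by (auto simp: content_def prod_eq_iff conj_commute intro!: sum.cong arg_cong[where f = card])
  finally show "content n (\<lambda>y\<in>{1..n}. snd (h y)) i = (\<Sum>j=1..N. content n h (j, i))" .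
qed

text \<open>Two invariant words make one invariant word in pairs; its content is a matrix whose
  margins are the two contents.\<close>

lemma frobenius_times_word_character:
  fixes N :: nat
  assumes "\<sigma> permutes {1..n}"
  shows "frobenius_character n N x \<sigma> * word_character n N m \<sigma> =
    (\<Sum>h | h \<in> {1..n} \<rightarrow>\<^sub>E {1..N} \<times> {1..N} \<and> h \<circ> \<sigma> = h.
       if \<forall>i\<in>{1..N}. (\<Sum>j=1..N. content n h (j, i)) = m i
       then alternant N (subtract x (\<lambda>i. \<Sum>j=1..N. content n h (i, j))) else 0)"
proof -
  let ?F = "{f. f \<in> words n N \<and> f \<circ> \<sigma> = f}"
  let ?H = "{h. h \<in> {1..n} \<rightarrow>\<^sub>E {1..N} \<times> {1..N} \<and> h \<circ> \<sigma> = h}"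
  let ?c = "\<lambda>g. \<forall>i\<in>{1..N}. content n g i = m i"
  let ?fst = "\<lambda>h y. if y \<in> {1..n} then fst (h y) else undefined :: nat"
  let ?snd = "\<lambda>h y. if y \<in> {1..n} then snd (h y) else undefined :: nat"
  have fF: "finite ?F" using finite_words[of n N] by simp
  have \<sigma>: "\<sigma> y \<in> {1..n} \<longleftrightarrow> y \<in> {1..n}" for y by (rule permutes_in_image[OF assms])
  have "word_character n N m \<sigma> = (\<Sum>g\<in>?F. if ?c g then 1 else 0)"
    unfolding word_character_def using fF by (simp add: sum.If_cases Int_def conj_assoc)
  then have "frobenius_character n N x \<sigma> * word_character n N m \<sigma> =
     (\<Sum>f\<in>?F. \<Sum>g\<in>?F. alternant N (subtract x (content n f)) * (if ?c g then 1 else 0))"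
    unfolding frobenius_character_def by (simp only: sum_product)
  also have "\<dots> = (\<Sum>(f, g)\<in>?F \<times> ?F. alternant N (subtract x (content n f)) * (if ?c g then 1 else 0))"
    by (rule sum.cartesian_product)
  also have "\<dots> = (\<Sum>h\<in>?H. if \<forall>i\<in>{1..N}. (\<Sum>j=1..N. content n h (j, i)) = m i
       then alternant N (subtract x (\<lambda>i. \<Sum>j=1..N. content n h (i, j))) else 0)"
  proof (rule sum.reindex_bij_witness[where i = "\<lambda>h. (?fst h, ?snd h)" and
        j = "\<lambda>p. \<lambda>y\<in>{1..n}. (fst p y, snd p y)"])
    fix p assume p: "p \<in> ?F \<times> ?F"
    have f: "fst p \<in> words n N" "snd p \<in> words n N" "fst p \<circ> \<sigma> = fst p" "snd p \<circ> \<sigma> = snd p" using p by auto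
    let ?h = "\<lambda>y\<in>{1..n}. (fst p y, snd p y)"
    have ff: "?fst ?h = fst p" "?snd ?h = snd p"
      using f(1,2) by (auto simp: fun_eq_iff words_def PiE_iff extensional_def)
    have ff': "(\<lambda>y\<in>{1..n}. fst (?h y)) = fst p" "(\<lambda>y\<in>{1..n}. snd (?h y)) = snd p"
      using f(1,2) by (auto simp: fun_eq_iff words_def PiE_iff extensional_def)
    from ff show "(?fst ?h, ?snd ?h) = p" by simp
    have h: "?h \<in> {1..n} \<rightarrow>\<^sub>E {1..N} \<times> {1..N}" using f(1,2) by (auto simp: words_def PiE_iff)
    moreover have "?h \<circ> \<sigma> = ?h"
    proof
      fix y show "(?h \<circ> \<sigma>) y = ?h y"
        using fun_cong[OF f(3), of y] fun_cong[OF f(4), of y] \<sigma>[of y]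
        by (cases "y \<in> {1..n}") auto
    qed
    ultimately show "?h \<in> ?H" by simp
    have c: "content n (fst p) i = (\<Sum>j=1..N. content n ?h (i, j))"
      "content n (snd p) i = (\<Sum>j=1..N. content n ?h (j, i))" for i
      using content_pair[OF h, of i] unfolding ff' by blast+
    show "(if \<forall>i\<in>{1..N}. (\<Sum>j=1..N. content n ?h (j, i)) = m i
       then alternant N (subtract x (\<lambda>i. \<Sum>j=1..N. content n ?h (i, j))) else 0) =
       (case p of (f, g) \<Rightarrow> alternant N (subtract x (content n f)) * (if ?c g then 1 else 0))"
      unfolding c[symmetric] case_prod_beta by simp
  next
    fix h assume h: "h \<in> ?H"
    then have e: "h \<in> {1..n} \<rightarrow>\<^sub>E {1..N} \<times> {1..N}" "h \<circ> \<sigma> = h" by auto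
    show "(\<lambda>y\<in>{1..n}. (fst (?fst h, ?snd h) y, snd (?fst h, ?snd h) y)) = h"
      using e(1) by (auto simp: fun_eq_iff PiE_iff extensional_def)
    have "?fst h \<in> words n N" "?snd h \<in> words n N" using e(1) by (auto simp: words_def PiE_iff extensional_def)
    moreover have "(?fst h \<circ> \<sigma>) y = ?fst h y" "(?snd h \<circ> \<sigma>) y = ?snd h y" for y
      using fun_cong[OF e(2), of y] \<sigma>[of y] by auto
    then have "?fst h \<circ> \<sigma> = ?fst h" "?snd h \<circ> \<sigma> = ?snd h" by blast+
    ultimately show "(?fst h, ?snd h) \<in> ?F \<times> ?F" by simp
  qed
  finally show ?thesis .
qed

text \<open>By the Burnside count the pairing is a sum over matrices with column sums
  \<open>m\<close>, and such matrices also index the expansion of \<open>h_m\<close> into monomials.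
  Pairing with the permutation character thus replaces power sums by complete symmetric
  functions.\<close>

lemma pairing_word_character:
  assumes "(\<Sum>i=1..N. m i) = n"
  shows "(\<Sum>\<sigma> | \<sigma> permutes {1..n}. frobenius_character n N x \<sigma> * word_character n N m \<sigma>) =
     fact n * fold (hop N) (map m [1..<Suc N]) (alternant N) x"
proof -
  let ?V = "{1..N} \<times> {1..N}"
  let ?mu = "map m [1..<Suc N]"
  let ?col = "\<lambda>c. \<forall>i\<in>{1..N}. (\<Sum>j=1..N. c (j, i)) = m i"
  let ?W = "\<lambda>c. alternant N (subtract x (\<lambda>i. \<Sum>j=1..N. c (i, j)))"
  let ?M = "{c. (\<forall>v. v \<notin> ?V \<longrightarrow> c v = 0) \<and> (\<Sum>v\<in>?V. c v) = n}"
  have len: "length ?mu = N" by simp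
  have pm: "part ?mu i = m i" if "i \<in> {1..N}" for i
    using that nth_upt[of 1 "i - 1" "Suc N"] by (auto simp: part_def simp del: upt_Suc)
  have M: "margin_matrices N ?mu = {c \<in> ?M. ?col c}"
  proof -
    have "(\<Sum>v\<in>?V. c v) = n" if "?col c" for c
    proof -
      have "(\<Sum>v\<in>?V. c v) = (\<Sum>j=1..N. \<Sum>i=1..N. c (j, i))" by (simp add: sum.cartesian_product)
      also have "\<dots> = (\<Sum>i=1..N. \<Sum>j=1..N. c (j, i))" by (rule sum.swap)
      also have "\<dots> = (\<Sum>i=1..N. m i)" by (rule sum.cong[OF refl]) (use that in blast)
      finally show ?thesis using assms by simp
    qed
    then show ?thesis
      unfolding margin_matrices_def len using pm by (auto simp del: One_nat_def)
  qed
  have fM: "finite ?M"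
  proof (rule finite_subset)
    show "?M \<subseteq> {c. \<forall>v. (v \<in> ?V \<longrightarrow> c v \<in> {0..n}) \<and> (v \<notin> ?V \<longrightarrow> c v = 0)}"
    proof (intro subsetI CollectI allI conjI impI)
      fix c v assume c: "c \<in> ?M"
      show "c v = 0" if "v \<notin> ?V" using c that by blast
      show "c v \<in> {0..n}" if "v \<in> ?V" using c that member_le_sum[of v ?V c] by simp
    qed
  qed (rule finite_set_of_finite_funs, auto)
  have "(\<Sum>\<sigma> | \<sigma> permutes {1..n}. frobenius_character n N x \<sigma> * word_character n N m \<sigma>) =
     (\<Sum>\<sigma> | \<sigma> permutes {1..n}. \<Sum>h | h \<in> {1..n} \<rightarrow>\<^sub>E ?V \<and> h \<circ> \<sigma> = h.
        if ?col (content n h) then ?W (content n h) else 0)"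
    by (rule sum.cong[OF refl]) (use frobenius_times_word_character in blast)
  also have "\<dots> = fact n * (\<Sum>c\<in>?M. if ?col c then ?W c else 0)"
    by (rule sum_fixed_words[of ?V "\<lambda>c. if ?col c then ?W c else 0"]) simp
  also have "(\<Sum>c\<in>?M. if ?col c then ?W c else 0) = (\<Sum>c\<in>{c \<in> ?M. ?col c}. ?W c)"
    by (rule sum.inter_filter[OF fM, symmetric])
  also have "\<dots> = fold (hop N) ?mu (alternant N) x"
    unfolding fold_hop_matrices len M ..
  finally show ?thesis .
qed

text \<open>At the least moved index \<open>k\<close> all smaller indices are fixed, so injectivity
  gives \<open>w k > k\<close>.\<close>

lemma permutes_first_moved:
  assumes "w permutes {1..N}" "w \<noteq> id"
  obtains k where "k \<in> {1..N}" "(\<Sum>i=1..k. int i) < (\<Sum>i=1..k. int (w i))"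
proof -
  let ?P = "\<lambda>k. w k \<noteq> k"
  obtain j where "?P j" using assms(2) by (auto simp: fun_eq_iff)
  define k where "k = (LEAST k. ?P k)"
  have k: "w k \<noteq> k" unfolding k_def by (rule LeastI[of ?P, OF \<open>?P j\<close>])
  have fix_lt: "w i = i" if "i < k" for i using not_less_Least[of i ?P] that unfolding k_def by blast
  have kN: "k \<in> {1..N}" using k permutes_not_in[OF assms(1)] by blast
  have "\<not> w k < k"
  proof
    assume "w k < k"
    then have "w (w k) = w k" by (rule fix_lt)
    then show False using k permutes_inj[OF assms(1)] by (auto dest: injD)
  qed
  then have "k < w k" using k by simp
  moreover have "(\<Sum>i=1..k. f i) = (\<Sum>i=1..<k. f i) + f k" for f :: "nat \<Rightarrow> int"
    using kN by (simp add: sum.last_plus add.commute atLeastLessThanSuc_atLeastAtMost[symmetric])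
  moreover have "(\<Sum>i=1..<k. int (w i)) = (\<Sum>i=1..<k. int i)"
    by (rule sum.cong) (auto simp: fix_lt)
  ultimately show thesis using that[OF kN] by simp
qed

text \<open>The exponent vector that pairs with the permutation \<open>w\<close> in the expansion of the
  Vandermonde determinant.\<close>

definition twist :: "point \<Rightarrow> (nat \<Rightarrow> nat) \<Rightarrow> nat \<Rightarrow> int" where
  "twist x w i = x i - int i + int (w i)"

definition twist_character :: "nat \<Rightarrow> nat \<Rightarrow> point \<Rightarrow> (nat \<Rightarrow> nat) \<Rightarrow> (nat \<Rightarrow> nat) \<Rightarrow> real" where
  "twist_character n N x w \<sigma> =
     real (card {f. f \<in> words n N \<and> f \<circ> \<sigma> = f \<and> (\<forall>i\<in>{1..N}. int (content n f i) = twist x w i)})"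

text \<open>Expanding the Vandermonde determinant over \<open>w\<close> gives the Jacobi-Trudi
  determinant at the level of permutation characters. If \<open>twist x w\<close> has a negative
  entry, no word has this content and the count is 0.\<close>

lemma frobenius_character_twist:
  assumes "x \<in> partition_points N"
  shows "frobenius_character n N x \<sigma> =
    (\<Sum>w | w permutes {1..N}. of_int (sign w) * twist_character n N x w \<sigma>)"
proof -
  let ?F = "{f. f \<in> words n N \<and> f \<circ> \<sigma> = f}"
  have fF: "finite ?F" using finite_words[of n N] by simp
  have e: "subtract x (content n f) = (\<lambda>i. int i - int (w i)) \<longleftrightarrow>
      (\<forall>i\<in>{1..N}. int (content n f i) = twist x w i)" if "f \<in> ?F" "w permutes {1..N}" for f w
  proof -
    have "x i = 0 \<and> content n f i = 0 \<and> w i = i" if "i \<notin> {1..N}" for i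
      using that \<open>f \<in> ?F\<close> word_content_0[of f n N i] permutes_not_in[OF \<open>w permutes {1..N}\<close> that]
        partition_pointsD(3)[OF assms that] by simp
    then have "subtract x (content n f) i = int i - int (w i)" if "i \<notin> {1..N}" for i
      using that by (simp add: subtract_def)
    then have "subtract x (content n f) = (\<lambda>i. int i - int (w i)) \<longleftrightarrow>
      (\<forall>i\<in>{1..N}. subtract x (content n f) i = int i - int (w i))" by (metis ext)
    moreover have "subtract x (content n f) i = int i - int (w i) \<longleftrightarrow> int (content n f i) = twist x w i" for i
      unfolding subtract_def twist_def by linarith
    ultimately show ?thesis by (simp only:)
  qed
  have "frobenius_character n N x \<sigma> = (\<Sum>f\<in>?F. \<Sum>w | w permutes {1..N}. of_int (sign w) *
     (if \<forall>i\<in>{1..N}. int (content n f i) = twist x w i then 1 else 0))"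
    unfolding frobenius_character_def alternant_def using e by (intro sum.cong) auto
  also have "\<dots> = (\<Sum>w | w permutes {1..N}. \<Sum>f\<in>?F. of_int (sign w) *
     (if \<forall>i\<in>{1..N}. int (content n f i) = twist x w i then 1 else 0))" by (rule sum.swap)
  also have "\<dots> = (\<Sum>w | w permutes {1..N}. of_int (sign w) * twist_character n N x w \<sigma>)"
    using fF by (simp add: sum_distrib_left[symmetric] sum.If_cases Int_def twist_character_def conj_assoc)
  finally show ?thesis .
qed

lemma sum_permuted:
  assumes "w permutes {1..N}"
  shows "(\<Sum>i=1..N. int (w i)) = (\<Sum>i=1..N. int i)"
  using sum.permute[OF assms, of int] by (simp add: comp_def)

text \<open>Up to \<open>n!\<close> the pairing is the number of semistandard tableaux of shape
  \<open>x\<close> and content \<open>twist x w\<close>. For \<open>w = id\<close> there is exactly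
  one; otherwise a partial sum of the content exceeds that of \<open>x\<close>, or an entry is
  negative.\<close>

lemma pairing_twist_character:
  assumes x: "x \<in> partition_points N" "weight N x = int n" and w: "w permutes {1..N}"
  shows "(\<Sum>\<sigma> | \<sigma> permutes {1..n}. frobenius_character n N x \<sigma> * twist_character n N x w \<sigma>) =
     (if w = id then fact n else 0)"
proof (cases "\<forall>i\<in>{1..N}. 0 \<le> twist x w i")
  case True
  define m where "m i = nat (twist x w i)" for i
  have m: "int (m i) = twist x w i" if "i \<in> {1..N}" for i using True that by (auto simp: m_def)
  have "int (\<Sum>i=1..N. m i) = (\<Sum>i=1..N. twist x w i)" by (simp add: m del: One_nat_def)
  also have "\<dots> = int n"
    using x(2) sum_permuted[OF w] by (simp add: twist_def weight_def sum.distrib sum_subtractf)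
  finally have sm: "(\<Sum>i=1..N. m i) = n" by (simp only: of_nat_eq_iff)
  have tw: "twist_character n N x w \<sigma> = word_character n N m \<sigma>" for \<sigma>
  proof -
    have "int (content n f i) = twist x w i \<longleftrightarrow> content n f i = m i" if "i \<in> {1..N}" for f i
      using m[OF that] by (metis of_nat_eq_iff)
    then have "{f. f \<in> words n N \<and> f \<circ> \<sigma> = f \<and> (\<forall>i\<in>{1..N}. int (content n f i) = twist x w i)} =
       {f. f \<in> words n N \<and> f \<circ> \<sigma> = f \<and> (\<forall>i\<in>{1..N}. content n f i = m i)}" by blast
    then show ?thesis by (simp only: twist_character_def word_character_def)
  qed
  let ?mu = "map m [1..<Suc N]"
  have pm: "int (part ?mu i) = twist x w i" if "i \<in> {1..N}" for i
  proof -
    have "part ?mu i = m i"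
      using that nth_upt[of 1 "i - 1" "Suc N"] by (auto simp: part_def simp del: upt_Suc)
    then show ?thesis using m[OF that] by simp
  qed
  have "card (ss_tableaux x ?mu) = (if w = id then 1 else 0)"
  proof (cases "w = id")
    case True
    then show ?thesis
      using ss_tableaux_superstandard[OF x(1), of ?mu] pm by (simp add: twist_def del: upt_Suc One_nat_def)
  next
    case False
    then obtain k where k: "k \<in> {1..N}" "(\<Sum>i=1..k. int i) < (\<Sum>i=1..k. int (w i))"
      using permutes_first_moved[OF w] by blast
    have "int (\<Sum>i=1..k. part ?mu i) = (\<Sum>i=1..k. twist x w i)"
      using k(1) pm by (simp del: upt_Suc One_nat_def)
    also have "\<dots> = (\<Sum>i=1..k. x i) - (\<Sum>i=1..k. int i) + (\<Sum>i=1..k. int (w i))"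
      by (simp add: twist_def sum.distrib sum_subtractf)
    finally have "ss_tableaux x ?mu = {}"
      using k by (intro ss_tableaux_dominance[OF x(1), of k]) auto
    then show ?thesis using False by simp
  qed
  then show ?thesis
    unfolding tw pairing_word_character[OF sm] fold_hop_alternant[OF x(1)] by simp
next
  case False
  then obtain i where i: "i \<in> {1..N}" "twist x w i < 0" by force
  then have "w \<noteq> id" using partition_pointsD(2)[OF x(1), of i] by (auto simp: twist_def)
  moreover have "twist_character n N x w \<sigma> = 0" for \<sigma>
  proof -
    have "int (content n f i) \<noteq> twist x w i" for f using i(2) by linarith
    then have "{f. f \<in> words n N \<and> f \<circ> \<sigma> = f \<and> (\<forall>i\<in>{1..N}. int (content n f i) = twist x w i)} = {}"
      using i(1) by blast
    then show ?thesis by (simp only: twist_character_def card.empty)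
  qed
  ultimately show ?thesis by simp
qed

text \<open>Serves twice, with \<open>g\<close> the Frobenius function itself and with
  \<open>g\<close> the character of the left ideal.\<close>

lemma pairing_frobenius:
  assumes "\<And>w. w permutes {1..N} \<Longrightarrow>
      (\<Sum>\<sigma> | \<sigma> permutes {1..n}. g \<sigma> * twist_character n N x w \<sigma>) = (if w = id then fact n else 0)"
    and "x \<in> partition_points N"
  shows "(\<Sum>\<sigma> | \<sigma> permutes {1..n}. g \<sigma> * frobenius_character n N x \<sigma>) = fact n"
proof -
  have "(\<Sum>\<sigma> | \<sigma> permutes {1..n}. g \<sigma> * frobenius_character n N x \<sigma>) =
    (\<Sum>\<sigma> | \<sigma> permutes {1..n}. \<Sum>w | w permutes {1..N}. of_int (sign w) * (g \<sigma> * twist_character n N x w \<sigma>))"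
    by (simp add: frobenius_character_twist[OF assms(2)] sum_distrib_left mult.left_commute)
  also have "\<dots> = (\<Sum>w | w permutes {1..N}. \<Sum>\<sigma> | \<sigma> permutes {1..n}. of_int (sign w) * (g \<sigma> * twist_character n N x w \<sigma>))"
    by (rule sum.swap)
  also have "\<dots> = (\<Sum>w | w permutes {1..N}. if w = id then fact n else 0)"
  proof (rule sum.cong[OF refl])
    fix w assume "w \<in> {w. w permutes {1..N}}"
    then have w: "w permutes {1..N}" by simp
    show "(\<Sum>\<sigma> | \<sigma> permutes {1..n}. of_int (sign w) * (g \<sigma> * twist_character n N x w \<sigma>)) =
        (if w = id then fact n else 0)"
      unfolding sum_distrib_left[symmetric] assms(1)[OF w] by simp
  qed
  also have "\<dots> = fact n"
    by (subst sum.delta) (auto simp: finite_permutations permutes_id)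
  finally show ?thesis .
qed

section \<open>The group algebra of the symmetric group\<close>

abbreviation sym_group :: "nat \<Rightarrow> (nat \<Rightarrow> nat) set" where
  "sym_group n \<equiv> {p. p permutes {1..n}}"

lemma finite_sym_group: "finite (sym_group n)"
  by (rule finite_permutations) simp

lemma card_sym_group: "card (sym_group n) = fact n"
  using card_permutations[of "{1..n}" n] by simp

lemma sym_group_comp: "p \<in> sym_group n \<Longrightarrow> q \<in> sym_group n \<Longrightarrow> p \<circ> q \<in> sym_group n"
  by (auto intro: permutes_compose)

lemma sym_group_inv: "p \<in> sym_group n \<Longrightarrow> inv p \<in> sym_group n"
  by (auto intro: permutes_inv)

lemma sym_group_id: "id \<in> sym_group n"
  by (auto intro: permutes_id)

lemma inv_comp_cancel:
  assumes "p \<in> sym_group n"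
  shows "inv p \<circ> (p \<circ> q) = q" "p \<circ> (inv p \<circ> q) = q" "(q \<circ> p) \<circ> inv p = q" "(q \<circ> inv p) \<circ> p = q"
    "inv (inv p) = p" "p \<circ> inv p = id" "inv p \<circ> p = id"
proof -
  have p: "p permutes {1..n}" using assms by simp
  show "inv p \<circ> (p \<circ> q) = q" "p \<circ> (inv p \<circ> q) = q"
    by (simp_all add: comp_assoc[symmetric] permutes_inv_o[OF p])
  show "(q \<circ> p) \<circ> inv p = q" "(q \<circ> inv p) \<circ> p = q"
    by (simp_all add: comp_assoc permutes_inv_o[OF p])
  show "inv (inv p) = p" by (rule inv_inv_eq[OF permutes_bij[OF p]])
  show "p \<circ> inv p = id" "inv p \<circ> p = id" by (simp_all add: permutes_inv_o[OF p])
qed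

lemma inv_comp:
  assumes "p \<in> sym_group n" "q \<in> sym_group n"
  shows "inv (p \<circ> q) = inv q \<circ> inv p"
  using assms permutes_bij by (intro o_inv_distrib) blast+

lemma sum_left_translate:
  assumes "p \<in> sym_group n"
  shows "(\<Sum>g\<in>sym_group n. f (p \<circ> g)) = (\<Sum>g\<in>sym_group n. f g)"
  by (rule sum.reindex_bij_witness[where i = "\<lambda>g. inv p \<circ> g" and j = "\<lambda>g. p \<circ> g"])
    (use assms sym_group_comp[of _ n] sym_group_inv[of _ n] in \<open>auto simp: inv_comp_cancel(1,2)[OF assms]\<close>)

lemma sum_right_translate:
  assumes "p \<in> sym_group n"
  shows "(\<Sum>g\<in>sym_group n. f (g \<circ> p)) = (\<Sum>g\<in>sym_group n. f g)"
  by (rule sum.reindex_bij_witness[where i = "\<lambda>g. g \<circ> inv p" and j = "\<lambda>g. g \<circ> p"])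
    (use assms sym_group_comp[of _ n] sym_group_inv[of _ n] in \<open>auto simp: inv_comp_cancel(3,4)[OF assms]\<close>)

lemma sum_inverse: "(\<Sum>g\<in>sym_group n. f (inv g)) = (\<Sum>g\<in>sym_group n. f g)"
  by (rule sum.reindex_bij_witness[where i = inv and j = inv])
    (use sym_group_inv[of _ n] in \<open>auto simp: inv_comp_cancel(5)[of _ n]\<close>)

lemma sum_conjugate:
  assumes "p \<in> sym_group n"
  shows "(\<Sum>g\<in>sym_group n. f (inv p \<circ> g \<circ> p)) = (\<Sum>g\<in>sym_group n. f g)"
  using sum_left_translate[OF sym_group_inv[OF assms], of "\<lambda>g. f (g \<circ> p)"] sum_right_translate[OF assms, of f]
  by simp

lemma group_algD: "f \<in> group_alg n \<Longrightarrow> p \<notin> sym_group n \<Longrightarrow> f p = 0"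
  by (simp add: group_alg_def)

lemma conv_in_group_alg:
  assumes "g \<in> group_alg n"
  shows "conv n f g \<in> group_alg n"
  unfolding group_alg_def
proof (intro CollectI allI impI)
  fix p assume p: "\<not> p permutes {1..n}"
  have "g (inv q \<circ> p) = 0" if q: "q \<in> sym_group n" for q
  proof (rule group_algD[OF assms])
    show "inv q \<circ> p \<notin> sym_group n"
      using sym_group_comp[OF q, of "inv q \<circ> p"] inv_comp_cancel(2)[OF q, of p] p by auto
  qed
  then show "conv n f g p = 0" by (simp add: conv_def)
qed

lemma conv_assoc: "conv n (conv n f g) h = conv n f (conv n g h)"
proof
  fix p
  have "conv n (conv n f g) h p = (\<Sum>r\<in>sym_group n. \<Sum>q\<in>sym_group n. f q * g (inv q \<circ> r) * h (inv r \<circ> p))"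
    by (simp add: conv_def sum_distrib_right)
  also have "\<dots> = (\<Sum>q\<in>sym_group n. \<Sum>r\<in>sym_group n. f q * g (inv q \<circ> r) * h (inv r \<circ> p))"
    by (rule sum.swap)
  also have "\<dots> = (\<Sum>q\<in>sym_group n. \<Sum>s\<in>sym_group n. f q * g s * h (inv s \<circ> (inv q \<circ> p)))"
  proof (rule sum.cong[OF refl])
    fix q assume q: "q \<in> sym_group n"
    have "(\<Sum>r\<in>sym_group n. f q * g (inv q \<circ> r) * h (inv r \<circ> p)) =
        (\<Sum>s\<in>sym_group n. f q * g (inv q \<circ> (q \<circ> s)) * h (inv (q \<circ> s) \<circ> p))"
      by (rule sum_left_translate[OF q, symmetric])
    also have "\<dots> = (\<Sum>s\<in>sym_group n. f q * g s * h (inv s \<circ> (inv q \<circ> p)))"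
      by (rule sum.cong[OF refl]) (simp add: inv_comp_cancel(1)[OF q] inv_comp[OF q] comp_assoc)
    finally show "(\<Sum>r\<in>sym_group n. f q * g (inv q \<circ> r) * h (inv r \<circ> p)) =
        (\<Sum>s\<in>sym_group n. f q * g s * h (inv s \<circ> (inv q \<circ> p)))" .
  qed
  also have "\<dots> = conv n f (conv n g h) p"
    by (simp add: conv_def sum_distrib_left mult.assoc)
  finally show "conv n (conv n f g) h p = conv n f (conv n g h) p" .
qed

lemma conv_id: "conv n f g id = (\<Sum>q\<in>sym_group n. f q * g (inv q))"
  by (simp add: conv_def)

text \<open>Evaluation at \<open>id\<close> is a trace form on the group algebra, which allows
  factors of a product to be rotated cyclically.\<close>

lemma conv_id_commute: "conv n f g id = conv n g f id"
proof -
  have "conv n f g id = (\<Sum>q\<in>sym_group n. f (inv q) * g (inv (inv q)))"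
    unfolding conv_id by (rule sum_inverse[symmetric])
  also have "\<dots> = conv n g f id"
    unfolding conv_id by (rule sum.cong) (auto simp: inv_comp_cancel(5)[of _ n])
  finally show ?thesis .
qed

lemma conv_group_elem_left:
  assumes "p \<in> sym_group n"
  shows "conv n (group_elem p) f x = f (inv p \<circ> x)"
proof -
  have "conv n (group_elem p) f x = (\<Sum>q\<in>sym_group n. if q = p then f (inv q \<circ> x) else 0)"
    unfolding conv_def group_elem_def by (intro sum.cong) auto
  then show ?thesis using assms by (simp add: finite_sym_group del: One_nat_def)
qed

lemma conv_group_elem_right:
  assumes "p \<in> sym_group n" "f \<in> group_alg n"
  shows "conv n f (group_elem p) x = f (x \<circ> inv p)"
proof -
  have "inv q \<circ> x = p \<longleftrightarrow> q = x \<circ> inv p" if q: "q \<in> sym_group n" for q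
    using inv_comp_cancel(2)[OF q, of x] inv_comp_cancel(1)[OF q, of p]
      inv_comp_cancel(3)[OF assms(1), of q] inv_comp_cancel(4)[OF assms(1), of x] by metis
  then have "conv n f (group_elem p) x = (\<Sum>q\<in>sym_group n. if q = x \<circ> inv p then f q else 0)"
    unfolding conv_def group_elem_def by (intro sum.cong) auto
  then show ?thesis using group_algD[OF assms(2)] by (auto simp: finite_sym_group simp del: One_nat_def)
qed

lemma group_elem_in_group_alg: "p \<in> sym_group n \<Longrightarrow> group_elem p \<in> group_alg n"
  by (auto simp: group_elem_def group_alg_def)

lemma conv_scale_left: "conv n (\<lambda>x. c * f x) g = (\<lambda>x. c * conv n f g x)"
  by (simp add: conv_def sum_distrib_left mult.assoc)

lemma conv_scale_right: "conv n f (\<lambda>x. c * g x) = (\<lambda>x. c * conv n f g x)"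
  by (simp add: conv_def sum_distrib_left mult.left_commute)

lemma conv_add_left: "conv n (\<lambda>x. f x + g x) h = (\<lambda>x. conv n f h x + conv n g h x)"
  by (simp add: conv_def sum.distrib distrib_right)

lemma sum_apply: "(\<Sum>a\<in>A. f a) x = (\<Sum>a\<in>A. f a x)"
  by (induction A rule: infinite_finite_induct) auto

lemma group_alg_expand:
  assumes "f \<in> group_alg n"
  shows "f = (\<Sum>g\<in>sym_group n. (\<lambda>x. f g * group_elem g x))"
proof
  fix p
  have "(\<Sum>g\<in>sym_group n. f g * group_elem g p) = (\<Sum>g\<in>sym_group n. if g = p then f g else 0)"
    by (intro sum.cong) (auto simp: group_elem_def)
  also have "\<dots> = f p" using group_algD[OF assms] by (auto simp: finite_sym_group simp del: One_nat_def)
  finally show "f p = (\<Sum>g\<in>sym_group n. (\<lambda>x. f g * group_elem g x)) p" by (simp add: sum_apply)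
qed

text \<open>The adjoint for the form in which group elements are orthonormal, taken without complex
  conjugation because it is applied to real coefficients.\<close>

definition involution :: "((nat \<Rightarrow> nat) \<Rightarrow> complex) \<Rightarrow> (nat \<Rightarrow> nat) \<Rightarrow> complex" where
  "involution f g = f (inv g)"

lemma involution_conv:
  assumes "x \<in> sym_group n"
  shows "involution (conv n f g) x = conv n (involution g) (involution f) x"
proof -
  have "involution (conv n f g) x = (\<Sum>q\<in>sym_group n. f q * g (inv q \<circ> inv x))"
    by (simp add: involution_def conv_def)
  also have "\<dots> = (\<Sum>q\<in>sym_group n. f (inv x \<circ> q) * g (inv (inv x \<circ> q) \<circ> inv x))"
    by (rule sum_left_translate[OF sym_group_inv[OF assms], symmetric])
  also have "\<dots> = (\<Sum>q\<in>sym_group n. g (inv q) * f (inv (inv q \<circ> x)))"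
  proof (rule sum.cong[OF refl])
    fix q assume q: "q \<in> sym_group n"
    have "inv (inv x \<circ> q) \<circ> inv x = inv q"
      by (simp only: inv_comp[OF sym_group_inv[OF assms] q] inv_comp_cancel[OF assms] comp_assoc comp_id)
    moreover have "inv (inv q \<circ> x) = inv x \<circ> q"
      by (simp only: inv_comp[OF sym_group_inv[OF q] assms] inv_comp_cancel(5)[OF q])
    ultimately show "f (inv x \<circ> q) * g (inv (inv x \<circ> q) \<circ> inv x) = g (inv q) * f (inv (inv q \<circ> x))"
      by (simp add: mult.commute)
  qed
  finally show ?thesis by (simp add: involution_def conv_def)
qed

text \<open>On the left ideal generated by a quasi-idempotent \<open>c\<close>, right multiplication by \<open>c / h\<close> is the
  identity; so the trace of a left multiplication on the ideal is the trace of the two-sided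
  multiplication on the whole group algebra, where the group elements form a basis.\<close>

lemma trace_on_left_ideal:
  assumes c: "c \<in> group_alg n" and cc: "conv n c c = (\<lambda>x. h * c x)" and h: "h \<noteq> 0"
    and \<sigma>: "\<sigma> \<in> sym_group n"
  shows "trace_on ((\<lambda>x. conv n x c) ` group_alg n) (conv n (group_elem \<sigma>)) =
    (\<Sum>g\<in>sym_group n. c (inv g \<circ> inv \<sigma> \<circ> g)) / h"
proof -
  let ?V = "(\<lambda>x. conv n x c) ` group_alg n"
  define B where "B = (SOME B. B \<subseteq> ?V \<and> cfun.independent B \<and> cfun.span B = ?V)"
  have add: "(\<lambda>x. f x + g x) \<in> group_alg n" if "f \<in> group_alg n" "g \<in> group_alg n" for f g
    using that by (simp add: group_alg_def)
  have scale: "(\<lambda>x. a * f x) \<in> group_alg n" if "f \<in> group_alg n" for f and a :: complex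
    using that by (simp add: group_alg_def)
  have "cfun.subspace ?V"
    unfolding cfun.subspace_def
  proof (intro conjI ballI allI)
    have "conv n (\<lambda>x. 0) c = 0" by (simp add: conv_def fun_eq_iff)
    moreover have "(\<lambda>x. 0) \<in> group_alg n" by (simp add: group_alg_def)
    ultimately show "0 \<in> ?V" by (metis image_eqI)
  next
    fix u v assume "u \<in> ?V" "v \<in> ?V"
    then obtain f g where fg: "f \<in> group_alg n" "g \<in> group_alg n" "u = conv n f c" "v = conv n g c" by blast
    have "u + v = conv n (\<lambda>x. f x + g x) c" by (simp add: fg conv_add_left plus_fun_def)
    then show "u + v \<in> ?V" using add[OF fg(1,2)] by blast
  next
    fix a :: complex and u assume "u \<in> ?V"
    then obtain f where f: "f \<in> group_alg n" "u = conv n f c" by blast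
    have "(\<lambda>x. a * u x) = conv n (\<lambda>x. a * f x) c" by (simp add: f conv_scale_left)
    then show "(\<lambda>x. a * u x) \<in> ?V" using scale[OF f(1)] by blast
  qed
  then have sp: "cfun.span ?V = ?V" by (simp add: cfun.span_eq_iff)
  \<comment> \<open>A basis contained in the ideal exists, so the \<open>SOME\<close> in
    \<open>trace_on\<close> really denotes one.\<close>
  obtain B0 where "B0 \<subseteq> ?V" "cfun.independent B0" "?V \<subseteq> cfun.span B0"
    using cfun.maximal_independent_subset by blast
  moreover from this have "cfun.span B0 = ?V" using cfun.span_mono[of B0 ?V] sp by blast
  ultimately have "\<exists>B. B \<subseteq> ?V \<and> cfun.independent B \<and> cfun.span B = ?V" by blast
  from someI_ex[OF this] have B: "B \<subseteq> ?V" "cfun.independent B" "cfun.span B = ?V" by (simp_all add: B_def)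
  have VA: "?V \<subseteq> group_alg n" using conv_in_group_alg[OF c] by blast
  have "group_alg n \<subseteq> cfun.span (group_elem ` sym_group n)"
  proof
    fix f assume "f \<in> group_alg n"
    then have "f = (\<Sum>g\<in>sym_group n. (\<lambda>x. f g * group_elem g x))" by (rule group_alg_expand)
    moreover have "(\<Sum>g\<in>sym_group n. (\<lambda>x. f g * group_elem g x)) \<in> cfun.span (group_elem ` sym_group n)"
      by (intro cfun.span_sum cfun.span_scale cfun.span_base) blast
    ultimately show "f \<in> cfun.span (group_elem ` sym_group n)" by (simp only:)
  qed
  then have "finite B"
    using cfun.independent_span_bound[of "group_elem ` sym_group n" B] B VA finite_sym_group by blast
  \<comment> \<open>The left multiplication combined with right multiplication by
    \<open>c / h\<close>: it maps the whole group algebra into the ideal and agrees with the left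
    multiplication on the ideal.\<close>
  define M where "M f = (\<lambda>x. conv n (group_elem \<sigma>) (conv n f c) x / h)" for f
  have M: "M f \<in> cfun.span B" if "f \<in> group_alg n" for f
  proof -
    have "M f = conv n (\<lambda>x. (1 / h) * conv n (group_elem \<sigma>) f x) c"
      unfolding conv_scale_left by (simp add: M_def conv_assoc)
    moreover have "(\<lambda>x. (1 / h) * conv n (group_elem \<sigma>) f x) \<in> group_alg n"
      by (rule scale[OF conv_in_group_alg[OF that]])
    ultimately show ?thesis unfolding B(3) by blast
  qed
  have Mb: "conv n (group_elem \<sigma>) b = (\<Sum>g\<in>sym_group n. (\<lambda>x. b g * M (group_elem g) x))" if b: "b \<in> B" for b
  proof -
    obtain f where f: "b = conv n f c" using b B(1) by blast
    have "conv n b c = (\<lambda>x. h * b x)" unfolding f conv_assoc cc conv_scale_right ..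
    then have 1: "conv n (group_elem \<sigma>) b = M b"
      using h by (simp add: M_def conv_scale_right)
    have bA: "b \<in> group_alg n" using b B(1) VA by blast
    have "M b x = (\<Sum>g\<in>sym_group n. b g * M (group_elem g) x)" for x
    proof -
      have "conv n b c y = (\<Sum>g\<in>sym_group n. b g * conv n (group_elem g) c y)" for y
        by (simp add: conv_def[of n b] conv_group_elem_left del: One_nat_def)
      then have "conv n b c = (\<lambda>y. \<Sum>g\<in>sym_group n. b g * conv n (group_elem g) c y)" ..
      then show ?thesis
        by (simp add: M_def conv_group_elem_left[OF \<sigma>] sum_divide_distrib)
    qed
    then have "M b = (\<Sum>g\<in>sym_group n. (\<lambda>x. b g * M (group_elem g) x))" by (auto simp: fun_eq_iff sum_apply)
    with 1 show ?thesis by simp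
  qed
  have "trace_on ?V (conv n (group_elem \<sigma>)) =
      (\<Sum>b\<in>B. cfun.representation B (conv n (group_elem \<sigma>) b) b)"
    by (simp add: trace_on_def B_def[symmetric])
  also have "\<dots> = (\<Sum>b\<in>B. \<Sum>g\<in>sym_group n. b g * cfun.representation B (M (group_elem g)) b)"
  proof (rule sum.cong[OF refl])
    fix b assume b: "b \<in> B"
    have "cfun.representation B (conv n (group_elem \<sigma>) b) =
      (\<lambda>v. \<Sum>g\<in>sym_group n. cfun.representation B (\<lambda>x. b g * M (group_elem g) x) v)"
      unfolding Mb[OF b]
      by (rule cfun.representation_sum[OF B(2)]) (intro cfun.span_scale M group_elem_in_group_alg)
    then show "cfun.representation B (conv n (group_elem \<sigma>) b) b =
       (\<Sum>g\<in>sym_group n. b g * cfun.representation B (M (group_elem g)) b)"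
      by (simp add: cfun.representation_scale[OF B(2) M[OF group_elem_in_group_alg]])
  qed
  also have "\<dots> = (\<Sum>g\<in>sym_group n. \<Sum>b\<in>B. b g * cfun.representation B (M (group_elem g)) b)"
    by (rule sum.swap)
  \<comment> \<open>For fixed \<open>g\<close> the sum over \<open>B\<close> recombines the basis
    expansion of \<open>M (group_elem g)\<close> at the point \<open>g\<close>, which turns the
    trace into one over group elements.\<close>
  also have "\<dots> = (\<Sum>g\<in>sym_group n. M (group_elem g) g)"
  proof (rule sum.cong[OF refl])
    fix g assume g: "g \<in> sym_group n"
    have "(\<Sum>b\<in>B. (\<lambda>x. cfun.representation B (M (group_elem g)) b * b x)) = M (group_elem g)"
      by (rule cfun.sum_representation_eq[OF B(2) M[OF group_elem_in_group_alg[OF g]] \<open>finite B\<close> order_refl])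
    from fun_cong[OF this, of g]
    show "(\<Sum>b\<in>B. b g * cfun.representation B (M (group_elem g)) b) = M (group_elem g) g"
      by (simp add: sum_apply mult.commute)
  qed
  also have "\<dots> = (\<Sum>g\<in>sym_group n. c (inv g \<circ> inv \<sigma> \<circ> g) / h)"
    by (rule sum.cong[OF refl]) (simp add: M_def conv_group_elem_left[OF \<sigma>] conv_group_elem_left comp_assoc)
  finally show ?thesis by (simp add: sum_divide_distrib)
qed

section \<open>Row and column groups of a tableau\<close>

declare One_nat_def [simp del]

lemma card_le_eq_sum_content:
  fixes f :: "nat \<Rightarrow> nat"
  assumes "\<And>y. y \<in> {1..n} \<Longrightarrow> 1 \<le> f y"
  shows "card {y \<in> {1..n}. f y \<le> k} = (\<Sum>i=1..k. content n f i)"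
proof -
  have "card {y \<in> {1..n}. f y \<le> k} = (\<Sum>y\<in>{y \<in> {1..n}. f y \<le> k}. 1)" by simp
  also have "\<dots> = (\<Sum>i=1..k. \<Sum>y\<in>{y \<in> {y \<in> {1..n}. f y \<le> k}. f y = i}. 1)"
    by (rule sum.group[symmetric]) (use assms in auto)
  also have "\<dots> = (\<Sum>i=1..k. content n f i)"
    by (intro sum.cong refl) (auto simp: content_def intro: arg_cong[where f = card])
  finally show ?thesis .
qed

text \<open>\<open>T\<close> is any bijective filling, used only to assign a row and a column to
  each number; the canonical tableau is substituted at the end.\<close>

locale young_tableau =
  fixes N n :: nat and x :: point and T :: "nat \<times> nat \<Rightarrow> nat"
  assumes x: "x \<in> partition_points N" and T: "bij_betw T (cells x) {1..n}"
begin

definition row :: "nat \<Rightarrow> nat" where "row y = fst (inv_into (cells x) T y)"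

definition column :: "nat \<Rightarrow> nat" where "column y = snd (inv_into (cells x) T y)"

definition R :: "(nat \<Rightarrow> nat) set" where
  "R = {p \<in> sym_group n. \<forall>y\<in>{1..n}. row (p y) = row y}"

definition C :: "(nat \<Rightarrow> nat) set" where
  "C = {q \<in> sym_group n. \<forall>y\<in>{1..n}. column (q y) = column y}"

lemma cell:
  assumes "y \<in> {1..n}"
  shows "(row y, column y) \<in> cells x" "T (row y, column y) = y"
  using assms T f_inv_into_f[of y T "cells x"] inv_into_into[of y T "cells x"]
  by (auto simp: row_def column_def bij_betw_def)

lemma row_column_T:
  assumes "(i, j) \<in> cells x"
  shows "row (T (i, j)) = i" "column (T (i, j)) = j" "T (i, j) \<in> {1..n}"
  using T assms inv_into_f_f[of T "cells x" "(i, j)"] bij_betwE[OF T]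
  by (auto simp: row_def column_def bij_betw_def)

lemma cell_eqI: "y \<in> {1..n} \<Longrightarrow> z \<in> {1..n} \<Longrightarrow> row y = row z \<Longrightarrow> column y = column z \<Longrightarrow> y = z"
  by (metis cell(2))

lemma row_pos: "y \<in> {1..n} \<Longrightarrow> 1 \<le> row y"
  using cell(1)[of y] by (auto simp: cells_def)

lemma mem_permute: "p \<in> sym_group n \<Longrightarrow> p y \<in> {1..n} \<longleftrightarrow> y \<in> {1..n}"
  using permutes_in_image by fastforce

lemma R_sub: "R \<subseteq> sym_group n" and C_sub: "C \<subseteq> sym_group n"
  by (auto simp: R_def C_def)

lemma R_id: "id \<in> R" and C_id: "id \<in> C"
  using sym_group_id by (auto simp: R_def C_def)

lemma R_comp: "p \<in> R \<Longrightarrow> q \<in> R \<Longrightarrow> p \<circ> q \<in> R"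
  using sym_group_comp[of p n q] mem_permute[of q] by (auto simp: R_def)

lemma C_comp: "p \<in> C \<Longrightarrow> q \<in> C \<Longrightarrow> p \<circ> q \<in> C"
  using sym_group_comp[of p n q] mem_permute[of q] by (auto simp: C_def)

lemma inverse_fix:
  assumes "p \<in> sym_group n" "\<forall>y\<in>{1..n}. f (p y) = f y" "y \<in> {1..n}"
  shows "f (inv p y) = f y"
proof -
  have "inv p y \<in> {1..n}" using mem_permute[OF sym_group_inv[OF assms(1)]] assms(3) by blast
  then have "f (p (inv p y)) = f (inv p y)" using assms(2) by blast
  moreover have "p (inv p y) = y" using fun_cong[OF inv_comp_cancel(6)[OF assms(1)], of y] by simp
  ultimately show ?thesis by simp
qed

lemma R_inv: "p \<in> R \<Longrightarrow> inv p \<in> R" and C_inv: "p \<in> C \<Longrightarrow> inv p \<in> C"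
  using inverse_fix[of p row] inverse_fix[of p column] sym_group_inv[of p n] by (auto simp: R_def C_def)

lemma R_C: "p \<in> R \<Longrightarrow> p \<in> C \<Longrightarrow> p = id"
proof
  fix y assume p: "p \<in> R" "p \<in> C"
  then have "p permutes {1..n}" by (simp add: R_def)
  then show "p y = id y"
    using p cell_eqI[of "p y" y] mem_permute[of p y] permutes_not_in[of p "{1..n}" y]
    by (cases "y \<in> {1..n}") (auto simp: R_def C_def)
qed

section \<open>Column heights and fillings without repetition in a column\<close>

definition height :: "nat \<Rightarrow> nat" where "height j = card {i. (i, j) \<in> cells x}"

lemma column_cells: "{i. (i, j) \<in> cells x} = {1..height j}"
  unfolding height_def
proof (rule initial_segment)
  show "finite {i. (i, j) \<in> cells x}"
    by (rule finite_subset[of _ "fst ` cells x"]) (force, simp add: finite_cells[OF x])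
qed (use cells_col_closed[OF x] in \<open>auto simp: cells_def\<close>)

lemma card_column_le: "card {y \<in> {1..n}. column y = j \<and> row y \<le> m} = min (height j) m"
proof -
  have c: "(i, j) \<in> cells x \<longleftrightarrow> i \<in> {1..height j}" for i using column_cells[of j] by blast
  have "bij_betw row {y \<in> {1..n}. column y = j \<and> row y \<le> m} {1..min (height j) m}"
  proof (rule bij_betwI[where g = "\<lambda>i. T (i, j)"])
    show "row \<in> {y \<in> {1..n}. column y = j \<and> row y \<le> m} \<rightarrow> {1..min (height j) m}"
      using cell(1) c by force
    show "(\<lambda>i. T (i, j)) \<in> {1..min (height j) m} \<rightarrow> {y \<in> {1..n}. column y = j \<and> row y \<le> m}"
      using row_column_T[of _ j] c by auto
    show "T (row y, j) = y" if "y \<in> {y \<in> {1..n}. column y = j \<and> row y \<le> m}" for y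
      using cell(2)[of y] that by auto
    show "row (T (i, j)) = i" if "i \<in> {1..min (height j) m}" for i
      using row_column_T(1)[of i j] c that by auto
  qed
  then show ?thesis using bij_betw_same_card by fastforce
qed

lemma row_le_height:
  assumes "y \<in> {1..n}"
  shows "row y \<le> height (column y)"
  using cell(1)[OF assms] column_cells[of "column y"] by auto

lemma card_column: "card {y \<in> {1..n}. column y = j} = height j"
proof -
  have "{y \<in> {1..n}. column y = j} = {y \<in> {1..n}. column y = j \<and> row y \<le> height j}"
    using row_le_height by auto
  then show ?thesis using card_column_le[of j "height j"] by simp
qed

lemma card_by_columns:
  "card {y \<in> {1..n}. P y} = (\<Sum>j\<in>column ` {1..n}. card {y \<in> {1..n}. column y = j \<and> P y})"
proof -
  have "card {y \<in> {1..n}. P y} = (\<Sum>y\<in>{y \<in> {1..n}. P y}. 1)" by simp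
  also have "\<dots> = (\<Sum>j\<in>column ` {1..n}. \<Sum>y\<in>{y \<in> {y \<in> {1..n}. P y}. column y = j}. 1)"
    by (rule sum.group[symmetric]) auto
  also have "\<dots> = (\<Sum>j\<in>column ` {1..n}. card {y \<in> {1..n}. column y = j \<and> P y})"
    by (intro sum.cong refl) (auto intro: arg_cong[where f = card])
  finally show ?thesis .
qed

text \<open>With \<open>f\<close> viewed as a filling of the shape by way of \<open>T\<close>, this
  is column strictness up to rearrangement within the columns.\<close>

definition column_injective :: "(nat \<Rightarrow> nat) \<Rightarrow> bool" where
  "column_injective f \<longleftrightarrow> (\<forall>y\<in>{1..n}. \<forall>z\<in>{1..n}. f y = f z \<longrightarrow> column y = column z \<longrightarrow> y = z)"

text \<open>At most \<open>min (height j) m\<close> distinct positive values up to \<open>m\<close>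
  fit into column \<open>j\<close>, and the row numbers attain this bound.\<close>

lemma column_injective_le:
  assumes "column_injective f" "\<And>y. y \<in> {1..n} \<Longrightarrow> 1 \<le> f y"
  shows "card {y \<in> {1..n}. column y = j \<and> f y \<le> m} \<le> card {y \<in> {1..n}. column y = j \<and> row y \<le> m}"
proof -
  have "card {y \<in> {1..n}. column y = j \<and> f y \<le> m} \<le> card {1..m}"
  proof (rule card_inj_on_le[of f])
    show "inj_on f {y \<in> {1..n}. column y = j \<and> f y \<le> m}"
      using assms(1) unfolding inj_on_def column_injective_def by blast
  qed (use assms(2) in auto)
  moreover have "card {y \<in> {1..n}. column y = j \<and> f y \<le> m} \<le> card {y \<in> {1..n}. column y = j}"
    by (rule card_mono) auto
  ultimately show ?thesis unfolding card_column_le card_column by simp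
qed

lemma column_injective_dominance:
  assumes "column_injective f" "\<And>y. y \<in> {1..n} \<Longrightarrow> 1 \<le> f y"
  shows "card {y \<in> {1..n}. f y \<le> m} \<le> card {y \<in> {1..n}. row y \<le> m}"
  unfolding card_by_columns[of "\<lambda>y. f y \<le> m"] card_by_columns[of "\<lambda>y. row y \<le> m"]
  by (intro sum_mono column_injective_le assms)

text \<open>Equal totals force equality in every column; with \<open>m\<close> the height of the
  column of \<open>y\<close>, no value in that column exceeds the height.\<close>

lemma column_injective_cells:
  assumes f: "column_injective f" "\<And>y. y \<in> {1..n} \<Longrightarrow> 1 \<le> f y"
    and eq: "\<And>m. card {y \<in> {1..n}. f y \<le> m} = card {y \<in> {1..n}. row y \<le> m}" and y: "y \<in> {1..n}"
  shows "(f y, column y) \<in> cells x"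
proof -
  let ?j = "column y" and ?m = "height (column y)"
  have "card {y \<in> {1..n}. column y = ?j \<and> f y \<le> ?m} = card {y \<in> {1..n}. column y = ?j \<and> row y \<le> ?m}"
  proof (rule sum_mono_inv[of "\<lambda>j. card {y \<in> {1..n}. column y = j \<and> f y \<le> ?m}" "column ` {1..n}"
        "\<lambda>j. card {y \<in> {1..n}. column y = j \<and> row y \<le> ?m}"])
    show "(\<Sum>j\<in>column ` {1..n}. card {y \<in> {1..n}. column y = j \<and> f y \<le> ?m}) =
       (\<Sum>j\<in>column ` {1..n}. card {y \<in> {1..n}. column y = j \<and> row y \<le> ?m})"
      using eq[of ?m] unfolding card_by_columns[of "\<lambda>y. f y \<le> ?m"] card_by_columns[of "\<lambda>y. row y \<le> ?m"] .
  qed (use y column_injective_le[OF f] in auto)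
  also have "\<dots> = card {y \<in> {1..n}. column y = ?j}" unfolding card_column_le card_column by simp
  finally have "{y \<in> {1..n}. column y = ?j \<and> f y \<le> ?m} = {y \<in> {1..n}. column y = ?j}"
    by (intro card_subset_eq) auto
  then have "f y \<le> ?m" using y by blast
  then show ?thesis using f(2)[OF y] column_cells[of ?j] by auto
qed

lemma not_column_injective_transposition:
  assumes "\<not> column_injective f"
  obtains u v where "u \<in> {1..n}" "v \<in> {1..n}" "u \<noteq> v" "f u = f v" "transpose u v \<in> C"
proof -
  obtain u v where uv: "u \<in> {1..n}" "v \<in> {1..n}" "u \<noteq> v" "f u = f v" "column u = column v"
    using assms by (auto simp: column_injective_def)
  then have "transpose u v \<in> C"
    using permutes_swap_id[of u "{1..n}" v] by (auto simp: C_def transpose_def)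
  with uv show thesis by (intro that) auto
qed

text \<open>\<open>q\<close> moves each \<open>y\<close> within its column to the row of
  \<open>g y\<close>; what remains of \<open>g\<close> then preserves rows.\<close>

lemma column_injective_factor:
  assumes g: "g \<in> sym_group n" and inj: "column_injective (row \<circ> g)"
  obtains p q where "p \<in> R" "q \<in> C" "g = p \<circ> q"
proof -
  have c: "((row \<circ> g) y, column y) \<in> cells x" if "y \<in> {1..n}" for y
  proof (rule column_injective_cells[OF inj _ _ that])
    show "1 \<le> (row \<circ> g) y" if "y \<in> {1..n}" for y
      using row_pos[of "g y"] mem_permute[OF g] that by simp
    fix m
    have "bij_betw g {y \<in> {1..n}. (row \<circ> g) y \<le> m} {y \<in> {1..n}. row y \<le> m}"
      by (rule bij_betwI[where g = "inv g"])
        (use mem_permute[OF g] mem_permute[OF sym_group_inv[OF g]] inv_comp_cancel(6,7)[OF g]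
          in \<open>auto simp: fun_eq_iff\<close>)
    then show "card {y \<in> {1..n}. (row \<circ> g) y \<le> m} = card {y \<in> {1..n}. row y \<le> m}"
      by (rule bij_betw_same_card)
  qed
  define q where "q y = (if y \<in> {1..n} then T (row (g y), column y) else y)" for y
  have q: "q y \<in> {1..n}" "row (q y) = row (g y)" "column (q y) = column y" if "y \<in> {1..n}" for y
    using row_column_T[of "row (g y)" "column y"] c[OF that] that by (auto simp: q_def)
  have "inj_on q {1..n}"
  proof (rule inj_onI)
    fix y z assume yz: "y \<in> {1..n}" "z \<in> {1..n}" "q y = q z"
    then have "(row \<circ> g) y = (row \<circ> g) z" "column y = column z" using q[of y] q[of z] by auto
    then show "y = z" using inj yz(1,2) unfolding column_injective_def by blast
  qed
  moreover from this have "q ` {1..n} = {1..n}" using q(1) by (intro endo_inj_surj) auto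
  ultimately have "bij_betw q {1..n} {1..n}" by (simp add: bij_betw_def)
  then have "q permutes {1..n}" by (rule bij_imp_permutes) (auto simp: q_def)
  then have qC: "q \<in> C" using q by (simp add: C_def)
  then have qG: "q \<in> sym_group n" using C_sub by blast
  have "g \<circ> inv q \<in> R"
    unfolding R_def
  proof (rule CollectI, intro conjI ballI)
    show "g \<circ> inv q \<in> sym_group n" by (rule sym_group_comp[OF g sym_group_inv[OF qG]])
    fix y assume y: "y \<in> {1..n}"
    have "inv q y \<in> {1..n}" using mem_permute[OF sym_group_inv[OF qG]] y by blast
    then have "row (q (inv q y)) = row (g (inv q y))" by (rule q(2))
    then show "row ((g \<circ> inv q) y) = row y" using fun_cong[OF inv_comp_cancel(6)[OF qG], of y] by simp
  qed
  moreover have "g = (g \<circ> inv q) \<circ> q" by (rule inv_comp_cancel(4)[OF qG, symmetric])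
  ultimately show thesis using qC that by blast
qed

lemma content_row: "content n row i = nat (x i)"
proof -
  have "bij_betw column {y \<in> {1..n}. row y = i} {j. (i, j) \<in> cells x}"
  proof (rule bij_betwI[where g = "\<lambda>j. T (i, j)"])
    show "column \<in> {y \<in> {1..n}. row y = i} \<rightarrow> {j. (i, j) \<in> cells x}" using cell(1) by auto
    show "(\<lambda>j. T (i, j)) \<in> {j. (i, j) \<in> cells x} \<rightarrow> {y \<in> {1..n}. row y = i}"
      using row_column_T by auto
  qed (use cell(2) row_column_T in auto)
  moreover have "{j. (i, j) \<in> cells x} = {1..nat (x i)}"
  proof (cases "i \<ge> 1")
    case False
    then have "x i = 0" using partition_pointsD(3)[OF x, of i] by auto
    then show ?thesis using False by (auto simp: cells_def)
  qed (auto simp: cells_def)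
  ultimately show ?thesis using bij_betw_same_card by (fastforce simp: content_def)
qed

end

section \<open>The Young symmetrizer and its character\<close>

context young_tableau
begin

definition row_sum :: "(nat \<Rightarrow> nat) \<Rightarrow> complex" where
  "row_sum g = (if g \<in> R then 1 else 0)"

definition column_sum :: "(nat \<Rightarrow> nat) \<Rightarrow> complex" where
  "column_sum g = (if g \<in> C then of_int (sign g) else 0)"

definition c :: "(nat \<Rightarrow> nat) \<Rightarrow> complex" where
  "c = conv n row_sum column_sum"

definition left_invariant :: "((nat \<Rightarrow> nat) \<Rightarrow> complex) \<Rightarrow> bool" where
  "left_invariant f \<longleftrightarrow> (\<forall>p\<in>R. \<forall>g\<in>sym_group n. f (p \<circ> g) = f g)"

definition right_signed :: "((nat \<Rightarrow> nat) \<Rightarrow> complex) \<Rightarrow> bool" where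
  "right_signed f \<longleftrightarrow> (\<forall>q\<in>C. \<forall>g\<in>sym_group n. f (g \<circ> q) = of_int (sign q) * f g)"

lemma sym_group_permutation: "p \<in> sym_group n \<Longrightarrow> permutation p"
  using permutes_imp_permutation by blast

lemma sign_comp: "p \<in> sym_group n \<Longrightarrow> q \<in> sym_group n \<Longrightarrow> sign (p \<circ> q) = sign p * sign q"
  by (intro sign_compose sym_group_permutation)

lemma R_mem_iff: "p \<in> R \<Longrightarrow> g \<in> sym_group n \<Longrightarrow> p \<circ> g \<in> R \<longleftrightarrow> g \<in> R"
  using R_comp[of p g] R_comp[of "inv p" "p \<circ> g"] R_inv[of p] inv_comp_cancel(1)[of p n g] R_sub by auto

lemma C_mem_iff: "q \<in> C \<Longrightarrow> g \<in> sym_group n \<Longrightarrow> g \<circ> q \<in> C \<longleftrightarrow> g \<in> C"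
  using C_comp[of g q] C_comp[of "g \<circ> q" "inv q"] C_inv[of q] inv_comp_cancel(3)[of q n g] C_sub by auto

lemma left_invariant_row_sum: "left_invariant row_sum"
  by (simp add: left_invariant_def row_sum_def R_mem_iff)

lemma right_signed_column_sum: "right_signed column_sum"
  unfolding right_signed_def
proof (intro ballI)
  fix q g assume q: "q \<in> C" and g: "g \<in> sym_group n"
  show "column_sum (g \<circ> q) = of_int (sign q) * column_sum g"
    unfolding column_sum_def C_mem_iff[OF q g] using sign_comp[OF g] q C_sub by auto
qed

lemma column_sum_in_group_alg: "column_sum \<in> group_alg n"
  using C_sub by (auto simp: column_sum_def group_alg_def)

lemma row_sum_in_group_alg: "row_sum \<in> group_alg n"
  using R_sub by (auto simp: row_sum_def group_alg_def)

lemma c_in_group_alg: "c \<in> group_alg n"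
  unfolding c_def by (rule conv_in_group_alg[OF column_sum_in_group_alg])

lemma left_invariant_conv:
  assumes "left_invariant f"
  shows "left_invariant (conv n f g)"
  unfolding left_invariant_def
proof (intro ballI)
  fix p y assume p: "p \<in> R" and y: "y \<in> sym_group n"
  have pG: "p \<in> sym_group n" using p R_sub by blast
  have "conv n f g (p \<circ> y) = (\<Sum>q\<in>sym_group n. f (p \<circ> q) * g (inv (p \<circ> q) \<circ> (p \<circ> y)))"
    unfolding conv_def by (rule sum_left_translate[OF pG, symmetric])
  also have "\<dots> = conv n f g y"
    unfolding conv_def
  proof (rule sum.cong[OF refl])
    fix q assume q: "q \<in> sym_group n"
    have "inv (p \<circ> q) \<circ> (p \<circ> y) = inv q \<circ> y"
      by (simp only: inv_comp[OF pG q] comp_assoc inv_comp_cancel[OF pG])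
    moreover have "f (p \<circ> q) = f q" using assms p q by (simp only: left_invariant_def)
    ultimately show "f (p \<circ> q) * g (inv (p \<circ> q) \<circ> (p \<circ> y)) = f q * g (inv q \<circ> y)" by simp
  qed
  finally show "conv n f g (p \<circ> y) = conv n f g y" .
qed

lemma right_signed_conv:
  assumes "right_signed g"
  shows "right_signed (conv n f g)"
  unfolding right_signed_def
proof (intro ballI)
  fix s y assume s: "s \<in> C" and y: "y \<in> sym_group n"
  have "g (inv q \<circ> (y \<circ> s)) = of_int (sign s) * g (inv q \<circ> y)" if "q \<in> sym_group n" for q
    using assms s sym_group_comp[OF sym_group_inv[OF that] y]
    by (simp only: right_signed_def comp_assoc[symmetric])
  then show "conv n f g (y \<circ> s) = of_int (sign s) * conv n f g y"
    by (simp add: conv_def sum_distrib_left mult.left_commute)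
qed

lemma left_invariant_c: "left_invariant c" and right_signed_c: "right_signed c"
  unfolding c_def
  by (rule left_invariant_conv[OF left_invariant_row_sum], rule right_signed_conv[OF right_signed_column_sum])

lemma sum_row_sum: "(\<Sum>p\<in>sym_group n. row_sum p * f p) = (\<Sum>p\<in>R. f p)"
  by (rule sum.mono_neutral_cong_right) (use R_sub in \<open>auto simp: row_sum_def finite_sym_group\<close>)

lemma sum_column_sum: "(\<Sum>q\<in>sym_group n. column_sum q * f q) = (\<Sum>q\<in>C. of_int (sign q) * f q)"
  by (rule sum.mono_neutral_cong_right) (use C_sub in \<open>auto simp: column_sum_def finite_sym_group\<close>)

lemma finite_R: "finite R" and finite_C: "finite C"
  using finite_subset[OF R_sub finite_sym_group] finite_subset[OF C_sub finite_sym_group] by auto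

text \<open>\<open>R\<close> and \<open>C\<close> meet in the identity alone, so only the pair of
  identities multiplies to \<open>id\<close>.\<close>

lemma c_id: "c id = 1"
proof -
  have "c id = (\<Sum>p\<in>R. column_sum (inv p))"
    unfolding c_def conv_id by (rule sum_row_sum)
  also have "\<dots> = (\<Sum>p\<in>R. if p = id then 1 else 0)"
  proof (rule sum.cong[OF refl])
    fix p assume p: "p \<in> R"
    have "inv p \<in> C \<longleftrightarrow> p = id"
      using R_C[OF p] C_inv[of "inv p"] C_id inv_comp_cancel(5)[of p n] p R_sub by (auto simp: inv_id)
    then show "column_sum (inv p) = (if p = id then 1 else 0)"
      by (simp add: column_sum_def inv_id sign_id)
  qed
  finally show ?thesis using R_id finite_R by simp
qed

lemma sum_c: "(\<Sum>\<tau>\<in>sym_group n. c \<tau> * Y \<tau>) = (\<Sum>p\<in>R. \<Sum>q\<in>C. of_int (sign q) * Y (p \<circ> q))"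
proof -
  have "(\<Sum>\<tau>\<in>sym_group n. c \<tau> * Y \<tau>) =
     (\<Sum>\<tau>\<in>sym_group n. \<Sum>p\<in>sym_group n. row_sum p * (column_sum (inv p \<circ> \<tau>) * Y \<tau>))"
    by (simp add: c_def conv_def sum_distrib_right mult.assoc)
  also have "\<dots> = (\<Sum>p\<in>sym_group n. \<Sum>\<tau>\<in>sym_group n. row_sum p * (column_sum (inv p \<circ> \<tau>) * Y \<tau>))"
    by (rule sum.swap)
  also have "\<dots> = (\<Sum>p\<in>sym_group n. row_sum p * (\<Sum>q\<in>sym_group n. column_sum q * Y (p \<circ> q)))"
  proof (rule sum.cong[OF refl])
    fix p assume p: "p \<in> sym_group n"
    have "(\<Sum>\<tau>\<in>sym_group n. column_sum (inv p \<circ> \<tau>) * Y \<tau>) =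
        (\<Sum>q\<in>sym_group n. column_sum (inv p \<circ> (p \<circ> q)) * Y (p \<circ> q))"
      by (rule sum_left_translate[OF p, symmetric])
    then show "(\<Sum>\<tau>\<in>sym_group n. row_sum p * (column_sum (inv p \<circ> \<tau>) * Y \<tau>)) =
        row_sum p * (\<Sum>q\<in>sym_group n. column_sum q * Y (p \<circ> q))"
      by (simp only: inv_comp_cancel(1)[OF p] sum_distrib_left[symmetric])
  qed
  also have "\<dots> = (\<Sum>p\<in>R. \<Sum>q\<in>C. of_int (sign q) * Y (p \<circ> q))"
    unfolding sum_row_sum sum_column_sum ..
  finally show ?thesis .
qed

lemma sign_transposition: "u \<noteq> v \<Longrightarrow> sign (transpose u v) = -1"
  by (simp add: sign_swap_id)

text \<open>Two numbers in one column are sent by \<open>g\<close> into one row. Their transposition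
  lies in \<open>C\<close> and its conjugate by \<open>g\<close> in \<open>R\<close>, so the two
  covariances give \<open>z g = - z g\<close>.\<close>

lemma von_neumann_zero:
  assumes z: "left_invariant z" "right_signed z" and g: "g \<in> sym_group n" "\<not> column_injective (row \<circ> g)"
  shows "z g = 0"
proof -
  obtain u v where uv: "u \<in> {1..n}" "v \<in> {1..n}" "u \<noteq> v" "(row \<circ> g) u = (row \<circ> g) v" "transpose u v \<in> C"
    using not_column_injective_transposition[OF g(2)] by blast
  have gm: "g u \<in> {1..n}" "g v \<in> {1..n}" using mem_permute[OF g(1)] uv(1,2) by blast+
  have "transpose (g u) (g v) \<in> sym_group n" using permutes_swap_id[OF gm] by simp
  then have "transpose (g u) (g v) \<in> R" using uv(4) by (auto simp: R_def transpose_def)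
  moreover have "g \<circ> transpose u v = transpose (g u) (g v) \<circ> g"
  proof
    fix y
    have "g y = g u \<longleftrightarrow> y = u" "g y = g v \<longleftrightarrow> y = v"
      using g(1) permutes_inj[of g "{1..n}"] by (auto dest: injD)
    then show "(g \<circ> transpose u v) y = (transpose (g u) (g v) \<circ> g) y" by (simp add: transpose_def)
  qed
  ultimately have "z (g \<circ> transpose u v) = z g" using z(1) g(1) by (simp add: left_invariant_def)
  moreover have "z (g \<circ> transpose u v) = - z g"
    using z(2) uv(3,5) g(1) by (simp add: right_signed_def sign_transposition)
  ultimately show ?thesis by simp
qed

text \<open>A permutation either factors as \<open>p \<circ> q\<close>, where both covariances
  determine the value from that at \<open>id\<close>, or is a place where \<open>z\<close> and
  \<open>c\<close> both vanish. The factor is \<open>z id\<close> because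
  \<open>c id = 1\<close>.\<close>

lemma von_neumann:
  assumes z: "left_invariant z" "right_signed z" "z \<in> group_alg n"
  shows "z = (\<lambda>g. z id * c g)"
proof
  fix g
  have f: "f (p \<circ> q) = of_int (sign q) * f id" if f: "left_invariant f" "right_signed f" and pq: "p \<in> R" "q \<in> C" for f p q
  proof -
    have "f (p \<circ> q) = f (id \<circ> q)" using f(1) pq C_sub by (auto simp: left_invariant_def)
    also have "\<dots> = of_int (sign q) * f id" using f(2) pq(2) sym_group_id by (simp only: right_signed_def)
    finally show ?thesis .
  qed
  show "z g = z id * c g"
  proof (cases "g \<in> sym_group n")
    case True
    show ?thesis
    proof (cases "column_injective (row \<circ> g)")
      case inj: True
      then obtain p q where "p \<in> R" "q \<in> C" "g = p \<circ> q" using column_injective_factor[OF True] by blast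
      then show ?thesis using f[OF z(1,2)] f[OF left_invariant_c right_signed_c] c_id by simp
    next
      case False
      then show ?thesis
        using von_neumann_zero[OF z(1,2) True] von_neumann_zero[OF left_invariant_c right_signed_c True] by simp
    qed
  next
    case False
    then show ?thesis using group_algD[OF z(3)] group_algD[OF c_in_group_alg] by simp
  qed
qed

definition h :: complex where "h = conv n c c id"

lemma c_c: "conv n c c = (\<lambda>g. h * c g)"
  unfolding h_def
  by (intro von_neumann left_invariant_conv right_signed_conv conv_in_group_alg
      left_invariant_c right_signed_c c_in_group_alg)

lemma c_y_c: "conv n c (conv n y c) = (\<lambda>g. conv n c (conv n y c) id * c g)"
  by (intro von_neumann left_invariant_conv right_signed_conv conv_in_group_alg
      left_invariant_c right_signed_c c_in_group_alg)

lemma c_Reals: "c g \<in> \<real>"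
  by (auto simp: c_def conv_def row_sum_def column_sum_def)

lemma sum_squares_Reals:
  assumes "finite A" "\<And>g. g \<in> A \<Longrightarrow> f g \<in> \<real>" "(\<Sum>g\<in>A. f g * f g) = (0 :: complex)" "g \<in> A"
  shows "f g = 0"
proof -
  have "(\<Sum>g\<in>A. f g * f g) = of_real (\<Sum>g\<in>A. (Re (f g))\<^sup>2)"
    unfolding of_real_sum using assms(2) by (intro sum.cong) (auto simp: complex_is_Real_iff complex_eq_iff power2_eq_square)
  then have "(\<Sum>g\<in>A. (Re (f g))\<^sup>2) = 0" using assms(3) by (metis of_real_eq_0_iff)
  then have "Re (f g) = 0" using assms(1,4) by (simp add: sum_nonneg_eq_0_iff)
  then show ?thesis using assms(2,4) by (auto simp: complex_is_Real_iff complex_eq_iff)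
qed

text \<open>If \<open>h = 0\<close>, then \<open>c y c = 0\<close> for all \<open>y\<close>. With \<open>y\<close> the adjoint of \<open>c\<close>, the self-adjoint element
  \<open>w = c y\<close> satisfies \<open>w w = 0\<close>, hence \<open>w = 0\<close>, hence \<open>c = 0\<close>.\<close>

lemma h_nonzero: "h \<noteq> 0"
proof
  assume h0: "h = 0"
  define w where "w = conv n c (involution c)"
  \<comment> \<open>This value is the scalar by which \<open>c y c\<close> is a multiple of
    \<open>c\<close>; rotation under the trace form brings the two factors \<open>c\<close>
    together.\<close>
  have "conv n c (conv n (involution c) c) id = conv n (conv n c c) (involution c) id"
    by (metis conv_assoc conv_id_commute)
  also have "\<dots> = 0" unfolding c_c h0 by (simp add: conv_def)
  finally have "conv n w c = (\<lambda>g. 0)"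
    using c_y_c[of "involution c"] by (simp add: w_def conv_assoc)
  then have "conv n w w id = 0" unfolding w_def by (simp add: conv_assoc[symmetric]) (simp add: conv_def)
  moreover have inv_w: "w (inv q) = w q" if q: "q \<in> sym_group n" for q
  proof -
    have "w (inv q) = conv n (involution (involution c)) (involution c) q"
      using involution_conv[OF q, of c "involution c"] by (simp add: w_def involution_def)
    also have "\<dots> = w q"
      unfolding w_def conv_def
      by (rule sum.cong[OF refl]) (use inv_comp_cancel(5)[of _ n] in \<open>simp add: involution_def\<close>)
    finally show ?thesis .
  qed
  ultimately have "(\<Sum>q\<in>sym_group n. w q * w q) = 0" by (simp add: conv_id)
  moreover have "w q \<in> \<real>" for q
    using c_Reals by (auto simp: w_def conv_def involution_def intro!: sum_in_Reals)
  ultimately have "w id = 0" using sum_squares_Reals[OF finite_sym_group, of n w id] sym_group_id by blast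
  moreover have "w id = (\<Sum>q\<in>sym_group n. c q * c q)"
    unfolding w_def conv_id by (rule sum.cong) (use inv_comp_cancel(5)[of _ n] in \<open>auto simp: involution_def\<close>)
  ultimately have "c id = 0"
    using sum_squares_Reals[OF finite_sym_group, of n c id] sym_group_id c_Reals by auto
  then show False using c_id by simp
qed

text \<open>The trace on the left ideal of \<open>c\<close>, in the form supplied by
  \<open>trace_on_left_ideal\<close>.\<close>

definition chi :: "(nat \<Rightarrow> nat) \<Rightarrow> complex" where
  "chi \<sigma> = (\<Sum>g\<in>sym_group n. c (inv g \<circ> inv \<sigma> \<circ> g)) / h"

definition class_function :: "((nat \<Rightarrow> nat) \<Rightarrow> complex) \<Rightarrow> bool" where
  "class_function X \<longleftrightarrow> (\<forall>k\<in>sym_group n. \<forall>\<sigma>\<in>sym_group n. X (inv k \<circ> \<sigma> \<circ> k) = X \<sigma>)"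

lemma inv_conjugate:
  assumes "k \<in> sym_group n" "\<sigma> \<in> sym_group n"
  shows "inv (inv k \<circ> \<sigma> \<circ> k) = inv k \<circ> inv \<sigma> \<circ> k"
  using assms inv_comp[OF sym_group_comp[OF sym_group_inv[OF assms(1)] assms(2)] assms(1)]
    inv_comp[OF sym_group_inv[OF assms(1)] assms(2)] inv_comp_cancel(5)[OF assms(1)]
  by (simp add: comp_assoc)

text \<open>The products \<open>p q\<close> and \<open>q p\<close> are conjugate.\<close>

lemma class_function_inverse:
  assumes "class_function X"
  shows "(\<Sum>\<tau>\<in>sym_group n. c (inv \<tau>) * X \<tau>) = (\<Sum>\<tau>\<in>sym_group n. c \<tau> * X \<tau>)"
proof -
  have "(\<Sum>\<tau>\<in>sym_group n. c (inv \<tau>) * X \<tau>) = (\<Sum>\<tau>\<in>sym_group n. c (inv (inv \<tau>)) * X (inv \<tau>))"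
    by (rule sum_inverse[symmetric])
  also have "\<dots> = (\<Sum>\<tau>\<in>sym_group n. c \<tau> * X (inv \<tau>))"
    by (rule sum.cong[OF refl]) (simp add: inv_comp_cancel(5)[of _ n])
  also have "\<dots> = (\<Sum>p\<in>R. \<Sum>q\<in>C. of_int (sign q) * X (inv (p \<circ> q)))" by (rule sum_c)
  also have "\<dots> = (\<Sum>p\<in>R. \<Sum>q\<in>C. of_int (sign (inv q)) * X (inv (inv p \<circ> inv q)))"
  proof -
    have "(\<Sum>q\<in>C. f (inv q)) = (\<Sum>q\<in>C. f q)" for f :: "(nat \<Rightarrow> nat) \<Rightarrow> complex"
      by (rule sum.reindex_bij_witness[where i = inv and j = inv])
        (use C_inv C_sub inv_comp_cancel(5)[of _ n] in auto)
    from this[of "\<lambda>q. of_int (sign q) * X (inv (p \<circ> q))" for p]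
    have 1: "(\<Sum>q\<in>C. of_int (sign (inv q)) * X (inv (p \<circ> inv q))) = (\<Sum>q\<in>C. of_int (sign q) * X (inv (p \<circ> q)))" for p .
    have "(\<Sum>p\<in>R. f (inv p)) = (\<Sum>p\<in>R. f p)" for f :: "(nat \<Rightarrow> nat) \<Rightarrow> complex"
      by (rule sum.reindex_bij_witness[where i = inv and j = inv])
        (use R_inv R_sub inv_comp_cancel(5)[of _ n] in auto)
    from this[of "\<lambda>p. \<Sum>q\<in>C. of_int (sign (inv q)) * X (inv (p \<circ> inv q))"] show ?thesis
      by (simp only: 1)
  qed
  also have "\<dots> = (\<Sum>p\<in>R. \<Sum>q\<in>C. of_int (sign q) * X (p \<circ> q))"
  proof (intro sum.cong refl)
    fix p q assume pq: "p \<in> R" "q \<in> C"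
    then have pG: "p \<in> sym_group n" and qG: "q \<in> sym_group n" using R_sub C_sub by auto
    have "inv (inv p \<circ> inv q) = q \<circ> p"
      using inv_comp[OF sym_group_inv[OF pG] sym_group_inv[OF qG]] inv_comp_cancel(5)[OF pG] inv_comp_cancel(5)[OF qG]
      by simp
    also have "\<dots> = inv p \<circ> (p \<circ> q) \<circ> p" by (simp only: inv_comp_cancel[OF pG])
    finally have "X (inv (inv p \<circ> inv q)) = X (p \<circ> q)"
      using assms pG sym_group_comp[OF pG qG] by (simp only: class_function_def)
    moreover have "sign (inv q) = sign q" by (rule sign_inverse[OF sym_group_permutation[OF qG]])
    ultimately show "of_int (sign (inv q)) * X (inv (inv p \<circ> inv q)) = of_int (sign q) * X (p \<circ> q)" by simp
  qed
  also have "\<dots> = (\<Sum>\<tau>\<in>sym_group n. c \<tau> * X \<tau>)" by (rule sum_c[symmetric])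
  finally show ?thesis .
qed

text \<open>Against a class function all conjugating elements \<open>g\<close> contribute alike,
  which gives the factor \<open>n!\<close>; the inverse in the argument is absorbed by
  \<open>class_function_inverse\<close>.\<close>

lemma pairing_chi:
  assumes "class_function X"
  shows "(\<Sum>\<sigma>\<in>sym_group n. chi \<sigma> * X \<sigma>) = fact n / h * (\<Sum>\<tau>\<in>sym_group n. c \<tau> * X \<tau>)"
proof -
  have "(\<Sum>\<sigma>\<in>sym_group n. chi \<sigma> * X \<sigma>) =
     (\<Sum>\<sigma>\<in>sym_group n. \<Sum>g\<in>sym_group n. c (inv g \<circ> inv \<sigma> \<circ> g) * X \<sigma> / h)"
    by (simp add: chi_def sum_distrib_right sum_divide_distrib)
  also have "\<dots> = (\<Sum>g\<in>sym_group n. \<Sum>\<sigma>\<in>sym_group n. c (inv g \<circ> inv \<sigma> \<circ> g) * X \<sigma> / h)"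
    by (rule sum.swap)
  also have "\<dots> = (\<Sum>g\<in>sym_group n. \<Sum>\<tau>\<in>sym_group n. c (inv \<tau>) * X \<tau> / h)"
  proof (rule sum.cong[OF refl])
    fix g assume g: "g \<in> sym_group n"
    have "(\<Sum>\<sigma>\<in>sym_group n. c (inv g \<circ> inv \<sigma> \<circ> g) * X \<sigma> / h) =
        (\<Sum>\<sigma>\<in>sym_group n. c (inv (inv g \<circ> \<sigma> \<circ> g)) * X (inv g \<circ> \<sigma> \<circ> g) / h)"
    proof (rule sum.cong[OF refl])
      fix \<sigma> assume s: "\<sigma> \<in> sym_group n"
      have "X (inv g \<circ> \<sigma> \<circ> g) = X \<sigma>" using assms g s by (simp only: class_function_def)
      then show "c (inv g \<circ> inv \<sigma> \<circ> g) * X \<sigma> / h = c (inv (inv g \<circ> \<sigma> \<circ> g)) * X (inv g \<circ> \<sigma> \<circ> g) / h"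
        by (simp only: inv_conjugate[OF g s])
    qed
    also have "\<dots> = (\<Sum>\<tau>\<in>sym_group n. c (inv \<tau>) * X \<tau> / h)"
      by (rule sum_conjugate[OF g])
    finally show "(\<Sum>\<sigma>\<in>sym_group n. c (inv g \<circ> inv \<sigma> \<circ> g) * X \<sigma> / h) =
        (\<Sum>\<tau>\<in>sym_group n. c (inv \<tau>) * X \<tau> / h)" .
  qed
  also have "\<dots> = fact n / h * (\<Sum>\<tau>\<in>sym_group n. c (inv \<tau>) * X \<tau>)"
    by (simp only: sum_constant card_sym_group sum_divide_distrib[symmetric]) simp
  finally show ?thesis by (simp only: class_function_inverse[OF assms])
qed

lemma class_function_chi: "class_function chi"
  unfolding class_function_def
proof (intro ballI)
  fix k \<sigma> assume k: "k \<in> sym_group n" and s: "\<sigma> \<in> sym_group n"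
  have "(\<Sum>g\<in>sym_group n. c (inv g \<circ> inv (inv k \<circ> \<sigma> \<circ> k) \<circ> g)) =
      (\<Sum>g\<in>sym_group n. c (inv (k \<circ> g) \<circ> inv \<sigma> \<circ> (k \<circ> g)))"
    unfolding inv_conjugate[OF k s] by (rule sum.cong[OF refl]) (simp only: inv_comp[OF k] comp_assoc)
  also have "\<dots> = (\<Sum>g\<in>sym_group n. c (inv g \<circ> inv \<sigma> \<circ> g))"
    by (rule sum_left_translate[OF k])
  finally show "chi (inv k \<circ> \<sigma> \<circ> k) = chi \<sigma>" by (simp only: chi_def)
qed

text \<open>The pairing reduces to traces of \<open>c\<close> times a conjugate of \<open>c\<close>.
  As \<open>c k c\<close> is a multiple of \<open>c\<close>, each trace is
  \<open>h * c k * c (inv k)\<close>; summing over \<open>k\<close> gives \<open>h\<close> times the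
  value of \<open>c c\<close> at \<open>id\<close>, which is again \<open>h\<close>.\<close>

lemma chi_norm: "(\<Sum>\<sigma>\<in>sym_group n. chi \<sigma> * chi \<sigma>) = fact n"
proof -
  have inner: "(\<Sum>\<tau>\<in>sym_group n. c \<tau> * c (inv k \<circ> inv \<tau> \<circ> k)) = h * (c k * c (inv k))"
    if k: "k \<in> sym_group n" for k
  proof -
    have D: "conv n (group_elem k) (conv n c (group_elem (inv k))) y = c (inv k \<circ> y \<circ> k)" for y
      by (simp only: conv_group_elem_left[OF k] conv_group_elem_right[OF sym_group_inv[OF k] c_in_group_alg]
          inv_comp_cancel(5)[OF k])
    have "(\<Sum>\<tau>\<in>sym_group n. c \<tau> * c (inv k \<circ> inv \<tau> \<circ> k)) =
       conv n c (conv n (group_elem k) (conv n c (group_elem (inv k)))) id"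
      unfolding conv_id[of n c] D ..
    also have "\<dots> = conv n (conv n c (conv n (group_elem k) c)) (group_elem (inv k)) id"
      by (simp only: conv_assoc)
    also have "\<dots> = conv n c (conv n (group_elem k) c) (id \<circ> inv (inv k))"
      by (intro conv_group_elem_right[OF sym_group_inv[OF k]] conv_in_group_alg c_in_group_alg)
    also have "\<dots> = conv n c (conv n (group_elem k) c) id * c k"
      by (subst c_y_c) (simp only: inv_comp_cancel(5)[OF k] id_comp)
    also have "conv n c (conv n (group_elem k) c) id = conv n (group_elem k) (conv n c c) id"
      by (metis conv_assoc conv_id_commute)
    also have "\<dots> = h * c (inv k)" by (simp only: conv_group_elem_left[OF k] c_c comp_id)
    finally show ?thesis by (simp only: ac_simps)
  qed
  have "(\<Sum>\<tau>\<in>sym_group n. c \<tau> * chi \<tau>) =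
      (\<Sum>\<tau>\<in>sym_group n. \<Sum>k\<in>sym_group n. c \<tau> * c (inv k \<circ> inv \<tau> \<circ> k)) / h"
    by (simp add: chi_def sum_distrib_left sum_divide_distrib)
  also have "\<dots> = (\<Sum>k\<in>sym_group n. \<Sum>\<tau>\<in>sym_group n. c \<tau> * c (inv k \<circ> inv \<tau> \<circ> k)) / h"
    by (subst sum.swap) (rule refl)
  also have "\<dots> = (\<Sum>k\<in>sym_group n. h * (c k * c (inv k))) / h"
    by (intro arg_cong[where f = "\<lambda>z. z / h"] sum.cong refl inner)
  also have "\<dots> = h" using h_nonzero by (simp add: sum_distrib_left[symmetric] conv_id[symmetric] h_def[symmetric])
  finally show ?thesis using h_nonzero by (simp add: pairing_chi[OF class_function_chi])
qed

lemma chi_Reals: "chi \<sigma> \<in> \<real>"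
proof -
  have "h \<in> \<real>" unfolding h_def conv_id using c_Reals by (intro sum_in_Reals Reals_mult)
  then show ?thesis unfolding chi_def using c_Reals by (intro Reals_divide sum_in_Reals)
qed

end

section \<open>Pairing the character with permutation characters\<close>

lemma words_permute:
  assumes "f \<in> words n N" "\<tau> \<in> sym_group n"
  shows "f \<circ> \<tau> \<in> words n N"
proof -
  have "f \<circ> \<tau> \<in> extensional {1..n}"
    using assms by (intro extensional_permute) (auto simp: words_def PiE_iff)
  moreover have "(f \<circ> \<tau>) y \<in> {1..N}" if "y \<in> {1..n}" for y
  proof -
    have "\<tau> y \<in> {1..n}" using that assms(2) permutes_in_image by fastforce
    then show ?thesis using assms(1) by (auto simp: words_def PiE_iff)
  qed
  ultimately show ?thesis unfolding words_def PiE_iff by blast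
qed

context young_tableau
begin

lemma weight_x: "weight N x = int n"
  using bij_betw_same_card[OF T] card_cells[OF x] by simp

definition twisted_words :: "(nat \<Rightarrow> nat) \<Rightarrow> (nat \<Rightarrow> nat) set" where
  "twisted_words w = {f \<in> words n N. \<forall>i\<in>{1..N}. int (content n f i) = twist x w i}"

lemma finite_twisted_words: "finite (twisted_words w)"
  using finite_words by (simp add: twisted_words_def)

lemma twisted_words_permute: "f \<in> twisted_words w \<Longrightarrow> \<tau> \<in> sym_group n \<Longrightarrow> f \<circ> \<tau> \<in> twisted_words w"
  using words_permute[of f n N \<tau>] content_permute[of \<tau> n f] by (auto simp: twisted_words_def)

lemma twist_character_eq: "twist_character n N x w \<sigma> = real (card {f \<in> twisted_words w. f \<circ> \<sigma> = f})"
  unfolding twist_character_def twisted_words_def by (rule arg_cong[where f = "\<lambda>A. real (card A)"]) auto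

lemma class_function_twist: "class_function (\<lambda>\<sigma>. of_real (twist_character n N x w \<sigma>))"
  unfolding class_function_def
proof (intro ballI)
  fix k \<sigma> assume k: "k \<in> sym_group n" and s: "\<sigma> \<in> sym_group n"
  have "bij_betw (\<lambda>f. f \<circ> inv k) {f \<in> twisted_words w. f \<circ> (inv k \<circ> \<sigma> \<circ> k) = f} {f \<in> twisted_words w. f \<circ> \<sigma> = f}"
  proof (rule bij_betwI[where g = "\<lambda>f. f \<circ> k"])
    show "(\<lambda>f. f \<circ> inv k) \<in> {f \<in> twisted_words w. f \<circ> (inv k \<circ> \<sigma> \<circ> k) = f} \<rightarrow> {f \<in> twisted_words w. f \<circ> \<sigma> = f}"
    proof
      fix f assume f: "f \<in> {f \<in> twisted_words w. f \<circ> (inv k \<circ> \<sigma> \<circ> k) = f}"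
      have "f \<circ> inv k \<circ> \<sigma> = (f \<circ> (inv k \<circ> \<sigma> \<circ> k)) \<circ> inv k"
        by (simp only: comp_assoc inv_comp_cancel(6)[OF k] comp_id)
      then show "f \<circ> inv k \<in> {f \<in> twisted_words w. f \<circ> \<sigma> = f}"
        using f twisted_words_permute[OF _ sym_group_inv[OF k]] by simp
    qed
    show "(\<lambda>f. f \<circ> k) \<in> {f \<in> twisted_words w. f \<circ> \<sigma> = f} \<rightarrow> {f \<in> twisted_words w. f \<circ> (inv k \<circ> \<sigma> \<circ> k) = f}"
    proof
      fix f assume f: "f \<in> {f \<in> twisted_words w. f \<circ> \<sigma> = f}"
      have "f \<circ> k \<circ> (inv k \<circ> \<sigma> \<circ> k) = (f \<circ> \<sigma>) \<circ> k"
        by (simp only: comp_assoc inv_comp_cancel(2)[OF k])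
      then show "f \<circ> k \<in> {f \<in> twisted_words w. f \<circ> (inv k \<circ> \<sigma> \<circ> k) = f}"
        using f twisted_words_permute[OF _ k] by simp
    qed
  qed (simp_all add: inv_comp_cancel(3,4)[OF k])
  then show "complex_of_real (twist_character n N x w (inv k \<circ> \<sigma> \<circ> k)) = of_real (twist_character n N x w \<sigma>)"
    unfolding twist_character_eq by (simp add: bij_betw_same_card)
qed

text \<open>For the \<open>k\<close> of \<open>permutes_first_moved\<close>, such a word has more
  letters up to \<open>k\<close> than the first \<open>k\<close> rows have boxes, against the
  dominance bound for column-injective fillings.\<close>

lemma twisted_not_column_injective:
  assumes w: "w permutes {1..N}" "w \<noteq> id" and f: "f \<in> twisted_words w"
  shows "\<not> column_injective f"
proof
  assume inj: "column_injective f"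
  have pos: "1 \<le> f y" if "y \<in> {1..n}" for y
    using f that by (auto simp: twisted_words_def words_def PiE_iff)
  obtain k where k: "k \<in> {1..N}" "(\<Sum>i=1..k. int i) < (\<Sum>i=1..k. int (w i))"
    using permutes_first_moved[OF w] by blast
  have "int (card {y \<in> {1..n}. f y \<le> k}) = (\<Sum>i=1..k. int (content n f i))"
    by (subst card_le_eq_sum_content[OF pos]) simp_all
  also have "\<dots> = (\<Sum>i=1..k. twist x w i)"
    using f k(1) by (intro sum.cong) (auto simp: twisted_words_def)
  also have "\<dots> = (\<Sum>i=1..k. x i) - (\<Sum>i=1..k. int i) + (\<Sum>i=1..k. int (w i))"
    by (simp add: twist_def sum.distrib sum_subtractf)
  also have "(\<Sum>i=1..k. x i) = int (card {y \<in> {1..n}. row y \<le> k})"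
    by (subst card_le_eq_sum_content[OF row_pos]) (simp_all add: content_row partition_pointsD(2)[OF x])
  finally show False using column_injective_dominance[OF inj pos, of k] k(2) by simp
qed

text \<open>A word with a repetition in a column is fixed by the transposition of the two places,
  which reverses the sign; so the signed sum over \<open>C\<close> vanishes.\<close>

lemma sum_c_twist:
  assumes w: "w permutes {1..N}" "w \<noteq> id"
  shows "(\<Sum>\<tau>\<in>sym_group n. c \<tau> * of_real (twist_character n N x w \<tau>)) = 0"
proof -
  let ?F = "twisted_words w"
  have fiber: "(\<Sum>q\<in>C. of_int (sign q) * (if f' \<circ> q = f then 1 else 0)) = (0 :: complex)"
    if f': "f' \<in> ?F" for f f'
  proof -
    let ?S = "\<Sum>q\<in>C. of_int (sign q) * (if f' \<circ> q = f then 1 else 0) :: complex"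
    obtain u v where uv: "u \<noteq> v" "f' u = f' v" "transpose u v \<in> C"
      using not_column_injective_transposition[OF twisted_not_column_injective[OF w f']] by blast
    let ?t = "transpose u v"
    have tG: "?t \<in> sym_group n" using uv(3) C_sub by blast
    have ft: "f' \<circ> ?t = f'" using uv(2) by (auto simp: fun_eq_iff transpose_def)
    have "?S = (\<Sum>q\<in>C. of_int (sign (?t \<circ> q)) * (if f' \<circ> (?t \<circ> q) = f then 1 else 0))"
      by (rule sum.reindex_bij_witness[where i = "\<lambda>q. ?t \<circ> q" and j = "\<lambda>q. ?t \<circ> q"])
        (use C_comp[OF uv(3)] in \<open>auto simp: comp_assoc[symmetric]\<close>)
    also have "\<dots> = (\<Sum>q\<in>C. - (of_int (sign q) * (if f' \<circ> q = f then 1 else 0)))"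
    proof (rule sum.cong[OF refl])
      fix q assume "q \<in> C"
      then have "sign (?t \<circ> q) = - sign q"
        using sign_comp[OF tG, of q] C_sub sign_transposition[OF uv(1)] by auto
      moreover have "f' \<circ> (?t \<circ> q) = f' \<circ> q" by (simp add: comp_assoc[symmetric] ft)
      ultimately show "of_int (sign (?t \<circ> q)) * (if f' \<circ> (?t \<circ> q) = f then 1 else 0) =
          - (of_int (sign q) * (if f' \<circ> q = f then 1 else 0 :: complex))" by simp
    qed
    also have "\<dots> = - ?S" by (rule sum_negf)
    finally show ?thesis by simp
  qed
  have "(\<Sum>\<tau>\<in>sym_group n. c \<tau> * of_real (twist_character n N x w \<tau>)) =
     (\<Sum>p\<in>R. \<Sum>q\<in>C. \<Sum>f\<in>?F. of_int (sign q) * (if (f \<circ> p) \<circ> q = f then 1 else 0))"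
    unfolding sum_c twist_character_eq
    by (intro sum.cong refl) (simp add: finite_twisted_words sum.If_cases Int_def comp_assoc sum_distrib_left[symmetric])
  also have "\<dots> = (\<Sum>p\<in>R. \<Sum>f\<in>?F. \<Sum>q\<in>C. of_int (sign q) * (if (f \<circ> p) \<circ> q = f then 1 else 0))"
    by (intro sum.cong refl sum.swap)
  also have "\<dots> = 0"
  proof (rule sum.neutral, rule ballI, rule sum.neutral, rule ballI)
    fix p f assume "p \<in> R" "f \<in> ?F"
    then have "f \<circ> p \<in> ?F" using twisted_words_permute R_sub by blast
    then show "(\<Sum>q\<in>C. of_int (sign q) * (if (f \<circ> p) \<circ> q = f then 1 else 0)) = (0 :: complex)"
      by (rule fiber)
  qed
  finally show ?thesis .
qed

lemma row_word: "(\<lambda>y\<in>{1..n}. row y) \<in> twisted_words id"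
proof -
  have "row y \<in> {1..N}" if "y \<in> {1..n}" for y
    using cell(1)[OF that] unfolding cells_eq_Sigma[OF x] by auto
  moreover have "content n (\<lambda>y\<in>{1..n}. row y) i = content n row i" for i
    by (auto simp: content_def intro: arg_cong[where f = card])
  ultimately show ?thesis
    by (auto simp: twisted_words_def words_def twist_def content_row partition_pointsD(2)[OF x])
qed

text \<open>Both sides count the \<open>g\<close> for which \<open>\<sigma>\<close> fixes the rearrangement \<open>row \<circ> g\<close> of the row word.\<close>

lemma twist_id_eq_sum:
  assumes "\<sigma> \<in> sym_group n"
  shows "of_nat (card R) * of_real (twist_character n N x id \<sigma>) =
    (\<Sum>g\<in>sym_group n. row_sum (g \<circ> \<sigma> \<circ> inv g))"
proof -
  let ?r = "\<lambda>y\<in>{1..n}. row y"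
  let ?F = "twisted_words id"
  have re: "?r \<in> extensional {1..n}" by simp
  \<comment> \<open>\<open>R\<close> is the stabilizer of the row word, and the permutations that
    carry the row word to \<open>f\<close> form one of its cosets.\<close>
  have fib: "card {g \<in> sym_group n. ?r \<circ> g = f} = card R" if f: "f \<in> ?F" for f
  proof -
    have "content n f i = content n ?r i" for i
    proof (cases "i \<in> {1..N}")
      case True
      then have "int (content n f i) = int (content n ?r i)" using f row_word by (auto simp: twisted_words_def)
      then show ?thesis by simp
    next
      case False
      then show ?thesis
        using word_content_0[of f n N i] word_content_0[of ?r n N i] f row_word by (simp add: twisted_words_def)
    qed
    then have "content n ?r = content n f" by auto
    moreover have "f \<in> extensional {1..n}" using f by (auto simp: twisted_words_def words_def PiE_iff)
    ultimately obtain \<tau> where \<tau>: "\<tau> permutes {1..n}" "?r \<circ> \<tau> = f" using same_content_permute[OF re] by metis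
    then have tG: "\<tau> \<in> sym_group n" by simp
    have R_iff: "?r \<circ> p = ?r \<longleftrightarrow> p \<in> R" if p: "p \<in> sym_group n" for p
    proof -
      have "(?r \<circ> p) y = ?r y \<longleftrightarrow> (y \<in> {1..n} \<longrightarrow> row (p y) = row y)" for y
        using mem_permute[OF p, of y] by auto
      then show ?thesis using p unfolding R_def fun_eq_iff by blast
    qed
    have "bij_betw (\<lambda>p. p \<circ> \<tau>) R {g \<in> sym_group n. ?r \<circ> g = f}"
    proof (rule bij_betwI[where g = "\<lambda>g. g \<circ> inv \<tau>"])
      show "(\<lambda>p. p \<circ> \<tau>) \<in> R \<rightarrow> {g \<in> sym_group n. ?r \<circ> g = f}"
      proof
        fix p assume p: "p \<in> R"
        then have pG: "p \<in> sym_group n" using R_sub by blast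
        have "?r \<circ> (p \<circ> \<tau>) = (?r \<circ> p) \<circ> \<tau>" by (simp only: comp_assoc)
        also have "\<dots> = f" using R_iff[OF pG] p \<tau>(2) by simp
        finally have "?r \<circ> (p \<circ> \<tau>) = f" .
        then show "p \<circ> \<tau> \<in> {g \<in> sym_group n. ?r \<circ> g = f}" using sym_group_comp[OF pG tG] by simp
      qed
      show "(\<lambda>g. g \<circ> inv \<tau>) \<in> {g \<in> sym_group n. ?r \<circ> g = f} \<rightarrow> R"
      proof
        fix g assume g: "g \<in> {g \<in> sym_group n. ?r \<circ> g = f}"
        then have gG: "g \<circ> inv \<tau> \<in> sym_group n" using sym_group_comp[OF _ sym_group_inv[OF tG]] by blast
        have "?r \<circ> (g \<circ> inv \<tau>) = f \<circ> inv \<tau>" using g by (simp add: comp_assoc[symmetric])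
        also have "\<dots> = ?r" by (simp only: \<tau>(2)[symmetric] inv_comp_cancel(3)[OF tG])
        finally show "g \<circ> inv \<tau> \<in> R" using R_iff[OF gG] by simp
      qed
    qed (simp_all add: inv_comp_cancel(3,4)[OF tG])
    then show ?thesis by (rule bij_betw_same_card[symmetric])
  qed
  have eqv: "?r \<circ> g \<circ> \<sigma> = ?r \<circ> g \<longleftrightarrow> g \<circ> \<sigma> \<circ> inv g \<in> R" if g: "g \<in> sym_group n" for g
  proof -
    have G: "g \<circ> \<sigma> \<circ> inv g \<in> sym_group n"
      by (intro sym_group_comp sym_group_inv g assms)
    have "?r \<circ> g \<circ> \<sigma> = ?r \<circ> g \<longleftrightarrow> ?r \<circ> (g \<circ> \<sigma> \<circ> inv g) = ?r"
    proof
      assume "?r \<circ> g \<circ> \<sigma> = ?r \<circ> g"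
      then have "?r \<circ> g \<circ> \<sigma> \<circ> inv g = ?r \<circ> g \<circ> inv g" by (rule arg_cong)
      then show "?r \<circ> (g \<circ> \<sigma> \<circ> inv g) = ?r"
        by (simp only: comp_assoc inv_comp_cancel(6)[OF g] comp_id)
    next
      assume "?r \<circ> (g \<circ> \<sigma> \<circ> inv g) = ?r"
      then have "?r \<circ> (g \<circ> \<sigma> \<circ> inv g) \<circ> g = ?r \<circ> g" by (rule arg_cong)
      then show "?r \<circ> g \<circ> \<sigma> = ?r \<circ> g"
        by (simp only: comp_assoc inv_comp_cancel(7)[OF g] comp_id)
    qed
    also have "\<dots> \<longleftrightarrow> g \<circ> \<sigma> \<circ> inv g \<in> R"
    proof -
      have "(?r \<circ> p) y = ?r y \<longleftrightarrow> (y \<in> {1..n} \<longrightarrow> row (p y) = row y)" if "p \<in> sym_group n" for p y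
        using mem_permute[OF that, of y] by auto
      then show ?thesis using G unfolding R_def fun_eq_iff by blast
    qed
    finally show ?thesis .
  qed
  have "(\<Sum>g\<in>sym_group n. row_sum (g \<circ> \<sigma> \<circ> inv g)) =
      (\<Sum>g\<in>sym_group n. if (?r \<circ> g) \<circ> \<sigma> = ?r \<circ> g then 1 else 0)"
    by (rule sum.cong[OF refl]) (simp only: row_sum_def eqv)
  also have "\<dots> = (\<Sum>f\<in>?F. \<Sum>g\<in>{g \<in> sym_group n. ?r \<circ> g = f}. if (?r \<circ> g) \<circ> \<sigma> = ?r \<circ> g then 1 else 0)"
    by (rule sum.group[symmetric])
      (use finite_sym_group finite_twisted_words twisted_words_permute[OF row_word] in auto)
  also have "\<dots> = (\<Sum>f\<in>?F. of_nat (card R) * (if f \<circ> \<sigma> = f then 1 else 0))"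
  proof (rule sum.cong[OF refl])
    fix f assume f: "f \<in> ?F"
    have "(\<Sum>g\<in>{g \<in> sym_group n. ?r \<circ> g = f}. if (?r \<circ> g) \<circ> \<sigma> = ?r \<circ> g then 1 else 0 :: complex) =
       (\<Sum>g\<in>{g \<in> sym_group n. ?r \<circ> g = f}. if f \<circ> \<sigma> = f then 1 else 0)"
      by (rule sum.cong) auto
    then show "(\<Sum>g\<in>{g \<in> sym_group n. ?r \<circ> g = f}. if (?r \<circ> g) \<circ> \<sigma> = ?r \<circ> g then 1 else 0) =
        of_nat (card R) * (if f \<circ> \<sigma> = f then 1 else 0 :: complex)"
      by (simp only: sum_constant fib[OF f])
  qed
  also have "\<dots> = of_nat (card R) * of_real (twist_character n N x id \<sigma>)"
    unfolding twist_character_eq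
    by (simp add: sum_distrib_left[symmetric] sum.If_cases finite_twisted_words Int_def)
  finally show ?thesis ..
qed

lemma row_sum_inv: "g \<in> sym_group n \<Longrightarrow> row_sum (inv g) = row_sum g"
  using R_inv[of g] R_inv[of "inv g"] inv_comp_cancel(5)[of g n] by (auto simp: row_sum_def)

text \<open>The permutation character is the sum of the conjugates of \<open>row_sum\<close>,
  divided by \<open>card R\<close>. After rotation under the trace form, \<open>row_sum\<close>
  times \<open>g\<close> times \<open>c\<close> is a multiple of \<open>c\<close> by von Neumann's
  lemma, and summing over \<open>g\<close> leaves the value at \<open>id\<close> of
  \<open>c c\<close> times \<open>row_sum\<close>, which is \<open>h * card R\<close>.\<close>

lemma sum_c_twist_id: "(\<Sum>\<tau>\<in>sym_group n. c \<tau> * of_real (twist_character n N x id \<tau>)) = h"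
proof -
  have inner: "(\<Sum>\<tau>\<in>sym_group n. c \<tau> * row_sum (g \<circ> \<tau> \<circ> inv g)) = c g * conv n c row_sum (inv g)"
    if g: "g \<in> sym_group n" for g
  proof -
    have gi: "inv g \<in> sym_group n" by (rule sym_group_inv[OF g])
    have E: "conv n (group_elem (inv g)) (conv n row_sum (group_elem g)) y = row_sum (g \<circ> y \<circ> inv g)" for y
      by (simp only: conv_group_elem_left[OF gi] conv_group_elem_right[OF g row_sum_in_group_alg]
          inv_comp_cancel(5)[OF g])
    let ?z = "conv n row_sum (conv n (group_elem g) c)"
    have z: "?z = (\<lambda>y. ?z id * c y)"
      by (intro von_neumann left_invariant_conv right_signed_conv conv_in_group_alg
          left_invariant_row_sum right_signed_c c_in_group_alg)
    \<comment> \<open>\<open>conv\<close> at \<open>id\<close> evaluates its second factor at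
      inverses, which is harmless because \<open>R\<close> is closed under inversion.\<close>
    have "row_sum (g \<circ> inv \<tau> \<circ> inv g) = row_sum (g \<circ> \<tau> \<circ> inv g)" if t: "\<tau> \<in> sym_group n" for \<tau>
    proof -
      have "inv (g \<circ> \<tau> \<circ> inv g) = g \<circ> inv \<tau> \<circ> inv g"
        using inv_conjugate[OF gi t] by (simp only: inv_comp_cancel(5)[OF g])
      then show ?thesis
        using row_sum_inv[OF sym_group_comp[OF sym_group_comp[OF g t] gi]] by simp
    qed
    then have "(\<Sum>\<tau>\<in>sym_group n. c \<tau> * row_sum (g \<circ> \<tau> \<circ> inv g)) =
        conv n c (conv n (group_elem (inv g)) (conv n row_sum (group_elem g))) id"
      unfolding conv_id[of n c] E by (intro sum.cong refl) simp
    also have "\<dots> = conv n (conv n row_sum (group_elem g)) (conv n c (group_elem (inv g))) id"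
      by (metis conv_assoc conv_id_commute)
    also have "\<dots> = conv n ?z (group_elem (inv g)) id" by (simp only: conv_assoc)
    also have "\<dots> = ?z (id \<circ> inv (inv g))"
      by (intro conv_group_elem_right gi conv_in_group_alg c_in_group_alg)
    also have "\<dots> = ?z id * c g"
      by (subst z) (simp only: inv_comp_cancel(5)[OF g] id_comp)
    also have "?z id = conv n (group_elem g) (conv n c row_sum) id"
      by (metis conv_assoc conv_id_commute)
    also have "\<dots> = conv n c row_sum (inv g)"
      by (simp only: conv_group_elem_left[OF g] comp_id)
    finally show ?thesis by (simp only: mult.commute)
  qed
  have "of_nat (card R) * (\<Sum>\<tau>\<in>sym_group n. c \<tau> * of_real (twist_character n N x id \<tau>)) =
     (\<Sum>\<tau>\<in>sym_group n. \<Sum>g\<in>sym_group n. c \<tau> * row_sum (g \<circ> \<tau> \<circ> inv g))"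
    unfolding sum_distrib_left
    by (rule sum.cong[OF refl]) (simp only: mult.left_commute[of "of_nat (card R)"] twist_id_eq_sum sum_distrib_left)
  also have "\<dots> = (\<Sum>g\<in>sym_group n. \<Sum>\<tau>\<in>sym_group n. c \<tau> * row_sum (g \<circ> \<tau> \<circ> inv g))"
    by (rule sum.swap)
  also have "\<dots> = (\<Sum>g\<in>sym_group n. c g * conv n c row_sum (inv g))"
    by (intro sum.cong refl inner)
  also have "\<dots> = conv n (conv n c c) row_sum id" by (simp only: conv_id[symmetric] conv_assoc)
  also have "\<dots> = h * conv n row_sum c id" by (simp only: c_c conv_scale_left conv_id_commute[of n c])
  also have "conv n row_sum c id = (\<Sum>p\<in>R. c (inv p))" unfolding conv_id by (rule sum_row_sum)
  also have "\<dots> = (\<Sum>p\<in>R. 1)"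
  proof (rule sum.cong[OF refl])
    fix p assume "p \<in> R"
    then have "c (inv p \<circ> id) = c id" using left_invariant_c R_inv sym_group_id by (simp only: left_invariant_def)
    then show "c (inv p) = 1" by (simp only: comp_id c_id)
  qed
  finally have "of_nat (card R) * (\<Sum>\<tau>\<in>sym_group n. c \<tau> * of_real (twist_character n N x id \<tau>)) =
      h * of_nat (card R)" by (simp only: sum_constant mult_1_right)
  moreover have "of_nat (card R) \<noteq> (0 :: complex)" using finite_R R_id by auto
  ultimately show ?thesis by (simp only: mult.commute[of h] mult_cancel_left simp_thms)
qed

theorem chi_eq_frobenius_character:
  assumes "\<sigma> \<in> sym_group n"
  shows "chi \<sigma> = of_real (frobenius_character n N x \<sigma>)"
proof -
  let ?\<omega> = "frobenius_character n N x"
  let ?\<chi> = "\<lambda>\<sigma>. Re (chi \<sigma>)"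
  have chi: "chi \<sigma> = of_real (?\<chi> \<sigma>)" for \<sigma>
    using chi_Reals by (simp add: complex_is_Real_iff complex_eq_iff)
  have tw: "(\<Sum>\<sigma> | \<sigma> permutes {1..n}. ?\<chi> \<sigma> * twist_character n N x w \<sigma>) = (if w = id then fact n else 0)"
    if w: "w permutes {1..N}" for w
  proof -
    have "complex_of_real (\<Sum>\<sigma>\<in>sym_group n. ?\<chi> \<sigma> * twist_character n N x w \<sigma>) =
       (\<Sum>\<sigma>\<in>sym_group n. chi \<sigma> * of_real (twist_character n N x w \<sigma>))"
      unfolding of_real_sum of_real_mult chi[symmetric] ..
    also have "\<dots> = fact n / h * (if w = id then h else 0)"
      unfolding pairing_chi[OF class_function_twist] using sum_c_twist[OF w] sum_c_twist_id by simp
    also have "\<dots> = complex_of_real (if w = id then fact n else 0)" using h_nonzero by simp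
    finally show ?thesis by (simp only: of_real_eq_iff)
  qed
  have 1: "(\<Sum>\<sigma>\<in>sym_group n. ?\<chi> \<sigma> * ?\<omega> \<sigma>) = fact n" by (rule pairing_frobenius[OF tw x])
  have 2: "(\<Sum>\<sigma>\<in>sym_group n. ?\<omega> \<sigma> * ?\<omega> \<sigma>) = fact n"
    by (rule pairing_frobenius[OF pairing_twist_character[OF x weight_x] x])
  have "complex_of_real (\<Sum>\<sigma>\<in>sym_group n. ?\<chi> \<sigma> * ?\<chi> \<sigma>) = complex_of_real (fact n)"
    unfolding of_real_sum of_real_mult chi[symmetric] chi_norm by simp
  then have 3: "(\<Sum>\<sigma>\<in>sym_group n. ?\<chi> \<sigma> * ?\<chi> \<sigma>) = fact n" by (simp only: of_real_eq_iff)
  \<comment> \<open>Both functions are real, so a vanishing sum of squares gives pointwise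
    equality.\<close>
  have "(\<Sum>\<sigma>\<in>sym_group n. (?\<chi> \<sigma> - ?\<omega> \<sigma>)\<^sup>2) =
     (\<Sum>\<sigma>\<in>sym_group n. ?\<chi> \<sigma> * ?\<chi> \<sigma>) - 2 * (\<Sum>\<sigma>\<in>sym_group n. ?\<chi> \<sigma> * ?\<omega> \<sigma>)
       + (\<Sum>\<sigma>\<in>sym_group n. ?\<omega> \<sigma> * ?\<omega> \<sigma>)"
    by (simp add: power2_eq_square algebra_simps sum.distrib sum_subtractf sum_distrib_left)
  also have "\<dots> = 0" unfolding 1 2 3 by simp
  finally have "(?\<chi> \<sigma> - ?\<omega> \<sigma>)\<^sup>2 = 0"
    using assms by (subst (asm) sum_nonneg_eq_0_iff) (auto simp: finite_sym_group)
  then show ?thesis using chi[of \<sigma>] by simp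
qed

end

section \<open>The canonical tableau and the conclusion\<close>

lemma canonical_tableau_bij:
  assumes "partition_of n lam"
  shows "bij_betw (canonical_tableau lam) (cells (point_of lam)) {1..n}"
proof -
  let ?s = "\<lambda>i. \<Sum>k=1..<i. part lam k"
  have L: "is_partition lam" and n: "sum_list lam = n"
    using assms by (auto simp: partition_of_def is_partition_def)
  have p: "point_of lam \<in> partition_points (length lam)" by (rule point_of_partition[OF L]) simp
  have cell: "1 \<le> i \<and> i \<le> length lam \<and> 1 \<le> j \<and> j \<le> part lam i" if "(i, j) \<in> cells (point_of lam)" for i j
    using that by (auto simp: cells_def point_of_def part_def split: if_splits)
  \<comment> \<open>The rows occupy disjoint consecutive intervals of numbers; surjectivity then
    follows by counting boxes.\<close>
  have mono: "?s i + part lam i \<le> ?s i'" if "1 \<le> i" "i < i'" for i i'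
  proof -
    have "?s i + part lam i = ?s (Suc i)" using that(1) by simp
    also have "\<dots> \<le> ?s i'" using that by (intro sum_mono2) auto
    finally show ?thesis .
  qed
  have "int (?s (Suc (length lam))) = weight (length lam) (point_of lam)"
    by (simp add: weight_def point_of_def atLeastLessThanSuc_atLeastAtMost)
  then have tot: "?s (Suc (length lam)) = n" using weight_point_of[of lam "length lam"] n by simp
  have inj: "inj_on (canonical_tableau lam) (cells (point_of lam))"
  proof (rule inj_onI, clarify)
    fix i j i' j' assume a: "(i, j) \<in> cells (point_of lam)" "(i', j') \<in> cells (point_of lam)"
      and e: "canonical_tableau lam (i, j) = canonical_tableau lam (i', j')"
    have "\<not> i < i'" "\<not> i' < i"
      using mono[of i i'] mono[of i' i] cell[OF a(1)] cell[OF a(2)] e by (auto simp: canonical_tableau_def)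
    then show "i = i' \<and> j = j'" using e by (simp add: canonical_tableau_def)
  qed
  have "canonical_tableau lam ` cells (point_of lam) \<subseteq> {1..n}"
  proof clarify
    fix i j assume "(i, j) \<in> cells (point_of lam)"
    then show "canonical_tableau lam (i, j) \<in> {1..n}"
      using cell[of i j] mono[of i "Suc (length lam)"] tot by (simp add: canonical_tableau_def)
  qed
  moreover have "card (cells (point_of lam)) = n"
    using card_cells[OF p] weight_point_of[of lam "length lam"] n by simp
  ultimately have "canonical_tableau lam ` cells (point_of lam) = {1..n}"
    using card_image[OF inj] by (intro card_subset_eq) auto
  then show ?thesis using inj by (simp add: bij_betw_def)
qed

text \<open>For the canonical tableau the row and column groups and the Young symmetrizer are
  \<open>R\<close>, \<open>C\<close> and \<open>c\<close> of the locale, so the trace on the Specht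
  module is \<open>chi\<close>.\<close>

lemma irr_character_eq_frobenius_character:
  assumes lam: "partition_of n lam" and \<sigma>: "\<sigma> permutes {1..n}"
  shows "irr_character lam \<sigma> = of_real (frobenius_character n (length lam) (point_of lam) \<sigma>)"
proof -
  let ?T = "canonical_tableau lam" and ?x = "point_of lam"
  have L: "is_partition lam" and n: "sum_list lam = n"
    using lam by (auto simp: partition_of_def is_partition_def)
  interpret young_tableau "length lam" n ?x ?T
    by unfold_locales (use point_of_partition[OF L] canonical_tableau_bij[OF lam] in auto)
  have R: "row_group lam = R"
    unfolding row_group_def R_def n diagram_eq_cells
  proof (intro Collect_cong iffI; elim conjE; intro conjI allI impI ballI)
    fix p y assume p: "\<forall>i j. (i, j) \<in> cells ?x \<longrightarrow> (\<exists>j'. (i, j') \<in> cells ?x \<and> p (?T (i, j)) = ?T (i, j'))"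
      and y: "y \<in> {1..n}"
    then obtain j' where "(row y, j') \<in> cells ?x" "p (?T (row y, column y)) = ?T (row y, j')"
      using cell(1)[OF y] by blast
    then show "row (p y) = row y" using row_column_T(1) cell(2)[OF y] by simp
  next
    fix p i j assume p: "p \<in> sym_group n" "\<forall>y\<in>{1..n}. row (p y) = row y" and ij: "(i, j) \<in> cells ?x"
    let ?y = "?T (i, j)"
    have y: "?y \<in> {1..n}" "row ?y = i" using row_column_T[OF ij] by auto
    have "p ?y \<in> {1..n}" using mem_permute[OF p(1)] y by blast
    then have "(i, column (p ?y)) \<in> cells ?x \<and> p ?y = ?T (i, column (p ?y))"
      using cell[of "p ?y"] p(2) y by auto
    then show "\<exists>j'. (i, j') \<in> cells ?x \<and> p ?y = ?T (i, j')" by blast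
  qed auto
  have C: "column_group lam = C"
    unfolding column_group_def C_def n diagram_eq_cells
  proof (intro Collect_cong iffI; elim conjE; intro conjI allI impI ballI)
    fix p y assume p: "\<forall>i j. (i, j) \<in> cells ?x \<longrightarrow> (\<exists>i'. (i', j) \<in> cells ?x \<and> p (?T (i, j)) = ?T (i', j))"
      and y: "y \<in> {1..n}"
    then obtain i' where "(i', column y) \<in> cells ?x" "p (?T (row y, column y)) = ?T (i', column y)"
      using cell(1)[OF y] by blast
    then show "column (p y) = column y" using row_column_T(2) cell(2)[OF y] by simp
  next
    fix p i j assume p: "p \<in> sym_group n" "\<forall>y\<in>{1..n}. column (p y) = column y" and ij: "(i, j) \<in> cells ?x"
    let ?y = "?T (i, j)"
    have y: "?y \<in> {1..n}" "column ?y = j" using row_column_T[OF ij] by auto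
    have "p ?y \<in> {1..n}" using mem_permute[OF p(1)] y by blast
    then have "(row (p ?y), j) \<in> cells ?x \<and> p ?y = ?T (row (p ?y), j)"
      using cell[of "p ?y"] p(2) y by auto
    then show "\<exists>i'. (i', j) \<in> cells ?x \<and> p ?y = ?T (i', j)" by blast
  qed auto
  have "(\<Sum>p\<in>R. group_elem p) = row_sum"
  proof
    fix g show "(\<Sum>p\<in>R. group_elem p) g = row_sum g"
      using finite_R by (simp add: sum_apply group_elem_def row_sum_def)
  qed
  moreover have "(\<Sum>q\<in>C. (\<lambda>x. of_int (sign q) * group_elem q x)) = column_sum"
  proof
    fix g
    have "(\<Sum>q\<in>C. of_int (sign q) * group_elem q g :: complex) = (\<Sum>q\<in>C. if q = g then of_int (sign q) else 0)"
      by (rule sum.cong) (auto simp: group_elem_def)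
    then show "(\<Sum>q\<in>C. (\<lambda>x. of_int (sign q) * group_elem q x)) g = column_sum g"
      using finite_C by (auto simp: sum_apply column_sum_def)
  qed
  ultimately have "young_symmetrizer lam = c"
    unfolding young_symmetrizer_def R C n c_def by simp
  then have "irr_character lam \<sigma> = chi \<sigma>"
    unfolding irr_character_def specht_module_def n chi_def
    using trace_on_left_ideal[OF c_in_group_alg c_c h_nonzero, of \<sigma>] \<sigma> by simp
  then show ?thesis using chi_eq_frobenius_character[of \<sigma>] \<sigma> by simp
qed

theorem character_expansion:
  assumes "partition_of n lam" "partition_of n mu" "has_cycle_type n \<sigma> mu"
  shows "irr_character lam \<sigma> =
     complex_of_real (\<Sum>rho | is_partition rho \<and> diagram rho \<subseteq> diagram lam.
        (-1) ^ card (diagram rho) * real_of_int (pi_part mu rho)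
          / (H_diag (diagram rho) * H_diag (diagram lam - diagram rho)))"
proof -
  have mu: "sum_list mu = n" "0 \<notin> set mu" using assms(2) by (auto simp: partition_of_def)
  have \<sigma>: "\<sigma> permutes {1..n}" using assms(3) by (simp add: has_cycle_type_def)
  show ?thesis
    unfolding irr_character_eq_frobenius_character[OF assms(1) \<sigma>] pi_expansion[OF assms(1) mu]
      fold_power_op_cycle_type[OF assms(3)] ..
qed

theorem corollary6p3:
  fixes n :: nat and lam mu :: "nat list"
  assumes "partition_of n lam" and "partition_of n mu"
  shows "(\<forall>\<sigma>. has_cycle_type n \<sigma> mu \<longrightarrow>
            irr_character lam \<sigma> =
              complex_of_real (\<Sum>rho | is_partition rho \<and> diagram rho \<subseteq> diagram lam.
                (-1) ^ card (diagram rho) * real_of_int (pi_part mu rho)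
                  / (H_diag (diagram rho) * H_diag (diagram lam - diagram rho))))
       \<and> real (kostka lam mu) =
              (\<Sum>rho | is_partition rho \<and> diagram rho \<subseteq> diagram lam.
                (-1) ^ card (diagram lam - diagram rho) * real_of_int (kappa_part mu rho)
                  / (H_diag (diagram rho) * H_diag (diagram lam - diagram rho)))"
  using character_expansion[OF assms] kostka_expansion[OF assms] by blast

end
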